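(* Let $E$ be a smooth manifold of dimension $n+m$ ($n,m\ge1$) and $\Gamma$ a torsion-free linear connection on $TE\to E$. Then the image of the section $\ddot\Gamma\colon J^1(E,n)\to J^2(E,n)$ associated with $\Gamma$ coincides with the equation $\mathcal S\subset J^2(E,n)$ of unparametrized $n$-dimensional totally geodesic submanifolds of $E$.
   Context: Two $n$-dimensional embedded submanifolds of $E$ through $p$, written locally as $u^i=f^i(u^\lambda)$ and $u^i=f'^i(u^\lambda)$, have contact of order $r$ at $p$ if the Taylor expansion of $f-f'$ vanishes at $p$ up to order $r$. $[L]^r_p$ is the class of $L$ and $J^r(E,n)$ the manifold of all such classes, with charts $(u^\lambda,u^i_\sigma)$, $|\sigma|\le r$, $u^i_\sigma([L]^r_p)=\partial^{|\sigma|}f^i/\partial u^\sigma$; $\pi_{k,h}\colon J^k(E,n)\to J^h(E,n)$ are the projections. Greek indices run in $1..n$, lower-case Latin in $n+1..n+m$, capital in $1..n+m$. With $L^{(r)}=\{[L]^r_p:p\in L\}$, the $R$-plane of $\theta_{r+1}=[L]^{r+1}_p$ is $R_{\theta_{r+1}}=T_{[L]^r_p}L^{(r)}$. $\Gamma_A{}^C{}_B$ denote Christoffel symbols ($\nabla_{\partial_A}\partial_B=\Gamma_A{}^C{}_B\partial_C$). $\mathcal S$ is the zero locus of the universal second fundamental form $\mathrm{II}$ on $J^2(E,n)$: $\mathrm{II}([L]^2_p)\in T_p^*L\odot T_p^*L\otimes(T_pE/T_pL)$ is $(X,Y)\mapsto \nabla_XY \bmod T_pL$ (the second fundamental form of $L$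 at $p$). Locally $\mathcal S$ is $$u^k_{\lambda\xi}+\Gamma_\lambda{}^k{}_\xi+\Gamma_\lambda{}^k{}_iu^i_\xi+\Gamma_j{}^k{}_\xi u^j_\lambda+\Gamma_j{}^k{}_iu^j_\lambda u^i_\xi-u^k_\beta\big(\Gamma_\lambda{}^\beta{}_\xi+\Gamma_\lambda{}^\beta{}_iu^i_\xi+\Gamma_j{}^\beta{}_\xi u^j_\lambda+\Gamma_j{}^\beta{}_iu^j_\lambda u^i_\xi\big)=0.$$ $\dot\Gamma$ is the connection on $\pi_{1,0}$ associated with $\Gamma$, with vertical projection $$\upsilon_{\dot\Gamma}=(du^k_\xi+\dot\Gamma_A{}^k{}_\xi\,du^A)\otimes\partial_{u^k_\xi},\qquad \dot\Gamma_A{}^k{}_\xi=\Gamma_A{}^k{}_\xi+\Gamma_A{}^k{}_iu^i_\xi-u^k_\beta(\Gamma_A{}^\beta{}_\xi+\Gamma_A{}^\beta{}_iu^i_\xi).$$ $\ddot\Gamma$ is the unique section of $\pi_{2,1}$ such that, for every $\theta_1\in J^1(E,n)$, $R_{\ddot\Gamma(\theta_1)}$ is the $\dot\Gamma$-horizontal lift at $\theta_1$ of $R_{\theta_1}\subset T_{\pi_{1,0}(\theta_1)}E$; i.e. $R_{\ddot\Gamma(\theta_1)}$ is spanned by $\partial_{u^\lambda}+u^j_\lambda\partial_{u^j}-(\dot\Gamma_\lambda{}^k{}_\xi+u^j_\lambda\dot\Gamma_j{}^k{}_\xi)\partial_{u^k_\xi}$. *)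

theory Defs
  imports "HOL-Analysis.Analysis"
begin

section \<open>Smooth maps between open subsets of Euclidean spaces\<close>

text \<open>These are meant for open sets \<open>S\<close>; only the values of \<open>f\<close> on \<open>S\<close> matter then.\<close>

fun Ck_on :: "nat \<Rightarrow> 'a::euclidean_space set \<Rightarrow> ('a \<Rightarrow> 'b::euclidean_space) \<Rightarrow> bool" where
  "Ck_on 0 S f \<longleftrightarrow> continuous_on S f"
| "Ck_on (Suc k) S f \<longleftrightarrow>
     (\<forall>x\<in>S. f differentiable (at x)) \<and> (\<forall>v. Ck_on k S (\<lambda>x. frechet_derivative f (at x) v))"

definition smooth_on :: "'a::euclidean_space set \<Rightarrow> ('a \<Rightarrow> 'b::euclidean_space) \<Rightarrow> bool" where
  "smooth_on S f \<longleftrightarrow> (\<forall>k. Ck_on k S f)"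

text \<open>A multi-index of length \<open>r\<close> is given by a list of \<open>r\<close> indices.\<close>

fun iter_partial :: "'n::finite list \<Rightarrow> (real^'n \<Rightarrow> 'b::euclidean_space) \<Rightarrow> real^'n \<Rightarrow> 'b" where
  "iter_partial [] f = f"
| "iter_partial (l # s) f = (\<lambda>x. frechet_derivative (iter_partial s f) (at x) (axis l 1))"


section \<open>Smooth manifolds\<close>

text \<open>A chart is a pair of its domain \<open>U\<close> and a map whose values outside \<open>U\<close> are irrelevant.\<close>

type_synonym ('a, 'v) chart = "'a set \<times> ('a \<Rightarrow> 'v)"

definition chart_inv :: "('a, 'v) chart \<Rightarrow> 'v \<Rightarrow> 'a" where
  "chart_inv c = inv_into (fst c) (snd c)"

definition charts_at :: "('a, 'v) chart set \<Rightarrow> 'a \<Rightarrow> ('a, 'v) chart set" where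
  "charts_at A x = {c \<in> A. x \<in> fst c}"

definition is_chart :: "'a topology \<Rightarrow> ('a, 'v::euclidean_space) chart \<Rightarrow> bool" where
  "is_chart E c \<longleftrightarrow> openin E (fst c) \<and> open (snd c ` fst c) \<and>
     homeomorphic_map (subtopology E (fst c)) (top_of_set (snd c ` fst c)) (snd c)"

definition compatible :: "('a, 'v::euclidean_space) chart \<Rightarrow> ('a, 'v) chart \<Rightarrow> bool" where
  "compatible c d \<longleftrightarrow>
     smooth_on (snd c ` (fst c \<inter> fst d)) (snd d \<circ> chart_inv c) \<and>
     smooth_on (snd d ` (fst c \<inter> fst d)) (snd c \<circ> chart_inv d)"

text \<open>A smooth structure is a maximal atlas; the dimension is that of the model space \<open>'v\<close>.\<close>

definition smooth_manifold :: "'a topology \<Rightarrow> ('a, 'v::euclidean_space) chart set \<Rightarrow> bool" where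
  "smooth_manifold E A \<longleftrightarrow>
     Hausdorff_space E \<and> second_countable E \<and>
     (\<forall>c\<in>A. is_chart E c) \<and> \<Union>(fst ` A) = topspace E \<and>
     (\<forall>c\<in>A. \<forall>d\<in>A. compatible c d) \<and>
     (\<forall>c. is_chart E c \<and> (\<forall>d\<in>A. compatible c d) \<longrightarrow> c \<in> A)"


section \<open>Tangent vectors\<close>

text \<open>
  A tangent vector at \<open>x\<close> is the velocity of a smooth curve through \<open>x\<close>, represented by
  the family of its coordinate vectors in all charts around \<open>x\<close> (and \<open>0\<close> for the other
  charts). Thus \<open>v c\<close> is the coordinate expression of \<open>v\<close> in the chart \<open>c\<close>, and the
  vector space operations are the pointwise ones.  Only the set of charts is used, so that
  the same notions apply to a manifold and to its first jet manifold.
\<close>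

type_synonym ('a, 'v) tvec = "('a, 'v) chart \<Rightarrow> 'v"

definition smooth_curve_at :: "('a, 'v::euclidean_space) chart set \<Rightarrow> 'a \<Rightarrow> (real \<Rightarrow> 'a) \<Rightarrow> bool" where
  "smooth_curve_at A x \<gamma> \<longleftrightarrow> \<gamma> 0 = x \<and>
     (\<forall>c\<in>charts_at A x. \<exists>e>0. \<gamma> ` {-e<..<e} \<subseteq> fst c \<and> smooth_on {-e<..<e} (snd c \<circ> \<gamma>))"

definition velocity :: "('a, 'v::euclidean_space) chart set \<Rightarrow> 'a \<Rightarrow> (real \<Rightarrow> 'a) \<Rightarrow> ('a, 'v) tvec" where
  "velocity A x \<gamma> =
     (\<lambda>c. if c \<in> charts_at A x then vector_derivative (snd c \<circ> \<gamma>) (at 0) else 0)"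

definition tangent_space :: "('a, 'v::euclidean_space) chart set \<Rightarrow> 'a \<Rightarrow> ('a, 'v) tvec set" where
  "tangent_space A x = velocity A x ` {\<gamma>. smooth_curve_at A x \<gamma>}"

text \<open>The tangent space at \<open>x\<close> of a submanifold \<open>N\<close>.\<close>

definition tangent_to ::
    "('a, 'v::euclidean_space) chart set \<Rightarrow> 'a set \<Rightarrow> 'a \<Rightarrow> ('a, 'v) tvec set" where
  "tangent_to A N x =
     velocity A x ` {\<gamma>. smooth_curve_at A x \<gamma> \<and> (\<exists>e>0. \<gamma> ` {-e<..<e} \<subseteq> N)}"

text \<open>
  Below, \<open>the_elem (f ` R)\<close> denotes the common value of \<open>f\<close> on all representatives in \<open>R\<close>.
  The differential at \<open>x\<close> of a smooth map \<open>F\<close> from a manifold with charts \<open>A\<close> to one with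
  charts \<open>B\<close>:
\<close>

definition pushforward ::
    "('a, 'v::euclidean_space) chart set \<Rightarrow> ('b, 'w::euclidean_space) chart set \<Rightarrow> ('a \<Rightarrow> 'b) \<Rightarrow>
     'a \<Rightarrow> ('a, 'v) tvec \<Rightarrow> ('b, 'w) tvec" where
  "pushforward A B F x v =
     the_elem ((\<lambda>\<gamma>. velocity B (F x) (F \<circ> \<gamma>)) ` {\<gamma>. smooth_curve_at A x \<gamma> \<and> velocity A x \<gamma> = v})"

definition tadd :: "('a, 'v::euclidean_space) tvec \<Rightarrow> ('a, 'v) tvec \<Rightarrow> ('a, 'v) tvec" where
  "tadd v w = (\<lambda>c. v c + w c)"

definition tscale :: "real \<Rightarrow> ('a, 'v::euclidean_space) tvec \<Rightarrow> ('a, 'v) tvec" where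
  "tscale r v = (\<lambda>c. r *\<^sub>R v c)"


section \<open>Local functions and vector fields, linear connections\<close>

definition smooth_fun_on ::
    "'a topology \<Rightarrow> ('a, 'v::euclidean_space) chart set \<Rightarrow> 'a set \<Rightarrow> ('a \<Rightarrow> real) \<Rightarrow> bool" where
  "smooth_fun_on E A W f \<longleftrightarrow> openin E W \<and>
     (\<forall>c\<in>A. smooth_on (snd c ` (W \<inter> fst c)) (f \<circ> chart_inv c))"

definition vector_field_on ::
    "'a topology \<Rightarrow> ('a, 'v::euclidean_space) chart set \<Rightarrow> 'a set \<Rightarrow> ('a \<Rightarrow> ('a, 'v) tvec) \<Rightarrow> bool" where
  "vector_field_on E A W Y \<longleftrightarrow> openin E W \<and> (\<forall>q\<in>W. Y q \<in> tangent_space A q) \<and>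
     (\<forall>c\<in>A. smooth_on (snd c ` (W \<inter> fst c)) (\<lambda>x. Y (chart_inv c x) c))"

definition lie_bracket ::
    "('a, 'v::euclidean_space) chart set \<Rightarrow> ('a \<Rightarrow> ('a, 'v) tvec) \<Rightarrow> ('a \<Rightarrow> ('a, 'v) tvec) \<Rightarrow>
     'a \<Rightarrow> ('a, 'v) tvec" where
  "lie_bracket A X Y p = (\<lambda>c. if c \<in> charts_at A p
     then frechet_derivative (\<lambda>x. Y (chart_inv c x) c) (at (snd c p)) (X p c)
        - frechet_derivative (\<lambda>x. X (chart_inv c x) c) (at (snd c p)) (Y p c)
     else 0)"

text \<open>
  A linear connection on the tangent bundle is given by its covariant derivative:
  \<open>D p v Y\<close> is the derivative at \<open>p\<close> of the vector field \<open>Y\<close>, defined on some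
  neighbourhood of \<open>p\<close>, in the direction of the tangent vector \<open>v\<close> at \<open>p\<close>.
\<close>

type_synonym ('a, 'v) covd = "'a \<Rightarrow> ('a, 'v) tvec \<Rightarrow> ('a \<Rightarrow> ('a, 'v) tvec) \<Rightarrow> ('a, 'v) tvec"

definition linear_connection ::
    "'a topology \<Rightarrow> ('a, 'v::euclidean_space) chart set \<Rightarrow> ('a, 'v) covd \<Rightarrow> bool" where
  "linear_connection E A D \<longleftrightarrow>
    \<comment> \<open>as \<open>W\<close> can be shrunk: \<open>D p v Y\<close> depends only on the germ of \<open>Y\<close> at \<open>p\<close>\<close>
    (\<forall>W Y Z. \<forall>p\<in>W. \<forall>v\<in>tangent_space A p.
       vector_field_on E A W Y \<and> vector_field_on E A W Z \<and> (\<forall>q\<in>W. Y q = Z q) \<longrightarrow>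
       D p v Y = D p v Z) \<and>
    (\<forall>W Y. \<forall>p\<in>W. \<forall>v\<in>tangent_space A p. vector_field_on E A W Y \<longrightarrow>
       D p v Y \<in> tangent_space A p) \<and>
    (\<forall>W Y a b. \<forall>p\<in>W. \<forall>v\<in>tangent_space A p. \<forall>w\<in>tangent_space A p.
       vector_field_on E A W Y \<longrightarrow>
       D p (tadd (tscale a v) (tscale b w)) Y = tadd (tscale a (D p v Y)) (tscale b (D p w Y))) \<and>
    (\<forall>W Y Z. \<forall>p\<in>W. \<forall>v\<in>tangent_space A p.
       vector_field_on E A W Y \<and> vector_field_on E A W Z \<longrightarrow>
       D p v (\<lambda>q. tadd (Y q) (Z q)) = tadd (D p v Y) (D p v Z)) \<and>
    \<comment> \<open>Leibniz rule; the derivative of \<open>f\<close> along \<open>v\<close> may be computed in any chart \<open>c\<close>\<close>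
    (\<forall>W Y f. \<forall>p\<in>W. \<forall>v\<in>tangent_space A p. \<forall>c\<in>charts_at A p.
       vector_field_on E A W Y \<and> smooth_fun_on E A W f \<longrightarrow>
       D p v (\<lambda>q. tscale (f q) (Y q)) =
         tadd (tscale (frechet_derivative (f \<circ> chart_inv c) (at (snd c p)) (v c)) (Y p))
              (tscale (f p) (D p v Y))) \<and>
    (\<forall>W X Y. vector_field_on E A W X \<and> vector_field_on E A W Y \<longrightarrow>
       vector_field_on E A W (\<lambda>q. D q (X q) Y))"

definition torsion_free ::
    "'a topology \<Rightarrow> ('a, 'v::euclidean_space) chart set \<Rightarrow> ('a, 'v) covd \<Rightarrow> bool" where
  "torsion_free E A D \<longleftrightarrow> (\<forall>W X Y. \<forall>p\<in>W. vector_field_on E A W X \<and> vector_field_on E A W Y \<longrightarrow>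
     tadd (D p (X p) Y) (tscale (-1) (D p (Y p) X)) = lie_bracket A X Y p)"


section \<open>Jets of submanifolds\<close>

text \<open>
  From now on the model space is \<open>real^('n + 'm)\<close>: indices of the form \<open>Inl \<lambda>\<close> are the
  Greek ones, those of the form \<open>Inr i\<close> the lower-case Latin ones.
\<close>

definition indep :: "real^('n::finite + 'm::finite) \<Rightarrow> real^'n" where
  "indep x = (\<chi> l. x $ Inl l)"

definition dep :: "real^('n::finite + 'm::finite) \<Rightarrow> real^'m" where
  "dep x = (\<chi> i. x $ Inr i)"

text \<open>Near \<open>p \<in> L\<close>, the set \<open>L\<close> is given by \<open>u\<^sup>i = f\<^sup>i(u\<^sup>\<lambda>)\<close> in the chart \<open>c\<close>.\<close>

definition graph_at ::
    "'e topology \<Rightarrow> ('e, real^('n::finite + 'm::finite)) chart \<Rightarrow> 'e \<Rightarrow> 'e set \<Rightarrow>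
     (real^'n \<Rightarrow> real^'m) \<Rightarrow> bool" where
  "graph_at E c p L f \<longleftrightarrow> p \<in> L \<and>
     (\<exists>W. openin E W \<and> p \<in> W \<and> W \<subseteq> fst c \<and>
          smooth_on (indep ` snd c ` W) f \<and>
          L \<inter> W = {q \<in> W. dep (snd c q) = f (indep (snd c q))})"

text \<open>Embedded submanifolds of dimension \<open>CARD('n)\<close>.\<close>

definition submanifold ::
    "'e topology \<Rightarrow> ('e, real^('n::finite + 'm::finite)) chart set \<Rightarrow> 'e set \<Rightarrow> bool" where
  "submanifold E A L \<longleftrightarrow> L \<subseteq> topspace E \<and>
     (\<forall>p\<in>L. \<exists>c\<in>charts_at A p. \<exists>f. graph_at E c p L f)"

definition contact ::
    "'e topology \<Rightarrow> ('e, real^('n::finite + 'm::finite)) chart set \<Rightarrow> nat \<Rightarrow> 'e \<Rightarrow>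
     'e set \<Rightarrow> 'e set \<Rightarrow> bool" where
  "contact E A r p L L' \<longleftrightarrow>
     (\<exists>c\<in>charts_at A p. \<exists>f f'. graph_at E c p L f \<and> graph_at E c p L' f' \<and>
        (\<forall>s. length s \<le> r \<longrightarrow> iter_partial s (\<lambda>x. f x - f' x) (indep (snd c p)) = 0))"

text \<open>A jet is a point together with a contact class of submanifolds through it.\<close>

type_synonym 'e jet = "'e \<times> 'e set set"

definition jet ::
    "'e topology \<Rightarrow> ('e, real^('n::finite + 'm::finite)) chart set \<Rightarrow> nat \<Rightarrow> 'e \<Rightarrow> 'e set \<Rightarrow>
     'e jet" where
  "jet E A r p L = (p, {L'. submanifold E A L' \<and> p \<in> L' \<and> contact E A r p L L'})"

definition jets ::
    "'e topology \<Rightarrow> ('e, real^('n::finite + 'm::finite)) chart set \<Rightarrow> nat \<Rightarrow> 'e jet set" where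
  "jets E A r = {jet E A r p L | p L. submanifold E A L \<and> p \<in> L}"

text \<open>
  The projection onto the jets of order \<open>h\<close>.  The projection of jets (of positive order)
  onto \<open>E\<close> itself is \<open>fst\<close>.
\<close>

definition jet_proj ::
    "'e topology \<Rightarrow> ('e, real^('n::finite + 'm::finite)) chart set \<Rightarrow> nat \<Rightarrow> 'e jet \<Rightarrow>
     'e jet" where
  "jet_proj E A h \<theta> = the_elem (jet E A h (fst \<theta>) ` snd \<theta>)"

definition prolongation ::
    "'e topology \<Rightarrow> ('e, real^('n::finite + 'm::finite)) chart set \<Rightarrow> nat \<Rightarrow> 'e set \<Rightarrow>
     'e jet set" where
  "prolongation E A r L = (\<lambda>p. jet E A r p L) ` L"

text \<open>The jet coordinate \<open>u\<^sup>i\<^sub>s(\<theta>)\<close> in the chart \<open>c\<close>.\<close>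

definition jet_coord ::
    "'e topology \<Rightarrow> ('e, real^('n::finite + 'm::finite)) chart \<Rightarrow> 'm \<Rightarrow> 'n list \<Rightarrow> 'e jet \<Rightarrow>
     real" where
  "jet_coord E c i s \<theta> =
     the_elem {iter_partial s f (indep (snd c (fst \<theta>))) $ i | L f.
                 L \<in> snd \<theta> \<and> graph_at E c (fst \<theta>) L f}"

text \<open>The chart \<open>(u\<^sup>A, u\<^sup>i\<^sub>\<lambda>)\<close> of the manifold of 1-jets induced by a chart \<open>c\<close> of \<open>E\<close>.\<close>

definition jet1_chart ::
    "'e topology \<Rightarrow> ('e, real^('n::finite + 'm::finite)) chart set \<Rightarrow>
     ('e, real^('n + 'm)) chart \<Rightarrow> ('e jet, (real^('n + 'm)) \<times> (real^'n^'m)) chart" where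
  "jet1_chart E A c =
     ({\<theta> \<in> jets E A 1. fst \<theta> \<in> fst c \<and> (\<exists>L\<in>snd \<theta>. \<exists>f. graph_at E c (fst \<theta>) L f)},
      \<lambda>\<theta>. (snd c (fst \<theta>), \<chi> i l. jet_coord E c i [l] \<theta>))"

definition jet1_atlas ::
    "'e topology \<Rightarrow> ('e, real^('n::finite + 'm::finite)) chart set \<Rightarrow>
     ('e jet, (real^('n + 'm)) \<times> (real^'n^'m)) chart set" where
  "jet1_atlas E A = jet1_chart E A ` A"

text \<open>
  The \<open>R\<close>-planes of a 1-jet and of a 2-jet.  The former is the tangent space
  \<open>T\<^sub>pL\<close>, as the 0-th prolongation of \<open>L\<close> is \<open>L\<close>.
\<close>

definition R_plane1 ::
    "('e, real^('n::finite + 'm::finite)) chart set \<Rightarrow> 'e jet \<Rightarrow>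
     ('e, real^('n + 'm)) tvec set" where
  "R_plane1 A \<theta> = the_elem ((\<lambda>L. tangent_to A L (fst \<theta>)) ` snd \<theta>)"

definition R_plane2 ::
    "'e topology \<Rightarrow> ('e, real^('n::finite + 'm::finite)) chart set \<Rightarrow> 'e jet \<Rightarrow>
     ('e jet, (real^('n + 'm)) \<times> (real^'n^'m)) tvec set" where
  "R_plane2 E A \<theta> =
     the_elem ((\<lambda>L. tangent_to (jet1_atlas E A) (prolongation E A 1 L) (jet E A 1 (fst \<theta>) L)) ` snd \<theta>)"


section \<open>The equation of totally geodesic submanifolds\<close>

text \<open>The class of \<open>v\<close> modulo a subspace \<open>P\<close> of the tangent space.\<close>

definition tcoset ::
    "('a, 'v::euclidean_space) tvec set \<Rightarrow> ('a, 'v) tvec \<Rightarrow> ('a, 'v) tvec set" where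
  "tcoset P v = tadd v ` P"

text \<open>
  The second fundamental form of \<open>L\<close> at \<open>p\<close>.  Here \<open>Y\<close> ranges over the vector fields
  around \<open>p\<close> that are tangent to \<open>L\<close> at the points of \<open>L\<close> and extend \<open>y\<close>.
\<close>

definition second_fundamental_form ::
    "'e topology \<Rightarrow> ('e, real^('n::finite + 'm::finite)) chart set \<Rightarrow> ('e, real^('n + 'm)) covd \<Rightarrow>
     'e set \<Rightarrow> 'e \<Rightarrow> ('e, real^('n + 'm)) tvec \<Rightarrow> ('e, real^('n + 'm)) tvec \<Rightarrow>
     ('e, real^('n + 'm)) tvec set" where
  "second_fundamental_form E A D L p x y =
     the_elem {tcoset (tangent_to A L p) (D p x Y) | W Y.
        vector_field_on E A W Y \<and> p \<in> W \<and> (\<forall>q\<in>L \<inter> W. Y q \<in> tangent_to A L q) \<and> Y p = y}"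

definition universal_II ::
    "'e topology \<Rightarrow> ('e, real^('n::finite + 'm::finite)) chart set \<Rightarrow> ('e, real^('n + 'm)) covd \<Rightarrow>
     'e jet \<Rightarrow> ('e, real^('n + 'm)) tvec \<Rightarrow> ('e, real^('n + 'm)) tvec \<Rightarrow>
     ('e, real^('n + 'm)) tvec set" where
  "universal_II E A D \<theta> x y =
     the_elem ((\<lambda>L. second_fundamental_form E A D L (fst \<theta>) x y) ` snd \<theta>)"

text \<open>The zero of the quotient modulo \<open>P\<close> is the coset \<open>P\<close> itself.\<close>

definition totally_geodesic_eq ::
    "'e topology \<Rightarrow> ('e, real^('n::finite + 'm::finite)) chart set \<Rightarrow> ('e, real^('n + 'm)) covd \<Rightarrow>
     'e jet set" where
  "totally_geodesic_eq E A D =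
     {\<theta> \<in> jets E A 2.
        let P = R_plane1 A (jet_proj E A 1 \<theta>) in \<forall>x\<in>P. \<forall>y\<in>P. universal_II E A D \<theta> x y = P}"


section \<open>The connection on 1-jets and the associated section\<close>

text \<open>The coordinate vector field \<open>\<partial>\<^sub>b\<close> of the chart \<open>c\<close>.\<close>

definition coord_field ::
    "('e, real^('k::finite)) chart set \<Rightarrow> ('e, real^'k) chart \<Rightarrow> 'k \<Rightarrow> 'e \<Rightarrow>
     ('e, real^'k) tvec" where
  "coord_field A c b q = velocity A q (\<lambda>t. chart_inv c (snd c q + t *\<^sub>R axis b 1))"

text \<open>
  \<open>christoffel A D c p a k b\<close> is the coefficient of \<open>\<partial>\<^sub>k\<close> in the covariant derivative
  of \<open>\<partial>\<^sub>b\<close> along \<open>\<partial>\<^sub>a\<close> at \<open>p\<close>; in \<open>gamma_dot\<close> the middle index is a dependent one.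
\<close>

definition christoffel ::
    "('e, real^('k::finite)) chart set \<Rightarrow> ('e, real^'k) covd \<Rightarrow> ('e, real^'k) chart \<Rightarrow> 'e \<Rightarrow>
     'k \<Rightarrow> 'k \<Rightarrow> 'k \<Rightarrow> real" where
  "christoffel A D c p a k b = D p (coord_field A c a p) (coord_field A c b) c $ k"

definition gamma_dot ::
    "'e topology \<Rightarrow> ('e, real^('n::finite + 'm::finite)) chart set \<Rightarrow> ('e, real^('n + 'm)) covd \<Rightarrow>
     ('e, real^('n + 'm)) chart \<Rightarrow> 'e jet \<Rightarrow> 'n + 'm \<Rightarrow> 'm \<Rightarrow> 'n \<Rightarrow> real" where
  "gamma_dot E A D c \<theta> a k \<xi> =
     (let G = christoffel A D c (fst \<theta>); u = (\<lambda>i l. jet_coord E c i [l] \<theta>) in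
        G a (Inr k) (Inl \<xi>) + (\<Sum>i\<in>UNIV. G a (Inr k) (Inr i) * u i \<xi>)
        - (\<Sum>\<beta>\<in>UNIV. u k \<beta> * (G a (Inl \<beta>) (Inl \<xi>) + (\<Sum>i\<in>UNIV. G a (Inl \<beta>) (Inr i) * u i \<xi>))))"

text \<open>
  The components, with respect to \<open>\<partial>/\<partial>u\<^sup>k\<^sub>\<xi>\<close>, of the vertical projection
  of a tangent vector \<open>v\<close> of the manifold of 1-jets at \<open>\<theta>\<close>.
\<close>

definition vertical_projection ::
    "'e topology \<Rightarrow> ('e, real^('n::finite + 'm::finite)) chart set \<Rightarrow> ('e, real^('n + 'm)) covd \<Rightarrow>
     ('e, real^('n + 'm)) chart \<Rightarrow> 'e jet \<Rightarrow>
     ('e jet, (real^('n + 'm)) \<times> (real^'n^'m)) tvec \<Rightarrow> real^'n^'m" where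
  "vertical_projection E A D c \<theta> v =
     (let du = v (jet1_chart E A c) in
        \<chi> k \<xi>. snd du $ k $ \<xi> + (\<Sum>a\<in>UNIV. gamma_dot E A D c \<theta> a k \<xi> * fst du $ a))"

text \<open>
  The horizontal lift of \<open>P\<close>: the coordinate expression of the vertical projection is
  required to vanish in every chart induced from \<open>E\<close>, so that no chart has to be selected.
\<close>

definition horizontal_lift ::
    "'e topology \<Rightarrow> ('e, real^('n::finite + 'm::finite)) chart set \<Rightarrow> ('e, real^('n + 'm)) covd \<Rightarrow>
     'e jet \<Rightarrow> ('e, real^('n + 'm)) tvec set \<Rightarrow>
     ('e jet, (real^('n + 'm)) \<times> (real^'n^'m)) tvec set" where
  "horizontal_lift E A D \<theta> P =
     {v \<in> tangent_space (jet1_atlas E A) \<theta>.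
        pushforward (jet1_atlas E A) A fst \<theta> v \<in> P \<and>
        (\<forall>c\<in>A. \<theta> \<in> fst (jet1_chart E A c) \<longrightarrow> vertical_projection E A D c \<theta> v = 0)}"

definition gamma_ddot ::
    "'e topology \<Rightarrow> ('e, real^('n::finite + 'm::finite)) chart set \<Rightarrow> ('e, real^('n + 'm)) covd \<Rightarrow>
     'e jet \<Rightarrow> 'e jet" where
  "gamma_ddot E A D \<theta>\<^sub>1 =
     (THE \<theta>\<^sub>2. \<theta>\<^sub>2 \<in> jets E A 2 \<and> jet_proj E A 1 \<theta>\<^sub>2 = \<theta>\<^sub>1 \<and>
        R_plane2 E A \<theta>\<^sub>2 = horizontal_lift E A D \<theta>\<^sub>1 (R_plane1 A \<theta>\<^sub>1))"

end

theory Submission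
  imports Defs
begin



text \<open>
  Fix a 2-jet \<open>[L]\<^sup>2\<^sub>p\<close> and a chart in which \<open>L\<close> is the graph of \<open>f\<close>. Membership in the equation of
  totally geodesic submanifolds and horizontality of the \<open>R\<close>-plane are both equivalent to the same
  condition on \<open>f\<close> at \<open>p\<close>, the vanishing of
  \<open>D\<^sup>2f(v, w) + N(\<Gamma>(w', v'))\<close> for all \<open>v\<close> and \<open>w\<close>. Here \<open>v' = (v, Df v)\<close> is the tangent
  vector of \<open>L\<close> over \<open>v\<close>, \<open>\<Gamma>\<close> is the bilinear form of the Christoffel symbols, and \<open>N(a, b) = b - Df a\<close>
  is the projection along \<open>T\<^sub>pL\<close>.

  For the equation: a vector field \<open>Y\<close> tangent to \<open>L\<close> satisfies \<open>N(Y) = 0\<close> along \<open>L\<close>. Differentiating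
  this relation shows that the normal part of the derivative of \<open>Y\<close> is a second derivative of \<open>f\<close>,
  independently of the extension \<open>Y\<close> (\<open>normal_part_covd\<close>, \<open>totally_geodesic_iff\<close>).
  For the \<open>R\<close>-plane: it consists of the velocities of the curves of 1-jets of \<open>L\<close>, whose coordinates
  are again the second derivatives of \<open>f\<close> (\<open>tangent_to_prolongation\<close>). Inserting them into the
  vertical projection gives the same expression (\<open>vertical_projection_prolonged\<close>,
  \<open>totally_geodesic_iff_horizontal\<close>).

  It remains to see that the equation contains exactly one 2-jet over each 1-jet, so that the
  section is well defined and takes its values there. In a chart, the first derivative determines
  the second one (\<open>geodesic_jet_unique\<close>); a function with this second derivative exists because the
  prescribed bilinear form is symmetric, which is where the absence of torsion enters
  (\<open>geodesic_jet_exists\<close>).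

  All of this presupposes that contact of order one or two is an equivalence relation that can be
  tested in every chart adapted to one of the submanifolds (\<open>contact_in_chart\<close>). A submanifold is a
  graph in a chart as soon as its tangent space is transversal to the fibres of the chart, by the
  inverse function theorem (\<open>graph_in_chart\<close>), and the derivatives of the graphing functions in two
  charts determine each other by the chain rule (\<open>graph_change\<close>).
\<close>


section \<open>Calculus of smooth maps\<close>

lemma has_derivative_frechet:
  "f differentiable at x \<Longrightarrow> (f has_derivative frechet_derivative f (at x)) (at x)"
  using frechet_derivative_works by blast

lemma linear_frechet: "f differentiable at x \<Longrightarrow> linear (frechet_derivative f (at x))"
  using has_derivative_frechet has_derivative_linear by blast

lemma frechetI: "(f has_derivative f') (at x) \<Longrightarrow> frechet_derivative f (at x) = f'"
  using frechet_derivative_at by metis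

lemma frechet_cong_open:
  assumes "open S" "x \<in> S" "\<And>y. y \<in> S \<Longrightarrow> f y = g y"
  shows "frechet_derivative f (at x) = frechet_derivative g (at x)"
proof -
  have "(f has_derivative f') (at x) \<longleftrightarrow> (g has_derivative f') (at x)" for f'
    using has_derivative_transform_within_open[OF _ assms(1,2), of f f' UNIV g]
      has_derivative_transform_within_open[OF _ assms(1,2), of g f' UNIV f] assms(3) by auto
  then show ?thesis unfolding frechet_derivative_def by simp
qed

lemma differentiable_cong_open:
  assumes "open S" "x \<in> S" "\<And>y. y \<in> S \<Longrightarrow> f y = g y" "f differentiable at x"
  shows "g differentiable at x"
  using has_derivative_transform_within_open[OF _ assms(1,2), of f _ UNIV g] assms(3,4)
  unfolding differentiable_def by fastforce

lemma Ck_on_cong: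
  assumes "open S" "\<And>x. x \<in> S \<Longrightarrow> f x = g x" "Ck_on k S f"
  shows "Ck_on k S g"
  using assms(2,3)
proof (induction k arbitrary: f g)
  case 0
  then show ?case using continuous_on_cong[of S S f g] by simp
next
  case (Suc k)
  have "g differentiable at x" if "x \<in> S" for x
    using differentiable_cong_open[OF assms(1) that, of f g] Suc.prems that by auto
  moreover have "Ck_on k S (\<lambda>x. frechet_derivative g (at x) v)" for v
    by (rule Suc.IH[of "\<lambda>x. frechet_derivative f (at x) v"])
      (use Suc.prems frechet_cong_open[OF assms(1), of _ f g] in auto)
  ultimately show ?case by simp
qed

lemma Ck_on_subset: "Ck_on k S f \<Longrightarrow> T \<subseteq> S \<Longrightarrow> Ck_on k T f"
  by (induction k arbitrary: f) (auto intro: continuous_on_subset)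

lemma Ck_on_Suc_imp: "Ck_on (Suc k) S f \<Longrightarrow> Ck_on k S f"
proof (induction k arbitrary: f)
  case 0
  then have "f differentiable at x" if "x \<in> S" for x using that by simp
  then have "continuous_on S f"
    by (meson continuous_at_imp_continuous_on differentiable_imp_continuous_within)
  then show ?case by simp
next
  case (Suc k)
  then have "f differentiable at x" if "x \<in> S" for x using that by simp
  moreover have "Ck_on k S (\<lambda>x. frechet_derivative f (at x) v)" for v
    by (rule Suc.IH) (use Suc.prems in simp)
  ultimately show ?case by simp
qed

text \<open>
  Derivatives are named by \<^const>\<open>frechet_derivative\<close> in the definition of \<^const>\<open>Ck_on\<close>; this
  rule lets the closure properties below be proved with derivatives in any closed form.
\<close>

lemma Ck_on_SucI:
  assumes "open S" "\<And>x. x \<in> S \<Longrightarrow> (f has_derivative f' x) (at x)"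
    and "\<And>v. Ck_on k S (\<lambda>x. f' x v)"
  shows "Ck_on (Suc k) S f"
proof -
  have "Ck_on k S (\<lambda>x. frechet_derivative f (at x) v)" for v
    by (rule Ck_on_cong[OF assms(1) _ assms(3)[of v]]) (simp add: frechetI[OF assms(2)])
  then show ?thesis using assms(2) by (auto simp: differentiable_def)
qed

lemma Ck_on_has_derivative:
  "Ck_on (Suc k) S f \<Longrightarrow> x \<in> S \<Longrightarrow> (f has_derivative frechet_derivative f (at x)) (at x)"
  by (simp add: has_derivative_frechet)

lemma Ck_on_const: "Ck_on k S (\<lambda>x. c)"
  by (induction k arbitrary: c) auto

lemma Ck_on_linear_comp:
  assumes L: "bounded_linear L" and S: "open S" and "Ck_on k S f"
  shows "Ck_on k S (\<lambda>x. L (f x))"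
  using assms(3)
proof (induction k arbitrary: f)
  case 0
  then show ?case using bounded_linear.continuous_on[OF L] by simp
next
  case (Suc k)
  show ?case
    by (rule Ck_on_SucI[OF S bounded_linear.has_derivative[OF L Ck_on_has_derivative[OF Suc.prems]]])
      (use Suc in auto)
qed

lemma Ck_on_add:
  assumes S: "open S" and "Ck_on k S f" "Ck_on k S g"
  shows "Ck_on k S (\<lambda>x. f x + g x)"
  using assms(2,3)
proof (induction k arbitrary: f g)
  case 0
  then show ?case by (simp add: continuous_on_add)
next
  case (Suc k)
  show ?case
    by (rule Ck_on_SucI[OF S has_derivative_add[OF Ck_on_has_derivative[OF Suc.prems(1)]
        Ck_on_has_derivative[OF Suc.prems(2)]]]) (use Suc in auto)
qed

lemma Ck_on_sum:
  assumes S: "open S" and "\<And>i. i \<in> I \<Longrightarrow> Ck_on k S (f i)"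
  shows "Ck_on k S (\<lambda>x. \<Sum>i\<in>I. f i x)"
  using assms(2)
  by (induction I rule: infinite_finite_induct) (auto intro: Ck_on_const Ck_on_add[OF S])

lemma Ck_on_bilinear:
  assumes B: "bounded_bilinear B" and S: "open S" and "Ck_on k S f" "Ck_on k S g"
  shows "Ck_on k S (\<lambda>x. B (f x) (g x))"
  using assms(3,4)
proof (induction k arbitrary: f g)
  case 0
  then show ?case using bounded_bilinear.continuous_on[OF B] by simp
next
  case (Suc k)
  show ?case
    by (rule Ck_on_SucI[OF S bounded_bilinear.FDERIV[OF B Ck_on_has_derivative[OF Suc.prems(1)]
        Ck_on_has_derivative[OF Suc.prems(2)]]])
      (use Suc Ck_on_Suc_imp[OF Suc.prems(1)] Ck_on_Suc_imp[OF Suc.prems(2)] in \<open>auto intro!: Ck_on_add[OF S]\<close>)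
qed

lemma linear_expand:
  fixes f :: "'a::euclidean_space \<Rightarrow> 'b::real_vector"
  assumes "linear f"
  shows "f v = (\<Sum>b\<in>Basis. (v \<bullet> b) *\<^sub>R f b)"
  by (subst euclidean_representation[of v, symmetric])
    (simp add: linear_sum[OF assms] linear_cmul[OF assms])

lemma basis_expansion_scaleR: "(\<Sum>i\<in>UNIV. (x $ i) *\<^sub>R axis i 1) = (x :: real^'k::finite)"
  using basis_expansion[of x] by (simp add: scalar_mult_eq_scaleR)

lemma linear_expand_axis:
  fixes h :: "real^'k::finite \<Rightarrow> 'b::real_vector"
  assumes "linear h"
  shows "h z = (\<Sum>i\<in>UNIV. (z $ i) *\<^sub>R h (axis i 1))"
proof -
  have "h z = h (\<Sum>i\<in>UNIV. (z $ i) *\<^sub>R axis i 1)" by (simp only: basis_expansion_scaleR)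
  also have "\<dots> = (\<Sum>i\<in>UNIV. (z $ i) *\<^sub>R h (axis i 1))"
    by (simp add: linear_sum[OF assms] linear_cmul[OF assms])
  finally show ?thesis .
qed

lemma linear_eq_axisI:
  fixes f g :: "real^'n \<Rightarrow> 'b::real_vector"
  assumes "linear f" "linear g" "\<And>l. f (axis l 1) = g (axis l 1)"
  shows "f v = g v"
proof -
  have "f b = g b" if "b \<in> Basis" for b
    using that assms(3) by (auto simp: Basis_vec_def)
  then show ?thesis
    unfolding linear_expand[OF assms(1), of v] linear_expand[OF assms(2), of v] by simp
qed

lemma Ck_on_compose:
  assumes S: "open S" and T: "open T" and "Ck_on k S f" "Ck_on k T g" "f ` S \<subseteq> T"
  shows "Ck_on k S (\<lambda>x. g (f x))"
  using assms(3,4)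
proof (induction k arbitrary: g)
  case 0
  then show ?case using continuous_on_compose2[of T g S f] assms(5) by auto
next
  case (Suc k)
  have fS: "f x \<in> T" if "x \<in> S" for x using that assms(5) by auto
  have lin: "linear (frechet_derivative g (at (f x)))" if "x \<in> S" for x
    using Suc.prems(2) fS[OF that] by (auto intro: linear_frechet)
  have der: "((\<lambda>x. g (f x)) has_derivative (\<lambda>v. \<Sum>b\<in>Basis.
      (frechet_derivative f (at x) v \<bullet> b) *\<^sub>R frechet_derivative g (at (f x)) b)) (at x)"
    if "x \<in> S" for x
    using has_derivative_compose[OF Ck_on_has_derivative[OF Suc.prems(1) that]
        Ck_on_has_derivative[OF Suc.prems(2) fS[OF that]]]
    by (subst linear_expand[OF lin[OF that], symmetric])
  have f: "Ck_on k S f" using Suc.prems Ck_on_Suc_imp by blast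
  have "Ck_on k S (\<lambda>x. \<Sum>b\<in>Basis.
      (frechet_derivative f (at x) v \<bullet> b) *\<^sub>R frechet_derivative g (at (f x)) b)" for v
    by (intro Ck_on_sum[OF S] Ck_on_bilinear[OF bounded_bilinear_scaleR S]
        Ck_on_linear_comp[OF bounded_linear_inner_left S] Suc.IH[OF f]) (use Suc.prems in auto)
  from Ck_on_SucI[OF S der this] show ?case .
qed

lemma Ck_on_componentwise:
  assumes S: "open S" and "\<And>b. b \<in> Basis \<Longrightarrow> Ck_on k S (\<lambda>x. f x \<bullet> b)"
  shows "Ck_on k S f"
proof -
  have "Ck_on k S (\<lambda>x. \<Sum>b\<in>Basis. (f x \<bullet> b) *\<^sub>R b)"
    by (intro Ck_on_sum[OF S] Ck_on_linear_comp[OF bounded_linear_scaleR_left S] assms(2))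
  then show ?thesis by (simp add: euclidean_representation)
qed

lemma Ck_on_inverse:
  fixes f :: "'a::euclidean_space \<Rightarrow> real"
  assumes S: "open S" and f: "Ck_on k S f" and nz: "\<And>x. x \<in> S \<Longrightarrow> f x \<noteq> 0"
  shows "Ck_on k S (\<lambda>x. inverse (f x))"
  using f
proof (induction k)
  case 0
  then show ?case using nz by (auto intro!: continuous_on_inverse)
next
  case (Suc k)
  note mult = Ck_on_bilinear[OF bounded_bilinear_mult S]
  have i: "Ck_on k S (\<lambda>x. inverse (f x))" using Suc Ck_on_Suc_imp by blast
  have "Ck_on (Suc k) S (\<lambda>x. inverse (f x)) \<longleftrightarrow> True"
    unfolding eq_True
    by (rule Ck_on_SucI[OF S Deriv.has_derivative_inverse[OF nz Ck_on_has_derivative[OF Suc.prems]]])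
      (use Suc.prems in \<open>auto intro!: mult i Ck_on_linear_comp[OF bounded_linear_minus[OF bounded_linear_ident] S]\<close>)
  then show ?case by simp
qed

lemma Ck_on_prod:
  fixes f :: "'i \<Rightarrow> 'a::euclidean_space \<Rightarrow> real"
  assumes S: "open S" and "\<And>i. i \<in> I \<Longrightarrow> Ck_on k S (f i)"
  shows "Ck_on k S (\<lambda>x. \<Prod>i\<in>I. f i x)"
  using assms(2)
  by (induction I rule: infinite_finite_induct)
    (auto intro: Ck_on_const Ck_on_bilinear[OF bounded_bilinear_mult S])

lemma Ck_on_vec:
  fixes f :: "'a::euclidean_space \<Rightarrow> 'b::euclidean_space ^ 'n"
  assumes S: "open S" and f: "\<And>i. Ck_on k S (\<lambda>x. f x $ i)"
  shows "Ck_on k S f"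
proof (rule Ck_on_componentwise[OF S])
  fix b :: "'b ^ 'n" assume "b \<in> Basis"
  then obtain i u where "b = axis i u" by (auto simp: Basis_vec_def)
  then show "Ck_on k S (\<lambda>x. f x \<bullet> b)"
    by (simp add: inner_axis Ck_on_linear_comp[OF bounded_linear_inner_left S f])
qed

lemma Ck_on_vec_nth:
  assumes S: "open S" and f: "Ck_on k S f"
  shows "Ck_on k S (\<lambda>x. f x $ i)"
  by (rule Ck_on_linear_comp[OF bounded_linear_vec_nth S f])

lemma Ck_on_det:
  fixes M :: "'a::euclidean_space \<Rightarrow> real^'n^'n"
  assumes S: "open S" and M: "\<And>i j. Ck_on k S (\<lambda>x. M x $ i $ j)"
  shows "Ck_on k S (\<lambda>x. det (M x))"
  unfolding det_def
  by (intro Ck_on_sum[OF S] Ck_on_bilinear[OF bounded_bilinear_mult S] Ck_on_const Ck_on_prod[OF S] M)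

text \<open>By Cramer's rule the solution is a quotient of determinants of smooth matrices.\<close>

lemma Ck_on_linear_solve:
  fixes M :: "'a::euclidean_space \<Rightarrow> real^'n^'n"
  assumes S: "open S" and M: "\<And>i j. Ck_on k S (\<lambda>x. M x $ i $ j)"
    and nz: "\<And>x. x \<in> S \<Longrightarrow> det (M x) \<noteq> 0" and w: "\<And>x. x \<in> S \<Longrightarrow> M x *v w x = v"
  shows "Ck_on k S w"
proof (rule Ck_on_cong[OF S])
  let ?c = "\<lambda>x l. det (\<chi> i j. if j = l then v $ i else M x $ i $ j)"
  show "(\<chi> l. ?c x l * inverse (det (M x))) = w x" if "x \<in> S" for x
    using cramer[OF nz[OF that], of "w x" v] w[OF that] by (simp add: divide_inverse)
  show "Ck_on k S (\<lambda>x. \<chi> l. ?c x l * inverse (det (M x)))"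
  proof (rule Ck_on_vec[OF S])
    fix l
    have "Ck_on k S (\<lambda>x. if j = l then v $ i else M x $ i $ j)" for i j
      using M by (cases "j = l") (auto intro: Ck_on_const)
    then have "Ck_on k S (\<lambda>x. ?c x l)"
      by (intro Ck_on_det[OF S]) simp
    moreover have "Ck_on k S (\<lambda>x. inverse (det (M x)))"
      by (rule Ck_on_inverse[OF S Ck_on_det[OF S M] nz])
    ultimately show "Ck_on k S (\<lambda>x. (\<chi> l. ?c x l * inverse (det (M x))) $ l)"
      by (simp add: Ck_on_bilinear[OF bounded_bilinear_mult S])
  qed
qed

subsection \<open>Smooth maps\<close>

lemma smooth_on_cong:
  "open S \<Longrightarrow> (\<And>x. x \<in> S \<Longrightarrow> f x = g x) \<Longrightarrow> smooth_on S f \<Longrightarrow> smooth_on S g"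
  unfolding smooth_on_def using Ck_on_cong by blast

lemma smooth_on_subset: "smooth_on S f \<Longrightarrow> T \<subseteq> S \<Longrightarrow> smooth_on T f"
  unfolding smooth_on_def using Ck_on_subset by blast

lemma smooth_on_differentiable: "smooth_on S f \<Longrightarrow> x \<in> S \<Longrightarrow> f differentiable at x"
  unfolding smooth_on_def using Ck_on.simps(2)[of 0 S f] by blast

lemma smooth_on_continuous: "smooth_on S f \<Longrightarrow> continuous_on S f"
  unfolding smooth_on_def using Ck_on.simps(1)[of S f] by blast

lemma smooth_on_derivative: "smooth_on S f \<Longrightarrow> smooth_on S (\<lambda>x. frechet_derivative f (at x) v)"
  unfolding smooth_on_def using Ck_on.simps(2) by blast

lemma smooth_on_const: "smooth_on S (\<lambda>x. c)"
  unfolding smooth_on_def by (simp add: Ck_on_const)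

lemma smooth_on_linear_comp:
  "bounded_linear L \<Longrightarrow> open S \<Longrightarrow> smooth_on S f \<Longrightarrow> smooth_on S (\<lambda>x. L (f x))"
  unfolding smooth_on_def by (simp add: Ck_on_linear_comp)

lemma smooth_on_linear:
  assumes "bounded_linear L" "open S"
  shows "smooth_on S L"
proof -
  have "Ck_on k S L" for k
  proof (cases k)
    case 0
    then show ?thesis using assms by (simp add: linear_continuous_on)
  next
    case (Suc j)
    then show ?thesis
      using Ck_on_SucI[OF assms(2) bounded_linear_imp_has_derivative[OF assms(1)] Ck_on_const] by simp
  qed
  then show ?thesis by (simp add: smooth_on_def)
qed

lemma smooth_on_id: "open S \<Longrightarrow> smooth_on S (\<lambda>x. x)"
  by (rule smooth_on_linear[OF bounded_linear_ident])

lemma smooth_on_add: "open S \<Longrightarrow> smooth_on S f \<Longrightarrow> smooth_on S g \<Longrightarrow> smooth_on S (\<lambda>x. f x + g x)"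
  unfolding smooth_on_def by (simp add: Ck_on_add)

lemma smooth_on_sum:
  "open S \<Longrightarrow> (\<And>i. i \<in> I \<Longrightarrow> smooth_on S (f i)) \<Longrightarrow> smooth_on S (\<lambda>x. \<Sum>i\<in>I. f i x)"
  unfolding smooth_on_def by (simp add: Ck_on_sum)

lemma smooth_on_bilinear:
  "bounded_bilinear B \<Longrightarrow> open S \<Longrightarrow> smooth_on S f \<Longrightarrow> smooth_on S g \<Longrightarrow>
    smooth_on S (\<lambda>x. B (f x) (g x))"
  unfolding smooth_on_def by (simp add: Ck_on_bilinear)

lemmas smooth_on_scaleR = smooth_on_bilinear[OF bounded_bilinear_scaleR]

lemma smooth_on_diff:
  assumes "open S" "smooth_on S f" "smooth_on S g"
  shows "smooth_on S (\<lambda>x. f x - g x)"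
  using smooth_on_add[OF assms(1,2) smooth_on_linear_comp[OF bounded_linear_minus[OF bounded_linear_ident] assms(1,3)]]
  by simp

lemma smooth_on_compose:
  "open S \<Longrightarrow> open T \<Longrightarrow> smooth_on S f \<Longrightarrow> smooth_on T g \<Longrightarrow> f ` S \<subseteq> T \<Longrightarrow>
    smooth_on S (\<lambda>x. g (f x))"
  unfolding smooth_on_def by (blast intro: Ck_on_compose)

lemma smooth_on_vec: "open S \<Longrightarrow> (\<And>i. smooth_on S (\<lambda>x. f x $ i)) \<Longrightarrow> smooth_on S f"
  unfolding smooth_on_def by (simp add: Ck_on_vec)

lemma smooth_on_vec_nth: "open S \<Longrightarrow> smooth_on S f \<Longrightarrow> smooth_on S (\<lambda>x. f x $ i)"
  unfolding smooth_on_def by (simp add: Ck_on_vec_nth)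

lemma smooth_on_Pair:
  assumes S: "open S" and f: "smooth_on S f" and g: "smooth_on S g"
  shows "smooth_on S (\<lambda>x. (f x, g x))"
proof -
  have "smooth_on S (\<lambda>x. (f x, 0) + (0, g x))"
    by (intro smooth_on_add[OF S]
        smooth_on_linear_comp[OF bounded_linear_Pair[OF bounded_linear_ident bounded_linear_zero] S f]
        smooth_on_linear_comp[OF bounded_linear_Pair[OF bounded_linear_zero bounded_linear_ident] S g])
  then show ?thesis by simp
qed

text \<open>
  Expanding \<open>b x\<close> in the basis separates the dependence on the point \<open>a x\<close> of differentiation from
  that on the direction.
\<close>

lemma smooth_on_directional_derivative:
  assumes S: "open S" and T: "open T" and a: "smooth_on S a" and b: "smooth_on S b"
    and f: "smooth_on T f" and sub: "a ` S \<subseteq> T"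
  shows "smooth_on S (\<lambda>x. frechet_derivative f (at (a x)) (b x))"
proof (rule smooth_on_cong[OF S])
  show "(\<Sum>e\<in>Basis. (b x \<bullet> e) *\<^sub>R frechet_derivative f (at (a x)) e)
      = frechet_derivative f (at (a x)) (b x)" if "x \<in> S" for x
    by (rule linear_expand[OF linear_frechet[OF smooth_on_differentiable[OF f]], symmetric])
      (use that sub in auto)
  show "smooth_on S (\<lambda>x. \<Sum>e\<in>Basis. (b x \<bullet> e) *\<^sub>R frechet_derivative f (at (a x)) e)"
    by (intro smooth_on_sum[OF S] smooth_on_scaleR[OF S]
        smooth_on_linear_comp[OF bounded_linear_inner_left S b]
        smooth_on_compose[OF S T a smooth_on_derivative[OF f] sub])
qed

subsection \<open>Second derivatives\<close>

abbreviation second_derivative ::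
  "('a::euclidean_space \<Rightarrow> 'b::euclidean_space) \<Rightarrow> 'a \<Rightarrow> 'a \<Rightarrow> 'a \<Rightarrow> 'b" where
  "second_derivative f x v w \<equiv>
    frechet_derivative (\<lambda>y. frechet_derivative f (at y) v) (at x) w"

lemma linear_second_derivative_left:
  assumes "open S" "smooth_on S f" "x \<in> S"
  shows "linear (\<lambda>v. second_derivative f x v w)"
proof
  have lin: "linear (frechet_derivative f (at y))" if "y \<in> S" for y
    using linear_frechet[OF smooth_on_differentiable[OF assms(2) that]] .
  have der: "((\<lambda>y. frechet_derivative f (at y) v) has_derivative
      frechet_derivative (\<lambda>y. frechet_derivative f (at y) v) (at x)) (at x)" for v
    by (rule has_derivative_frechet[OF smooth_on_differentiable[OF smooth_on_derivative[OF assms(2)] assms(3)]])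
  show "second_derivative f x (v + v') w = second_derivative f x v w + second_derivative f x v' w" for v v'
  proof -
    have "second_derivative f x (v + v') w
        = frechet_derivative (\<lambda>y. frechet_derivative f (at y) v + frechet_derivative f (at y) v') (at x) w"
      by (rule fun_cong[OF frechet_cong_open[OF assms(1,3)]]) (rule linear_add[OF lin])
    then show ?thesis using frechetI[OF has_derivative_add[OF der[of v] der[of v']]] by simp
  qed
  show "second_derivative f x (r *\<^sub>R v) w = r *\<^sub>R second_derivative f x v w" for r v
  proof -
    have "second_derivative f x (r *\<^sub>R v) w
        = frechet_derivative (\<lambda>y. r *\<^sub>R frechet_derivative f (at y) v) (at x) w"
      by (rule fun_cong[OF frechet_cong_open[OF assms(1,3)]]) (rule linear_cmul[OF lin])
    then show ?thesis using frechetI[OF has_derivative_scaleR_right[OF der[of v]]] by simp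
  qed
qed

lemma linear_second_derivative_right:
  assumes "smooth_on S f" "x \<in> S"
  shows "linear (second_derivative f x v)"
  by (rule linear_frechet[OF smooth_on_differentiable[OF smooth_on_derivative[OF assms(1)] assms(2)]])

text \<open>
  The product rule for the evaluation of the derivative of \<open>f\<close> at a moving point on a moving vector;
  it serves to differentiate the tangency condition of a vector field and the derivatives of the
  graph maps.
\<close>

lemma has_derivative_directional_derivative:
  assumes T: "open T" "smooth_on T f" "a x \<in> T"
    and a: "(a has_derivative a') (at x)" and b: "(b has_derivative b') (at x)"
  shows "((\<lambda>y. frechet_derivative f (at (a y)) (b y)) has_derivative
      (\<lambda>w. second_derivative f (a x) (b x) (a' w) + frechet_derivative f (at (a x)) (b' w))) (at x)"
proof -
  let ?F = "\<lambda>y. \<Sum>e\<in>Basis. (b y \<bullet> e) *\<^sub>R frechet_derivative f (at (a y)) e"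
  have lin: "linear (frechet_derivative f (at y))" if "y \<in> T" for y
    using linear_frechet[OF smooth_on_differentiable[OF T(2) that]] .
  have D: "((\<lambda>y. frechet_derivative f (at (a y)) e) has_derivative
      (\<lambda>w. second_derivative f (a x) e (a' w))) (at x)" for e
    by (rule has_derivative_compose[OF a has_derivative_frechet[OF
        smooth_on_differentiable[OF smooth_on_derivative[OF T(2)] T(3)]]])
  have "(?F has_derivative (\<lambda>w. \<Sum>e\<in>Basis. (b x \<bullet> e) *\<^sub>R second_derivative f (a x) e (a' w)
      + (b' w \<bullet> e) *\<^sub>R frechet_derivative f (at (a x)) e)) (at x)"
    by (intro has_derivative_sum has_derivative_scaleR has_derivative_inner_left b D)
  also have "(\<lambda>w. \<Sum>e\<in>Basis. (b x \<bullet> e) *\<^sub>R second_derivative f (a x) e (a' w)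
      + (b' w \<bullet> e) *\<^sub>R frechet_derivative f (at (a x)) e)
      = (\<lambda>w. second_derivative f (a x) (b x) (a' w) + frechet_derivative f (at (a x)) (b' w))"
    unfolding sum.distrib linear_expand[OF linear_second_derivative_left[OF T], symmetric]
      linear_expand[OF lin[OF T(3)], symmetric] by (rule refl)
  finally have F: "(?F has_derivative (\<lambda>w. second_derivative f (a x) (b x) (a' w)
      + frechet_derivative f (at (a x)) (b' w))) (at x)" .
  have "isCont a x" using a has_derivative_continuous by blast
  then have "\<forall>\<^sub>F y in at x. a y \<in> T"
    using T(1,3) by (auto simp: isCont_def tendsto_def)
  then have "\<forall>\<^sub>F y in at x. ?F y = frechet_derivative f (at (a y)) (b y)"
    by eventually_elim (rule linear_expand[OF lin, symmetric])
  moreover have "?F x = frechet_derivative f (at (a x)) (b x)"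
    by (rule linear_expand[OF lin[OF T(3)], symmetric])
  ultimately show ?thesis using has_derivative_transform_eventually[OF F] by auto
qed

subsection \<open>Smoothness of local inverses\<close>

text \<open>
  The derivative of the inverse \<open>g\<close> solves a linear system whose coefficients are the derivatives of
  \<open>f\<close> at \<open>g y\<close>. So if \<open>g\<close> is of class \<open>k\<close>, then so is its derivative, and the class of \<open>g\<close> increases
  indefinitely.
\<close>

lemma smooth_inverse_function:
  fixes f :: "real^'n \<Rightarrow> real^'n"
  assumes U: "open U" and f: "smooth_on U f" and x0: "x0 \<in> U"
    and inj: "\<And>v. frechet_derivative f (at x0) v = 0 \<Longrightarrow> v = 0"
  obtains U' V g where "open U'" "U' \<subseteq> U" "x0 \<in> U'" "open V" "f x0 \<in> V" "homeomorphism U' V f g"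
    "smooth_on V g"
proof -
  have dd: "f differentiable at x" if "x \<in> U" for x using smooth_on_differentiable[OF f that] .
  define f' where "f' x = Blinfun (frechet_derivative f (at x))" for x
  have f'_apply: "blinfun_apply (f' x) = frechet_derivative f (at x)" if "x \<in> U" for x
    unfolding f'_def
    by (rule bounded_linear_Blinfun_apply) (use has_derivative_frechet[OF dd[OF that]] has_derivative_bounded_linear in blast)
  have der: "(f has_derivative blinfun_apply (f' x)) (at x)" if "x \<in> U" for x
    using f'_apply[OF that] has_derivative_frechet[OF dd[OF that]] by simp
  have "continuous_on U (\<lambda>x. blinfun_apply (f' x) b)" for b
    using smooth_on_continuous[OF smooth_on_derivative[OF f, of b]]
    by (rule continuous_on_eq) (simp add: f'_apply)
  then have cont: "continuous_on U f'" by (rule continuous_on_blinfun_componentwise)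
  have lin0: "linear (frechet_derivative f (at x0))" using linear_frechet[OF dd[OF x0]] .
  have "inj (frechet_derivative f (at x0))"
    using inj linear_injective_0[OF lin0] by blast
  then obtain h where h: "linear h" "h \<circ> frechet_derivative f (at x0) = id"
    using linear_injective_left_inverse[OF lin0] by blast
  define invf where "invf = Blinfun h"
  have "blinfun_apply invf = h" unfolding invf_def
    using h(1) by (simp add: bounded_linear_Blinfun_apply linear_conv_bounded_linear)
  then have "invf o\<^sub>L f' x0 = id_blinfun"
    using h(2) f'_apply[OF x0] by (intro blinfun_eqI) (simp add: fun_eq_iff)
  then obtain U' V g g' where *: "open U'" "U' \<subseteq> U" "x0 \<in> U'" "open V" "f x0 \<in> V" "homeomorphism U' V f g"
    "\<And>y. y \<in> V \<Longrightarrow> (g has_derivative (g' y)) (at y)"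
    "\<And>y. y \<in> V \<Longrightarrow> g' y = inv (blinfun_apply (f'(g y)))"
    "\<And>y. y \<in> V \<Longrightarrow> bij (blinfun_apply (f'(g y)))"
    using inverse_function_theorem[OF U der cont x0] by metis
  have gV: "g ` V \<subseteq> U" using *(2,6) by (auto simp: homeomorphism_def)
  let ?M = "\<lambda>y. matrix (frechet_derivative f (at (g y)))"
  have M: "?M y *v v = frechet_derivative f (at (g y)) v" if "y \<in> V" for y v
    using matrix_vector_mul(2)[OF linear_frechet[OF dd, of "g y"]] gV that by (auto dest: fun_cong)
  have solve: "?M y *v g' y v = v" if "y \<in> V" for y v
  proof -
    have "g y \<in> U" using gV that by auto
    then have "?M y *v g' y v = blinfun_apply (f' (g y)) (inv (blinfun_apply (f' (g y))) v)"
      unfolding M[OF that] using *(8)[OF that] f'_apply by simp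
    then show ?thesis using *(9)[OF that] by (simp add: bij_is_surj surj_f_inv_f)
  qed
  have bij: "bij (frechet_derivative f (at (g y)))" if "y \<in> V" for y
    using *(9)[OF that] f'_apply[of "g y"] gV that by auto
  have "inj ((*v) (?M y))" if "y \<in> V" for y
    unfolding M[OF that] using bij_is_inj[OF bij[OF that]] .
  then have nz: "det (?M y) \<noteq> 0" if "y \<in> V" for y
    using that by (simp add: invertible_det_nz[symmetric] invertible_left_inverse matrix_left_invertible_injective)
  have "Ck_on k V g" for k
  proof (induction k)
    case 0
    show ?case using *(6) by (simp add: homeomorphism_def)
  next
    case (Suc k)
    have "Ck_on k V (\<lambda>y. ?M y $ i $ j)" for i j
    proof -
      have "Ck_on k U (\<lambda>x. frechet_derivative f (at x) (axis j 1))"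
        using smooth_on_derivative[OF f] by (simp add: smooth_on_def)
      from Ck_on_compose[OF *(4) U Suc this gV] show ?thesis
        by (simp add: matrix_def Ck_on_vec_nth[OF *(4)])
    qed
    then have "Ck_on k V (\<lambda>y. g' y v)" for v
      using Ck_on_linear_solve[where M = ?M and w = "\<lambda>y. g' y v", OF *(4) _ nz solve] by simp
    from Ck_on_SucI[OF *(4) *(7) this] show ?case .
  qed
  then show ?thesis using that[OF *(1-6)] by (simp add: smooth_on_def)
qed


section \<open>Charts, curves and tangent vectors\<close>

abbreviation transition :: "('a, 'v) chart \<Rightarrow> ('a, 'v) chart \<Rightarrow> 'v \<Rightarrow> 'v" where
  "transition c d \<equiv> \<lambda>x. snd d (chart_inv c x)"

lemma open_zero_interval:
  fixes S :: "real set"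
  assumes "open S" "0 \<in> S"
  obtains e where "e > 0" "{-e<..<e} \<subseteq> S"
  using assms by (metis ball_eq_greaterThanLessThan add_0 diff_0 open_contains_ball)

lemma has_vector_derivative_compose:
  "(f has_vector_derivative f') (at t) \<Longrightarrow> (g has_derivative g') (at (f t)) \<Longrightarrow>
    ((\<lambda>t. g (f t)) has_vector_derivative g' f') (at t)"
  using vector_derivative_diff_chain_within[of f f' t UNIV g g']
  by (simp add: o_def has_derivative_at_withinI)

lemma charts_atD: "c \<in> charts_at A p \<Longrightarrow> c \<in> A" "c \<in> charts_at A p \<Longrightarrow> p \<in> fst c"
  by (auto simp: charts_at_def)

lemma charts_atI: "c \<in> A \<Longrightarrow> p \<in> fst c \<Longrightarrow> c \<in> charts_at A p"
  by (auto simp: charts_at_def)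

lemma chart_inv_mem: "x \<in> snd c ` U \<Longrightarrow> U \<subseteq> fst c \<Longrightarrow> chart_inv c x \<in> fst c"
  unfolding chart_inv_def by (rule inv_into_into) auto

lemma chart_inv_right: "x \<in> snd c ` U \<Longrightarrow> U \<subseteq> fst c \<Longrightarrow> snd c (chart_inv c x) = x"
  unfolding chart_inv_def by (rule f_inv_into_f) auto

locale manifold =
  fixes E :: "'a topology" and A :: "('a, 'v::euclidean_space) chart set"
  assumes mfd: "smooth_manifold E A"
begin

lemma chart: "c \<in> A \<Longrightarrow> is_chart E c"
  using mfd by (simp add: smooth_manifold_def)

lemma chart_open: "c \<in> A \<Longrightarrow> openin E (fst c)"
  using chart by (simp add: is_chart_def)

lemma chart_inj: "c \<in> A \<Longrightarrow> inj_on (snd c) (fst c)"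
  using chart[of c] openin_subset[OF chart_open[of c]]
  by (auto simp: is_chart_def homeomorphic_map_def Int_absorb1)

lemma chart_inv_left: "c \<in> A \<Longrightarrow> p \<in> fst c \<Longrightarrow> chart_inv c (snd c p) = p"
  unfolding chart_inv_def using chart_inj by simp

lemma chart_inv_image: "c \<in> A \<Longrightarrow> W \<subseteq> fst c \<Longrightarrow> x \<in> snd c ` W \<Longrightarrow> chart_inv c x \<in> W"
  using chart_inv_left by fastforce

lemma chart_image_open:
  assumes "c \<in> A" "openin E W" "W \<subseteq> fst c"
  shows "open (snd c ` W)"
proof -
  have "open_map (subtopology E (fst c)) (top_of_set (snd c ` fst c)) (snd c)"
    using chart[OF assms(1)] by (simp add: is_chart_def homeomorphic_imp_open_map)
  moreover have "openin (subtopology E (fst c)) W"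
    using assms by (metis inf.absorb1 openin_subtopology_Int)
  ultimately have "openin (top_of_set (snd c ` fst c)) (snd c ` W)"
    unfolding open_map_def by blast
  then show ?thesis
    using chart[OF assms(1)] openin_open_trans unfolding is_chart_def by blast
qed

lemma chart_preimage_open:
  assumes "c \<in> A" "open V"
  shows "openin E {q \<in> fst c. snd c q \<in> V}"
proof -
  have cm: "continuous_map (subtopology E (fst c)) (top_of_set (snd c ` fst c)) (snd c)"
    using chart[OF assms(1)] by (simp add: is_chart_def homeomorphic_imp_continuous_map)
  have ts: "topspace (subtopology E (fst c)) = fst c"
    using openin_subset[OF chart_open[OF assms(1)]] by auto
  have "openin (top_of_set (snd c ` fst c)) (snd c ` fst c \<inter> V)"
    using assms(2) by (simp add: openin_open_Int)
  then have "openin (subtopology E (fst c)) {q \<in> fst c. snd c q \<in> snd c ` fst c \<inter> V}"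
    using cm ts unfolding continuous_map_def by metis
  moreover have "{q \<in> fst c. snd c q \<in> snd c ` fst c \<inter> V} = {q \<in> fst c. snd c q \<in> V}" by auto
  ultimately show ?thesis
    using openin_open_subtopology[OF chart_open[OF assms(1)]] by metis
qed

lemma overlap_open: "c \<in> A \<Longrightarrow> d \<in> A \<Longrightarrow> open (snd c ` (fst c \<inter> fst d))"
  by (rule chart_image_open) (auto intro: openin_Int chart_open)

lemma transition_smooth:
  "c \<in> A \<Longrightarrow> d \<in> A \<Longrightarrow> smooth_on (snd c ` (fst c \<inter> fst d)) (transition c d)"
  using mfd by (auto simp: smooth_manifold_def compatible_def o_def)

lemma transition_has_derivative:
  assumes "c \<in> charts_at A p" "d \<in> charts_at A p"
  shows "(transition c d has_derivative frechet_derivative (transition c d) (at (snd c p))) (at (snd c p))"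
  using assms by (intro has_derivative_frechet smooth_on_differentiable[OF transition_smooth])
    (auto simp: charts_at_def)

lemma transition_apply: "c \<in> charts_at A p \<Longrightarrow> transition c d (snd c p) = snd d p"
  by (simp add: chart_inv_left[OF charts_atD])

lemma linear_transition_derivative:
  "c \<in> charts_at A p \<Longrightarrow> d \<in> charts_at A p \<Longrightarrow> linear (frechet_derivative (transition c d) (at (snd c p)))"
  using transition_has_derivative has_derivative_linear by blast

text \<open>
  By continuity the curve stays in the domain of any other chart for a while, and there the
  transition map applies.
\<close>

lemma smooth_curve_atI:
  assumes c: "c \<in> charts_at A p" and "\<gamma> 0 = p" and S: "open S" "0 \<in> S"
    and sub: "\<And>t. t \<in> S \<Longrightarrow> \<gamma> t \<in> fst c" and sm: "smooth_on S (\<lambda>t. snd c (\<gamma> t))"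
  shows "smooth_curve_at A p \<gamma>"
  unfolding smooth_curve_at_def
proof (intro conjI ballI)
  show "\<gamma> 0 = p" by fact
  fix d assume d: "d \<in> charts_at A p"
  let ?O = "snd c ` (fst c \<inter> fst d)"
  have O: "open ?O" using c d by (intro overlap_open) (auto simp: charts_at_def)
  let ?S = "S \<inter> (\<lambda>t. snd c (\<gamma> t)) -` ?O"
  have "open ?S"
    using continuous_on_open_vimage[OF S(1), of "\<lambda>t. snd c (\<gamma> t)"] smooth_on_continuous[OF sm] O
    by (simp add: Int_commute)
  moreover have "0 \<in> ?S" using S c d \<open>\<gamma> 0 = p\<close> by (auto simp: charts_at_def)
  ultimately obtain e where e: "e > 0" "{-e<..<e} \<subseteq> ?S" by (rule open_zero_interval)
  have mem: "\<gamma> t \<in> fst d" if "t \<in> {-e<..<e}" for t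
  proof -
    have "snd c (\<gamma> t) \<in> ?O" "\<gamma> t \<in> fst c" using e that sub by auto
    then show ?thesis using chart_inj[OF charts_atD(1)[OF c]] by (auto simp: inj_on_def)
  qed
  have "smooth_on {-e<..<e} (\<lambda>t. transition c d (snd c (\<gamma> t)))"
    by (rule smooth_on_compose[OF _ O smooth_on_subset[OF sm] transition_smooth])
      (use c d e in \<open>auto simp: charts_at_def\<close>)
  then have "smooth_on {-e<..<e} (\<lambda>t. snd d (\<gamma> t))"
    by (rule smooth_on_cong[rotated 2]) (use e sub c in \<open>auto simp: chart_inv_left[OF charts_atD(1)[OF c]]\<close>)
  then show "\<exists>e>0. \<gamma> ` {-e<..<e} \<subseteq> fst d \<and> smooth_on {-e<..<e} (snd d \<circ> \<gamma>)"
    using e(1) mem by (auto simp: o_def)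
qed

lemma smooth_curve_chart:
  assumes "smooth_curve_at A p \<gamma>" "c \<in> charts_at A p"
  obtains e where "e > 0" "\<And>t. t \<in> {-e<..<e} \<Longrightarrow> \<gamma> t \<in> fst c"
    "smooth_on {-e<..<e} (\<lambda>t. snd c (\<gamma> t))"
  using assms unfolding smooth_curve_at_def o_def by blast

lemma smooth_curve_start: "smooth_curve_at A p \<gamma> \<Longrightarrow> \<gamma> 0 = p"
  by (simp add: smooth_curve_at_def)

lemma smooth_curve_velocity:
  assumes "smooth_curve_at A p \<gamma>" "c \<in> charts_at A p"
  shows "((\<lambda>t. snd c (\<gamma> t)) has_vector_derivative velocity A p \<gamma> c) (at 0)"
proof -
  from assms obtain e where "e > 0" "smooth_on {-e<..<e} (\<lambda>t. snd c (\<gamma> t))"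
    by (rule smooth_curve_chart)
  then have "(\<lambda>t. snd c (\<gamma> t)) differentiable at 0"
    by (auto intro: smooth_on_differentiable)
  then show ?thesis
    using assms(2) by (simp add: velocity_def o_def vector_derivative_works[symmetric])
qed

lemma velocity_outside: "c \<notin> charts_at A p \<Longrightarrow> velocity A p \<gamma> c = 0"
  by (simp add: velocity_def)

lemma velocityI:
  "c \<in> charts_at A p \<Longrightarrow> ((\<lambda>t. snd c (\<gamma> t)) has_vector_derivative w) (at 0) \<Longrightarrow> velocity A p \<gamma> c = w"
  by (simp add: velocity_def o_def vector_derivative_at)

lemma smooth_curve_near:
  assumes \<gamma>: "smooth_curve_at A p \<gamma>" and c: "c \<in> charts_at A p" and W: "openin E W" "p \<in> W"
  obtains e where "e > 0" "\<And>t. t \<in> {-e<..<e} \<Longrightarrow> \<gamma> t \<in> W \<inter> fst c"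
    "smooth_on {-e<..<e} (\<lambda>t. snd c (\<gamma> t))"
proof -
  obtain e where e: "e > 0" "\<And>t. t \<in> {-e<..<e} \<Longrightarrow> \<gamma> t \<in> fst c"
      "smooth_on {-e<..<e} (\<lambda>t. snd c (\<gamma> t))"
    using smooth_curve_chart[OF \<gamma> c] by blast
  let ?O = "snd c ` (W \<inter> fst c)"
  have O: "open ?O"
    using c W by (intro chart_image_open) (auto intro: openin_Int chart_open simp: charts_at_def)
  let ?S = "{-e<..<e} \<inter> (\<lambda>t. snd c (\<gamma> t)) -` ?O"
  have "open ?S"
    using continuous_on_open_vimage[of "{-e<..<e}" "\<lambda>t. snd c (\<gamma> t)"] smooth_on_continuous[OF e(3)] O
    by (simp add: Int_commute)
  moreover have "0 \<in> ?S" using e c W smooth_curve_start[OF \<gamma>] by (auto simp: charts_at_def)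
  ultimately obtain e' where e': "e' > 0" "{-e'<..<e'} \<subseteq> ?S" by (rule open_zero_interval)
  have "\<gamma> t \<in> W \<inter> fst c" if "t \<in> {-e'<..<e'}" for t
  proof -
    have "snd c (\<gamma> t) \<in> ?O" "\<gamma> t \<in> fst c" using e e' that by auto
    then show ?thesis using chart_inj[OF charts_atD(1)[OF c]] by (auto simp: inj_on_def)
  qed
  then show ?thesis using that[of e'] e' smooth_on_subset[OF e(3)] by blast
qed

lemma velocity_change:
  assumes \<gamma>: "smooth_curve_at A p \<gamma>" and c: "c \<in> charts_at A p" and d: "d \<in> charts_at A p"
  shows "velocity A p \<gamma> d = frechet_derivative (transition c d) (at (snd c p)) (velocity A p \<gamma> c)"
proof (rule velocityI[OF d])
  from \<gamma> c obtain e where e: "e > 0" "\<And>t. t \<in> {-e<..<e} \<Longrightarrow> \<gamma> t \<in> fst c"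
    by (rule smooth_curve_chart) blast
  have "((\<lambda>t. transition c d (snd c (\<gamma> t))) has_vector_derivative
      frechet_derivative (transition c d) (at (snd c p)) (velocity A p \<gamma> c)) (at 0)"
    by (rule has_vector_derivative_compose[OF smooth_curve_velocity[OF \<gamma> c]])
      (use transition_has_derivative[OF c d] smooth_curve_start[OF \<gamma>] in simp)
  then show "((\<lambda>t. snd d (\<gamma> t)) has_vector_derivative
      frechet_derivative (transition c d) (at (snd c p)) (velocity A p \<gamma> c)) (at 0)"
    by (rule has_vector_derivative_transform_within_open[where S = "{-e<..<e}"])
      (use e c in \<open>auto simp: chart_inv_left[OF charts_atD(1)[OF c]]\<close>)
qed

definition tangent_vector :: "('a, 'v) chart \<Rightarrow> 'a \<Rightarrow> 'v \<Rightarrow> ('a, 'v) tvec" where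
  "tangent_vector c p w = velocity A p (\<lambda>t. chart_inv c (snd c p + t *\<^sub>R w))"

lemma coordinate_line:
  assumes c: "c \<in> charts_at A p"
  shows "smooth_curve_at A p (\<lambda>t. chart_inv c (snd c p + t *\<^sub>R w))"
    and "tangent_vector c p w c = w"
proof -
  let ?l = "\<lambda>t::real. snd c p + t *\<^sub>R w"
  have cA: "c \<in> A" and p: "p \<in> fst c" using c by (auto simp: charts_at_def)
  have O: "open (snd c ` fst c)" using chart_image_open[OF cA chart_open[OF cA]] by simp
  have "continuous_on UNIV ?l" by (intro continuous_intros)
  then have oS: "open (?l -` (snd c ` fst c))"
    using O by (simp add: continuous_on_open_vimage[OF open_UNIV])
  have 0: "0 \<in> ?l -` (snd c ` fst c)" using p by auto
  have in_c: "chart_inv c (?l t) \<in> fst c" "snd c (chart_inv c (?l t)) = ?l t"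
    if "t \<in> ?l -` (snd c ` fst c)" for t
    using that chart_inv_mem[of "?l t" c "fst c"] chart_inv_right[of "?l t" c "fst c"] by auto
  have "smooth_on (?l -` (snd c ` fst c)) ?l"
    by (intro smooth_on_add smooth_on_const smooth_on_linear oS bounded_linear_scaleR_left)
  then have sm: "smooth_on (?l -` (snd c ` fst c)) (\<lambda>t. snd c (chart_inv c (?l t)))"
    by (rule smooth_on_cong[OF oS, rotated]) (use in_c in auto)
  show "smooth_curve_at A p (\<lambda>t. chart_inv c (?l t))"
    by (rule smooth_curve_atI[OF c _ oS 0 _ sm])
      (use in_c chart_inv_left[OF cA p] in auto)
  have "(?l has_vector_derivative w) (at 0)"
    by (auto intro!: derivative_eq_intros)
  then have "((\<lambda>t. snd c (chart_inv c (?l t))) has_vector_derivative w) (at 0)"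
    by (rule has_vector_derivative_transform_within_open[OF _ oS 0]) (use in_c in auto)
  then show "tangent_vector c p w c = w"
    unfolding tangent_vector_def by (rule velocityI[OF c])
qed

lemma tangent_vector_mem: "c \<in> charts_at A p \<Longrightarrow> tangent_vector c p w \<in> tangent_space A p"
  using coordinate_line(1) unfolding tangent_vector_def tangent_space_def by blast

lemma tangent_change:
  assumes "v \<in> tangent_space A p" "c \<in> charts_at A p" "d \<in> charts_at A p"
  shows "v d = frechet_derivative (transition c d) (at (snd c p)) (v c)"
  using assms(1) velocity_change[OF _ assms(2,3)] unfolding tangent_space_def by blast

lemma tangent_outside: "v \<in> tangent_space A p \<Longrightarrow> d \<notin> charts_at A p \<Longrightarrow> v d = 0"
  using velocity_outside[of d p] unfolding tangent_space_def by blast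

text \<open>The coordinates in the other charts are obtained by the derivatives of the transition maps.\<close>

lemma tangent_eqI:
  assumes "v \<in> tangent_space A p" "w \<in> tangent_space A p" "c \<in> charts_at A p" "v c = w c"
  shows "v = w"
proof
  fix d show "v d = w d"
  proof (cases "d \<in> charts_at A p")
    case True
    show ?thesis
      unfolding tangent_change[OF assms(1,3) True] tangent_change[OF assms(2,3) True] assms(4) ..
  next
    case False
    show ?thesis
      unfolding tangent_outside[OF assms(1) False] tangent_outside[OF assms(2) False] ..
  qed
qed

lemma tangent_vector_coords:
  "v \<in> tangent_space A p \<Longrightarrow> c \<in> charts_at A p \<Longrightarrow> tangent_vector c p (v c) = v"
  by (rule tangent_eqI[OF tangent_vector_mem _ _ coordinate_line(2)])

lemma tangent_lincomb_eq:
  assumes c: "c \<in> charts_at A p"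
  shows "tadd (tscale a (tangent_vector c p v)) (tscale b (tangent_vector c p w))
    = tangent_vector c p (a *\<^sub>R v + b *\<^sub>R w)" (is "?l = ?r")
proof
  fix d
  show "?l d = ?r d"
  proof (cases "d \<in> charts_at A p")
    case True
    note lin = linear_transition_derivative[OF c True]
    have "tangent_vector c p u d = frechet_derivative (transition c d) (at (snd c p)) u" for u
      using tangent_change[OF tangent_vector_mem[OF c] c True] coordinate_line(2)[OF c] by simp
    then show ?thesis
      by (simp add: tadd_def tscale_def linear_add[OF lin] linear_cmul[OF lin])
  next
    case False
    then show ?thesis by (simp add: tadd_def tscale_def tangent_outside[OF tangent_vector_mem[OF c]])
  qed
qed

lemma tscale_tangent_vector:
  "c \<in> charts_at A p \<Longrightarrow> tscale a (tangent_vector c p v) = tangent_vector c p (a *\<^sub>R v)"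
  using tangent_lincomb_eq[of c p a v 0 v] by (simp add: tadd_def tscale_def)

lemma tadd_tangent_vector:
  "c \<in> charts_at A p \<Longrightarrow> tadd (tangent_vector c p v) (tangent_vector c p w) = tangent_vector c p (v + w)"
  using tangent_lincomb_eq[of c p 1 v 1 w] by (simp add: tadd_def tscale_def)

lemma tangent_lincomb:
  assumes "p \<in> topspace E" "v \<in> tangent_space A p" "w \<in> tangent_space A p"
  shows "tadd (tscale a v) (tscale b w) \<in> tangent_space A p"
proof -
  have "p \<in> \<Union>(fst ` A)" using assms(1) mfd by (simp add: smooth_manifold_def)
  then obtain c where c: "c \<in> charts_at A p" by (blast intro: charts_atI)
  show ?thesis
    using tangent_lincomb_eq[OF c, of a "v c" b "w c"] tangent_vector_mem[OF c]
      tangent_vector_coords[OF assms(2) c] tangent_vector_coords[OF assms(3) c] by metis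
qed

subsection \<open>Vector fields in a chart\<close>

lemma vector_field_on_cong:
  assumes Y: "vector_field_on E A W Y" and eq: "\<And>q. q \<in> W \<Longrightarrow> Y q = Z q"
  shows "vector_field_on E A W Z"
  unfolding vector_field_on_def
proof (intro conjI ballI)
  show W: "openin E W" using Y by (simp add: vector_field_on_def)
  show "Z q \<in> tangent_space A q" if "q \<in> W" for q
    using Y that unfolding eq[OF that, symmetric] by (simp add: vector_field_on_def)
  fix c assume c: "c \<in> A"
  have O: "open (snd c ` (W \<inter> fst c))"
    by (rule chart_image_open[OF c]) (auto intro: openin_Int W chart_open c)
  have "smooth_on (snd c ` (W \<inter> fst c)) (\<lambda>x. Y (chart_inv c x) c)"
    using Y c by (simp add: vector_field_on_def)
  then show "smooth_on (snd c ` (W \<inter> fst c)) (\<lambda>x. Z (chart_inv c x) c)"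
  proof (rule smooth_on_cong[OF O, rotated])
    fix x assume "x \<in> snd c ` (W \<inter> fst c)"
    then have "chart_inv c x \<in> W" using chart_inv_image[OF c, of "W \<inter> fst c" x] by blast
    then show "Y (chart_inv c x) c = Z (chart_inv c x) c" by (simp only: eq)
  qed
qed

lemma vector_field_on_subset:
  assumes "vector_field_on E A W Y" "openin E W'" "W' \<subseteq> W"
  shows "vector_field_on E A W' Y"
proof -
  have "smooth_on (snd c ` (W' \<inter> fst c)) (\<lambda>x. Y (chart_inv c x) c)" if "c \<in> A" for c
    by (rule smooth_on_subset[of "snd c ` (W \<inter> fst c)"])
      (use assms that in \<open>auto simp: vector_field_on_def\<close>)
  then show ?thesis using assms unfolding vector_field_on_def by blast
qed

text \<open>
  Smoothness of a function or of a vector field near a point may be tested in one chart; in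
  another one, the transition map and its derivative intervene.
\<close>

lemma transition_subset:
  assumes c: "c \<in> A" and d: "d \<in> A" and W: "openin E W" "W \<subseteq> fst c"
  shows "open (snd d ` (W \<inter> fst d))" "transition d c ` (snd d ` (W \<inter> fst d)) \<subseteq> snd c ` W"
    "smooth_on (snd d ` (W \<inter> fst d)) (transition d c)"
proof -
  show "open (snd d ` (W \<inter> fst d))"
    by (rule chart_image_open[OF d]) (auto intro: openin_Int W chart_open d)
  show "transition d c ` (snd d ` (W \<inter> fst d)) \<subseteq> snd c ` W"
    using chart_inv_left[OF d] by fastforce
  show "smooth_on (snd d ` (W \<inter> fst d)) (transition d c)"
    by (rule smooth_on_subset[OF transition_smooth[OF d c]]) (use W in auto)
qed

lemma smooth_fun_onI:
  assumes c: "c \<in> A" and W: "openin E W" "W \<subseteq> fst c"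
    and f: "smooth_on (snd c ` W) (\<lambda>x. f (chart_inv c x))"
  shows "smooth_fun_on E A W f"
  unfolding smooth_fun_on_def
proof (intro conjI ballI)
  fix d assume d: "d \<in> A"
  note t = transition_subset[OF c d W]
  have "smooth_on (snd d ` (W \<inter> fst d)) (\<lambda>x. f (chart_inv c (transition d c x)))"
    by (rule smooth_on_compose[OF t(1) chart_image_open[OF c W] t(3) f t(2)])
  then show "smooth_on (snd d ` (W \<inter> fst d)) (f \<circ> chart_inv d)"
  proof (rule smooth_on_cong[OF t(1), rotated])
    fix x assume "x \<in> snd d ` (W \<inter> fst d)"
    then have "chart_inv d x \<in> fst c"
      using chart_inv_image[OF d, of "W \<inter> fst d" x] W(2) by blast
    then show "f (chart_inv c (transition d c x)) = (f \<circ> chart_inv d) x"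
      by (simp add: chart_inv_left[OF c])
  qed
qed fact

lemma vector_field_onI:
  assumes c: "c \<in> A" and W: "openin E W" "W \<subseteq> fst c"
    and T: "\<And>q. q \<in> W \<Longrightarrow> Y q \<in> tangent_space A q"
    and Y: "smooth_on (snd c ` W) (\<lambda>x. Y (chart_inv c x) c)"
  shows "vector_field_on E A W Y"
  unfolding vector_field_on_def
proof (intro conjI ballI)
  fix d assume d: "d \<in> A"
  note t = transition_subset[OF c d W]
  have t2': "transition d c ` (snd d ` (W \<inter> fst d)) \<subseteq> snd c ` (fst c \<inter> fst d)"
    using chart_inv_left[OF d] W(2) by (auto simp: subset_iff)
  let ?O = "snd d ` (W \<inter> fst d)"
  have "smooth_on ?O (\<lambda>x. Y (chart_inv c (transition d c x)) c)"
    by (rule smooth_on_compose[OF t(1) chart_image_open[OF c W] t(3) Y t(2)])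
  then have "smooth_on ?O (\<lambda>x. frechet_derivative (transition c d) (at (transition d c x))
      (Y (chart_inv c (transition d c x)) c))"
    by (rule smooth_on_directional_derivative[OF t(1) overlap_open[OF c d] t(3) _ transition_smooth[OF c d] t2'])
  then show "smooth_on ?O (\<lambda>x. Y (chart_inv d x) d)"
  proof (rule smooth_on_cong[OF t(1), rotated])
    fix x assume "x \<in> ?O"
    then obtain q where q: "q \<in> W" "q \<in> fst d" "x = snd d q" by auto
    have ch: "c \<in> charts_at A q" "d \<in> charts_at A q" using c d W q by (auto simp: charts_at_def)
    have "chart_inv d x = q" "chart_inv c (snd c q) = q"
      using q chart_inv_left[OF charts_atD(1)[OF ch(1)] charts_atD(2)[OF ch(1)]]
      by (simp_all add: chart_inv_left[OF d])
    then show "frechet_derivative (transition c d) (at (transition d c x)) (Y (chart_inv c (transition d c x)) c)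
        = Y (chart_inv d x) d"
      by (simp only: tangent_change[OF T[OF q(1)] ch])
  qed
qed (use assms in auto)

lemma vector_field_tangent_vector:
  assumes c: "c \<in> A" and W: "openin E W" "W \<subseteq> fst c" and y: "smooth_on (snd c ` W) y"
  shows "vector_field_on E A W (\<lambda>q. tangent_vector c q (y (snd c q)))"
proof (rule vector_field_onI[OF c W])
  have ch: "c \<in> charts_at A q" if "q \<in> W" for q using c W that by (auto simp: charts_at_def)
  then show "tangent_vector c q (y (snd c q)) \<in> tangent_space A q" if "q \<in> W" for q
    using that tangent_vector_mem by blast
  show "smooth_on (snd c ` W) (\<lambda>x. tangent_vector c (chart_inv c x) (y (snd c (chart_inv c x))) c)"
    using y
  proof (rule smooth_on_cong[OF chart_image_open[OF c W], rotated])
    fix x assume "x \<in> snd c ` W"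
    then obtain q where q: "q \<in> W" "x = snd c q" by blast
    then have "chart_inv c x = q" using chart_inv_left[OF c] W(2) by blast
    then show "y x = tangent_vector c (chart_inv c x) (y (snd c (chart_inv c x))) c"
      by (simp only: coordinate_line(2)[OF ch[OF q(1)]] q(2))
  qed
qed

lemma smooth_on_chart_vector_field:
  "vector_field_on E A W Y \<Longrightarrow> c \<in> A \<Longrightarrow> W \<subseteq> fst c \<Longrightarrow> smooth_on (snd c ` W) (\<lambda>x. Y (chart_inv c x) c)"
  unfolding vector_field_on_def by (metis Int_absorb2)

end


section \<open>Linear connections in coordinates\<close>

locale connection = manifold E A
  for E :: "'a topology" and A :: "('a, real^'k::finite) chart set" +
  fixes D :: "('a, real^'k) covd"
  assumes conn: "linear_connection E A D"
begin

lemma covd_germ: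
  assumes Y: "vector_field_on E A W Y" and eq: "\<And>q. q \<in> W \<Longrightarrow> Y q = Z q"
    and p: "p \<in> W" and v: "v \<in> tangent_space A p"
  shows "D p v Y = D p v Z"
  using conn[unfolded linear_connection_def, THEN conjunct1, rule_format, OF p v, of Y Z]
    Y vector_field_on_cong[OF Y eq] eq
  by blast

lemma covd_mem:
  assumes "vector_field_on E A W Y" "p \<in> W" "v \<in> tangent_space A p"
  shows "D p v Y \<in> tangent_space A p"
  using conn[unfolded linear_connection_def, THEN conjunct2, THEN conjunct1, rule_format, OF assms(2,3,1)] .

lemma covd_linear:
  assumes "vector_field_on E A W Y" "p \<in> W" "v \<in> tangent_space A p" "w \<in> tangent_space A p"
  shows "D p (tadd (tscale a v) (tscale b w)) Y = tadd (tscale a (D p v Y)) (tscale b (D p w Y))"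
  using conn[unfolded linear_connection_def, THEN conjunct2, THEN conjunct2, THEN conjunct1,
      rule_format, OF assms(2,3,4,1)] .

lemma covd_add:
  assumes "vector_field_on E A W Y" "vector_field_on E A W Z" "p \<in> W" "v \<in> tangent_space A p"
  shows "D p v (\<lambda>q. tadd (Y q) (Z q)) = tadd (D p v Y) (D p v Z)"
  using conn[unfolded linear_connection_def, THEN conjunct2, THEN conjunct2, THEN conjunct2,
      THEN conjunct1, rule_format, OF assms(3,4) conjI[OF assms(1,2)]] .

lemma covd_leibniz:
  assumes "vector_field_on E A W Y" "smooth_fun_on E A W f" "p \<in> W" "v \<in> tangent_space A p"
    "c \<in> charts_at A p"
  shows "D p v (\<lambda>q. tscale (f q) (Y q)) =
    tadd (tscale (frechet_derivative (f \<circ> chart_inv c) (at (snd c p)) (v c)) (Y p)) (tscale (f p) (D p v Y))"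
  using conn[unfolded linear_connection_def, THEN conjunct2, THEN conjunct2, THEN conjunct2,
      THEN conjunct2, THEN conjunct1, rule_format, OF assms(3,4,5) conjI[OF assms(1,2)]] .

lemma coord_field_eq: "coord_field A c b q = tangent_vector c q (axis b 1)"
  by (simp add: coord_field_def tangent_vector_def)

definition christoffel_form :: "('a, real^'k) chart \<Rightarrow> 'a \<Rightarrow> real^'k \<Rightarrow> real^'k \<Rightarrow> real^'k" where
  "christoffel_form c p x y = (\<Sum>b\<in>UNIV. \<Sum>a\<in>UNIV. (y $ b * x $ a) *\<^sub>R (\<chi> k. christoffel A D c p a k b))"

lemma covd_direction_sum:
  assumes c: "c \<in> charts_at A p" and Y: "vector_field_on E A W Y" and p: "p \<in> W"
  shows "D p (tangent_vector c p (\<Sum>a\<in>S. y a *\<^sub>R axis a 1)) Y c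
    = (\<Sum>a\<in>S. y a *\<^sub>R D p (coord_field A c a p) Y c)"
proof (induction S rule: infinite_finite_induct)
  case (insert a S)
  let ?u = "tangent_vector c p (axis a 1)" and ?v = "tangent_vector c p (\<Sum>a\<in>S. y a *\<^sub>R axis a 1)"
  have "tangent_vector c p (\<Sum>a\<in>insert a S. y a *\<^sub>R axis a 1) = tadd (tscale (y a) ?u) (tscale 1 ?v)"
    using insert by (simp add: tangent_lincomb_eq[OF c])
  then have "D p (tangent_vector c p (\<Sum>a\<in>insert a S. y a *\<^sub>R axis a 1)) Y
      = tadd (tscale (y a) (D p ?u Y)) (tscale 1 (D p ?v Y))"
    by (simp only: covd_linear[OF Y p tangent_vector_mem[OF c] tangent_vector_mem[OF c]])
  then show ?case
    using insert by (simp add: tadd_def tscale_def coord_field_eq)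
next
  case empty
  have "D p (tadd (tscale 0 (tangent_vector c p 0)) (tscale 0 (tangent_vector c p 0))) Y c = 0"
    unfolding covd_linear[OF Y p tangent_vector_mem[OF c] tangent_vector_mem[OF c]]
    by (simp add: tadd_def tscale_def)
  then show ?case unfolding tangent_lincomb_eq[OF c] by simp
qed simp

lemma vector_field_coord: "c \<in> A \<Longrightarrow> vector_field_on E A (fst c) (coord_field A c b)"
  unfolding coord_field_eq
  by (rule vector_field_tangent_vector) (auto intro: chart_open smooth_on_const)

lemma covd_field_sum:
  assumes c: "c \<in> A" and W: "openin E W" "W \<subseteq> fst c" and p: "p \<in> W" and v: "v \<in> tangent_space A p"
    and y: "\<And>b. smooth_on (snd c ` W) (y b)"
  shows "D p v (\<lambda>q. tangent_vector c q (\<Sum>b\<in>B. y b (snd c q) *\<^sub>R axis b 1)) c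
    = (\<Sum>b\<in>B. frechet_derivative (y b) (at (snd c p)) (v c) *\<^sub>R axis b 1
        + y b (snd c p) *\<^sub>R D p v (coord_field A c b) c)"
proof -
  have ch: "c \<in> charts_at A q" if "q \<in> W" for q using c W that by (auto simp: charts_at_def)
  note O = chart_image_open[OF c W]
  have F: "vector_field_on E A W (\<lambda>q. tangent_vector c q (\<Sum>b\<in>B. y b (snd c q) *\<^sub>R axis b 1))" for B
    by (rule vector_field_tangent_vector[OF c W])
      (intro smooth_on_sum[OF O] smooth_on_scaleR[OF O] smooth_on_const y)
  have coord: "vector_field_on E A W (coord_field A c b)" for b
    by (rule vector_field_on_subset[OF vector_field_coord[OF c] W])
  have fd: "frechet_derivative ((\<lambda>q. f (snd c q)) \<circ> chart_inv c) (at (snd c p)) = frechet_derivative f (at (snd c p))"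
    for f :: "real^'k \<Rightarrow> real"
    by (rule frechet_cong_open[OF O]) (use p W in \<open>auto simp: chart_inv_left[OF c] subset_iff\<close>)
  have sf: "smooth_fun_on E A W (\<lambda>q. f (snd c q))" if "smooth_on (snd c ` W) f" for f
    by (rule smooth_fun_onI[OF c W], rule smooth_on_cong[OF O _ that])
      (use W in \<open>auto simp: chart_inv_left[OF c] subset_iff\<close>)
  have leib: "D p v (\<lambda>q. tscale (f (snd c q)) (Y q)) c =
      frechet_derivative f (at (snd c p)) (v c) *\<^sub>R Y p c + f (snd c p) *\<^sub>R D p v Y c"
    if "smooth_on (snd c ` W) f" "vector_field_on E A W Y" for f Y
    using covd_leibniz[OF that(2) sf[OF that(1)] p v ch[OF p]] fd[of f]
    by (simp add: tadd_def tscale_def)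
  have Y1: "vector_field_on E A W (\<lambda>q. tangent_vector c q (y b (snd c q) *\<^sub>R axis b 1))" for b
    using F[of "{b}"] by simp
  have germ: "D p v (\<lambda>q. tangent_vector c q (y b (snd c q) *\<^sub>R axis b 1)) c =
      frechet_derivative (y b) (at (snd c p)) (v c) *\<^sub>R axis b 1 + y b (snd c p) *\<^sub>R D p v (coord_field A c b) c" for b
  proof -
    have eq: "tscale (y b (snd c q)) (coord_field A c b q) = tangent_vector c q (y b (snd c q) *\<^sub>R axis b 1)"
      if "q \<in> W" for q
      unfolding coord_field_eq by (rule tscale_tangent_vector[OF ch[OF that]])
    have "D p v (\<lambda>q. tscale (y b (snd c q)) (coord_field A c b q)) = D p v (\<lambda>q. tangent_vector c q (y b (snd c q) *\<^sub>R axis b 1))"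
      by (rule covd_germ[OF vector_field_on_cong[OF Y1 eq[symmetric]] eq p v])
    then show ?thesis
      using leib[OF y[of b] coord[of b]] by (simp add: coord_field_eq coordinate_line(2)[OF ch[OF p]])
  qed
  show ?thesis
  proof (induction B rule: infinite_finite_induct)
    case (insert b B)
    let ?F = "\<lambda>B q. tangent_vector c q (\<Sum>b\<in>B. y b (snd c q) *\<^sub>R axis b 1)"
    let ?Y = "\<lambda>q. tangent_vector c q (y b (snd c q) *\<^sub>R axis b 1)"
    have eq: "?F (insert b B) q = tadd (?Y q) (?F B q)" if "q \<in> W" for q
      using insert by (simp add: tadd_tangent_vector[OF ch[OF that]])
    have "D p v (?F (insert b B)) = D p v (\<lambda>q. tadd (?Y q) (?F B q))"
      by (rule covd_germ[OF F eq p v])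
    also have "\<dots> = tadd (D p v ?Y) (D p v (?F B))"
      by (rule covd_add[OF Y1 F p v])
    finally show ?case
      using insert germ[of b] by (simp add: tadd_def)
  next
    case empty
    have eq: "tscale 0 (tangent_vector c q 0) = tangent_vector c q 0" if "q \<in> W" for q
      by (simp add: tscale_tangent_vector[OF ch[OF that]])
    have z: "vector_field_on E A W (\<lambda>q. tangent_vector c q 0)"
      using F[of "{}"] by simp
    have "D p v (\<lambda>q. tscale 0 (tangent_vector c q 0)) = D p v (\<lambda>q. tangent_vector c q 0)"
      by (rule covd_germ[OF vector_field_on_cong[OF z eq[symmetric]] eq p v])
    then show ?case
      using leib[OF smooth_on_const[of _ 0] z] by simp
  qed simp
qed

text \<open>
  Near \<open>p\<close> a vector field is the sum of its components times the coordinate fields; the Leibniz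
  rule turns this into the usual formula with Christoffel symbols.
\<close>

lemma covd_coordinates:
  assumes Y: "vector_field_on E A W Y" and p: "p \<in> W" and c: "c \<in> charts_at A p"
    and v: "v \<in> tangent_space A p"
  shows "D p v Y c = frechet_derivative (\<lambda>x. Y (chart_inv c x) c) (at (snd c p)) (v c)
    + christoffel_form c p (v c) (Y p c)"
proof -
  have cA: "c \<in> A" and pc: "p \<in> fst c" using c by (auto simp: charts_at_def)
  define W' where "W' = W \<inter> fst c"
  have W': "openin E W'" "W' \<subseteq> fst c" "W' \<subseteq> W" "p \<in> W'"
    using Y p pc chart_open[OF cA] by (auto simp: W'_def vector_field_on_def)
  have ch: "c \<in> charts_at A q" if "q \<in> W'" for q using cA W' that by (auto simp: charts_at_def)
  have Y': "vector_field_on E A W' Y" by (rule vector_field_on_subset[OF Y W'(1,3)])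
  note O = chart_image_open[OF cA W'(1,2)]
  define y where "y b x = Y (chart_inv c x) c $ b" for b x
  have y: "smooth_on (snd c ` W') (y b)" for b
    unfolding y_def by (rule smooth_on_vec_nth[OF O smooth_on_chart_vector_field[OF Y' cA W'(2)]])
  have eq: "Y q = tangent_vector c q (\<Sum>b\<in>UNIV. y b (snd c q) *\<^sub>R axis b 1)" if q: "q \<in> W'" for q
  proof -
    have "Y q \<in> tangent_space A q" using Y' q by (auto simp: vector_field_on_def)
    moreover have "chart_inv c (snd c q) = q" using W'(2) q chart_inv_left[OF cA] by blast
    ultimately show ?thesis
      using tangent_vector_coords[OF _ ch[OF q]] by (simp add: y_def basis_expansion_scaleR)
  qed
  have F: "vector_field_on E A W' (\<lambda>q. tangent_vector c q (\<Sum>b\<in>UNIV. y b (snd c q) *\<^sub>R axis b 1))"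
    by (rule vector_field_tangent_vector[OF cA W'(1,2)])
      (intro smooth_on_sum[OF O] smooth_on_scaleR[OF O] smooth_on_const y)
  have yp: "y b (snd c p) = Y p c $ b" for b by (simp add: y_def chart_inv_left[OF cA pc])
  have coord: "D p v (coord_field A c b) c = (\<Sum>a\<in>UNIV. (v c $ a) *\<^sub>R (\<chi> k. christoffel A D c p a k b))" for b
    using covd_direction_sum[OF c vector_field_coord[OF cA] pc, of "\<lambda>a. v c $ a" UNIV b]
      tangent_vector_coords[OF v c]
    by (simp add: basis_expansion_scaleR christoffel_def)
  have dY: "((\<lambda>x. Y (chart_inv c x) c) has_derivative frechet_derivative (\<lambda>x. Y (chart_inv c x) c) (at (snd c p)))
      (at (snd c p))"
    by (rule has_derivative_frechet[OF smooth_on_differentiable[OF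
        smooth_on_chart_vector_field[OF Y' cA W'(2)]]]) (use W' in blast)
  have fdy: "frechet_derivative (y b) (at (snd c p)) (v c) = frechet_derivative (\<lambda>x. Y (chart_inv c x) c) (at (snd c p)) (v c) $ b" for b
    unfolding y_def by (simp add: frechetI[OF bounded_linear.has_derivative[OF bounded_linear_vec_nth dY]])
  have "D p v Y c = D p v (\<lambda>q. tangent_vector c q (\<Sum>b\<in>UNIV. y b (snd c q) *\<^sub>R axis b 1)) c"
    using covd_germ[OF Y' eq W'(4) v] by simp
  also have "\<dots> = (\<Sum>b\<in>UNIV. frechet_derivative (y b) (at (snd c p)) (v c) *\<^sub>R axis b 1
        + y b (snd c p) *\<^sub>R D p v (coord_field A c b) c)"
    by (rule covd_field_sum[OF cA W'(1,2,4) v y])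
  also have "\<dots> = frechet_derivative (\<lambda>x. Y (chart_inv c x) c) (at (snd c p)) (v c)
      + christoffel_form c p (v c) (Y p c)"
    by (simp add: sum.distrib fdy yp coord basis_expansion_scaleR christoffel_form_def scaleR_sum_right)
  finally show ?thesis .
qed

lemma bilinear_christoffel_form:
  "linear (\<lambda>x. christoffel_form c p x y)" "linear (christoffel_form c p x)"
  by (rule linearI; simp add: christoffel_form_def algebra_simps sum.distrib scaleR_sum_right)+

lemma christoffel_form_axis: "christoffel_form c p (axis a 1) (axis b 1) $ k = christoffel A D c p a k b"
proof -
  have "christoffel_form c p (axis a 1) (axis b 1)
      = (\<Sum>b'\<in>UNIV. \<Sum>a'\<in>UNIV. if b' = b then if a' = a then \<chi> k. christoffel A D c p a' k b' else 0 else 0)"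
    unfolding christoffel_form_def by (intro sum.cong refl) (simp add: axis_def)
  also have "\<dots> = (\<Sum>b'\<in>UNIV. if b' = b then (\<Sum>a'\<in>UNIV. if a' = a then \<chi> k. christoffel A D c p a' k b' else 0) else 0)"
    by (intro sum.cong refl) simp
  finally show ?thesis by simp
qed

lemma christoffel_symmetric:
  assumes tf: "torsion_free E A D" and c: "c \<in> charts_at A p"
  shows "christoffel A D c p a k b = christoffel A D c p b k a"
proof -
  have cA: "c \<in> A" and p: "p \<in> fst c" using c by (auto simp: charts_at_def)
  have O: "open (snd c ` fst c)" by (rule chart_image_open[OF cA chart_open[OF cA] subset_refl])
  have "frechet_derivative (\<lambda>x. coord_field A c b (chart_inv c x) c) (at (snd c p)) = (\<lambda>v. 0)" for b
  proof -
    have "coord_field A c b (chart_inv c x) c = axis b 1" if "x \<in> snd c ` fst c" for x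
      unfolding coord_field_eq
      by (rule coordinate_line(2)) (use cA chart_inv_image[OF cA subset_refl that] in \<open>auto simp: charts_at_def\<close>)
    then have "frechet_derivative (\<lambda>x. coord_field A c b (chart_inv c x) c) (at (snd c p))
        = frechet_derivative (\<lambda>x. axis b 1) (at (snd c p))"
      by (intro frechet_cong_open[OF O]) (use p in auto)
    then show ?thesis by simp
  qed
  then have "lie_bracket A (coord_field A c a) (coord_field A c b) p c = 0"
    by (simp add: lie_bracket_def)
  moreover have "tadd (D p (coord_field A c a p) (coord_field A c b))
      (tscale (-1) (D p (coord_field A c b p) (coord_field A c a)))
      = lie_bracket A (coord_field A c a) (coord_field A c b) p"
    using tf[unfolded torsion_free_def, rule_format, OF p] vector_field_coord[OF cA] by blast
  ultimately have "tadd (D p (coord_field A c a p) (coord_field A c b))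
      (tscale (-1) (D p (coord_field A c b p) (coord_field A c a))) c = 0"
    by simp
  then show ?thesis by (simp add: tadd_def tscale_def christoffel_def)
qed

lemma christoffel_form_symmetric:
  assumes "torsion_free E A D" "c \<in> charts_at A p"
  shows "christoffel_form c p x y = christoffel_form c p y x"
proof -
  have "christoffel_form c p x y = (\<Sum>a\<in>UNIV. \<Sum>b\<in>UNIV. (y $ b * x $ a) *\<^sub>R (\<chi> k. christoffel A D c p a k b))"
    unfolding christoffel_form_def by (rule sum.swap)
  also have "\<dots> = christoffel_form c p y x"
    unfolding christoffel_form_def
    by (simp add: christoffel_symmetric[OF assms, of _ _ "_::'k"] mult.commute)
  finally show ?thesis .
qed

end


section \<open>Submanifolds as graphs\<close>

definition join :: "real^'n::finite \<Rightarrow> real^'m::finite \<Rightarrow> real^('n + 'm)" where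
  "join x y = (\<chi> k. case k of Inl l \<Rightarrow> x $ l | Inr i \<Rightarrow> y $ i)"

lemma indep_join [simp]: "indep (join x y) = x"
  and dep_join [simp]: "dep (join x y) = y"
  by (simp_all add: indep_def dep_def join_def vec_eq_iff)

lemma join_indep_dep: "join (indep z) (dep z) = z"
  by (simp add: indep_def dep_def join_def vec_eq_iff split: sum.split)

lemma indep_dep_eqI:
  assumes "indep z = indep w" "dep z = dep w"
  shows "z = w"
  using join_indep_dep[of z] unfolding assms join_indep_dep[of w] by (rule sym)

lemma bounded_linear_indep: "bounded_linear indep"
  by (rule linear_conv_bounded_linear[THEN iffD1], rule linearI) (simp_all add: indep_def vec_eq_iff)

lemma bounded_linear_dep: "bounded_linear dep"
  by (rule linear_conv_bounded_linear[THEN iffD1], rule linearI) (simp_all add: dep_def vec_eq_iff)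

lemma bounded_linear_join_left: "bounded_linear (\<lambda>x. join x 0)"
  by (rule linear_conv_bounded_linear[THEN iffD1], rule linearI)
    (simp_all add: join_def vec_eq_iff split: sum.split)

lemma bounded_linear_join_right: "bounded_linear (\<lambda>y. join 0 y)"
  by (rule linear_conv_bounded_linear[THEN iffD1], rule linearI)
    (simp_all add: join_def vec_eq_iff split: sum.split)

lemma join_split: "join x y = join x 0 + join 0 y"
  by (simp add: join_def vec_eq_iff split: sum.split)

lemma indep_simps [simp]: "indep 0 = 0" "indep (x + y) = indep x + indep y"
    "indep (x - y) = indep x - indep y" "indep (r *\<^sub>R x) = r *\<^sub>R indep x"
  by (simp_all add: indep_def vec_eq_iff)

lemma dep_simps [simp]: "dep 0 = 0" "dep (x + y) = dep x + dep y"
    "dep (x - y) = dep x - dep y" "dep (r *\<^sub>R x) = r *\<^sub>R dep x"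
  by (simp_all add: dep_def vec_eq_iff)

lemma join_eq_0: "join x y = 0 \<longleftrightarrow> x = 0 \<and> y = 0"
  by (metis indep_join dep_join indep_simps(1) dep_simps(1) indep_dep_eqI)

lemma join_add: "join (x + x') (y + y') = join x y + join x' y'"
  by (rule indep_dep_eqI) simp_all

lemma join_scaleR: "join (r *\<^sub>R x) (r *\<^sub>R y) = r *\<^sub>R join x y"
  by (rule indep_dep_eqI) simp_all

lemma has_derivative_join:
  assumes "(f has_derivative f') F" "(g has_derivative g') F"
  shows "((\<lambda>x. join (f x) (g x)) has_derivative (\<lambda>v. join (f' v) (g' v))) F"
  using has_derivative_add[OF bounded_linear.has_derivative[OF bounded_linear_join_left assms(1)]
      bounded_linear.has_derivative[OF bounded_linear_join_right assms(2)]]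
  by (simp add: join_split[symmetric])

lemma smooth_on_join:
  assumes "open S" "smooth_on S f" "smooth_on S g"
  shows "smooth_on S (\<lambda>x. join (f x) (g x))"
  using smooth_on_add[OF assms(1) smooth_on_linear_comp[OF bounded_linear_join_left assms(1,2)]
      smooth_on_linear_comp[OF bounded_linear_join_right assms(1,3)]]
  by (simp add: join_split[symmetric])

lemma open_indep_image:
  fixes S :: "(real^('n::finite + 'm::finite)) set"
  assumes "open S"
  shows "open (indep ` S)"
proof -
  have "surj (indep :: real^('n + 'm) \<Rightarrow> real^'n)" by (rule surjI[of _ "\<lambda>x. join x 0"]) simp
  then show ?thesis
    using open_surjective_linear_image[OF assms] bounded_linear_indep linear_conv_bounded_linear by blast
qed

text \<open>
  The contact condition of order \<open>1\<close> or \<open>2\<close> with total derivatives in place of iterated partial ones,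
  to which the chain rule applies.
\<close>

definition same_jet :: "nat \<Rightarrow> ('a::euclidean_space \<Rightarrow> 'b::euclidean_space) \<Rightarrow> ('a \<Rightarrow> 'b) \<Rightarrow> 'a \<Rightarrow> bool" where
  "same_jet r f g x \<longleftrightarrow> f x = g x \<and> (\<forall>v. frechet_derivative f (at x) v = frechet_derivative g (at x) v) \<and>
     (2 \<le> r \<longrightarrow> (\<forall>v w. second_derivative f x v w = second_derivative g x v w))"

lemma same_jet_sym: "same_jet r f g x \<Longrightarrow> same_jet r g f x"
  by (simp add: same_jet_def)

lemma same_jet_trans: "same_jet r f g x \<Longrightarrow> same_jet r g h x \<Longrightarrow> same_jet r f h x"
  by (simp add: same_jet_def)

lemma same_jet_cong_open:
  assumes "open S" "x \<in> S" "\<And>y. y \<in> S \<Longrightarrow> f y = g y"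
  shows "same_jet r f g x"
proof -
  have "frechet_derivative f (at y) = frechet_derivative g (at y)" if "y \<in> S" for y
    by (rule frechet_cong_open[OF assms(1) that assms(3)])
  then have "second_derivative f x v w = second_derivative g x v w" for v w
    by (intro fun_cong[OF frechet_cong_open[OF assms(1,2)]]) simp
  then show ?thesis
    unfolding same_jet_def using assms(2,3) frechet_cong_open[OF assms(1,2), of f g] by simp
qed

lemma iter_partial_diff_eq_0_iff:
  fixes f g :: "real^'n \<Rightarrow> 'b::euclidean_space"
  assumes S: "open S" and f: "smooth_on S f" and g: "smooth_on S g" and x: "x \<in> S"
    and r: "r = 1 \<or> r = 2"
  shows "(\<forall>s. length s \<le> r \<longrightarrow> iter_partial s (\<lambda>x. f x - g x) x = 0) \<longleftrightarrow> same_jet r f g x"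
proof -
  let ?h = "\<lambda>x. f x - g x"
  have d1: "frechet_derivative ?h (at y) v = frechet_derivative f (at y) v - frechet_derivative g (at y) v"
    if "y \<in> S" for y v
    using frechetI[OF has_derivative_diff[OF has_derivative_frechet[OF smooth_on_differentiable[OF f that]]
          has_derivative_frechet[OF smooth_on_differentiable[OF g that]]]] by simp
  have d2: "second_derivative ?h x v w = second_derivative f x v w - second_derivative g x v w" for v w
  proof -
    have "second_derivative ?h x v w =
        frechet_derivative (\<lambda>y. frechet_derivative f (at y) v - frechet_derivative g (at y) v) (at x) w"
      by (rule fun_cong[OF frechet_cong_open[OF S x]]) (rule d1)
    then show ?thesis
      using frechetI[OF has_derivative_diff[OF
            has_derivative_frechet[OF smooth_on_differentiable[OF smooth_on_derivative[OF f] x]]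
            has_derivative_frechet[OF smooth_on_differentiable[OF smooth_on_derivative[OF g] x]]]] by simp
  qed
  have L1: "linear (frechet_derivative f (at x))" "linear (frechet_derivative g (at x))"
    by (rule linear_frechet[OF smooth_on_differentiable[OF f x]])
      (rule linear_frechet[OF smooth_on_differentiable[OF g x]])
  have axis1: "(\<forall>v. frechet_derivative f (at x) v = frechet_derivative g (at x) v) \<longleftrightarrow>
      (\<forall>l. frechet_derivative f (at x) (axis l 1) = frechet_derivative g (at x) (axis l 1))"
    using linear_eq_axisI[OF L1] by blast
  have axis2: "(\<forall>v w. second_derivative f x v w = second_derivative g x v w) \<longleftrightarrow>
      (\<forall>l m. second_derivative f x (axis m 1) (axis l 1) = second_derivative g x (axis m 1) (axis l 1))"
  proof
    assume *: "\<forall>l m. second_derivative f x (axis m 1) (axis l 1) = second_derivative g x (axis m 1) (axis l 1)"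
    have "second_derivative f x v (axis l 1) = second_derivative g x v (axis l 1)" for v l
      by (rule linear_eq_axisI[OF linear_second_derivative_left[OF S f x] linear_second_derivative_left[OF S g x]])
        (use * in blast)
    then have "second_derivative f x v w = second_derivative g x v w" for v w
      by (rule linear_eq_axisI[OF linear_second_derivative_right[OF f x] linear_second_derivative_right[OF g x]])
    then show "\<forall>v w. second_derivative f x v w = second_derivative g x v w" by blast
  qed blast
  have len1: "length s \<le> 1 \<longleftrightarrow> s = [] \<or> (\<exists>l. s = [l])" for s :: "'n list"
    by (cases s) auto
  have len2: "length s \<le> 2 \<longleftrightarrow> s = [] \<or> (\<exists>l. s = [l]) \<or> (\<exists>l m. s = [l, m])" for s :: "'n list"
  proof (cases s)
    case (Cons a t) then show ?thesis by (cases t) auto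
  qed simp
  have p0: "iter_partial [] ?h x = 0 \<longleftrightarrow> f x = g x" by simp
  have p1: "(\<forall>l. iter_partial [l] ?h x = 0) \<longleftrightarrow>
      (\<forall>v. frechet_derivative f (at x) v = frechet_derivative g (at x) v)"
    unfolding axis1 by (simp add: d1[OF x])
  have p2: "(\<forall>l m. iter_partial [l, m] ?h x = 0) \<longleftrightarrow>
      (\<forall>v w. second_derivative f x v w = second_derivative g x v w)"
    unfolding axis2 by (simp add: d2)
  show ?thesis
    using r
  proof
    assume r: "r = 1"
    show ?thesis unfolding same_jet_def r len1 p0[symmetric] p1[symmetric]
      by (simp del: iter_partial.simps) blast
  next
    assume r: "r = 2"
    show ?thesis unfolding same_jet_def r len2 p0[symmetric] p1[symmetric] p2[symmetric]
      by (simp del: iter_partial.simps) blast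
  qed
qed

locale graph_manifold = manifold E A
  for E :: "'e topology" and A :: "('e, real^('n::finite + 'm::finite)) chart set"
begin

text \<open>
  A normal form of \<^const>\<open>graph_at\<close>, in which the graphing function is defined on exactly the
  projection \<open>S\<close> of the neighbourhood \<open>W\<close> and its whole graph lies in \<open>W\<close>.
\<close>

definition graph_on :: "('e, real^('n + 'm)) chart \<Rightarrow> 'e set \<Rightarrow> (real^'n \<Rightarrow> real^'m) \<Rightarrow> 'e set \<Rightarrow> (real^'n) set \<Rightarrow> bool" where
  "graph_on c L f W S \<longleftrightarrow> openin E W \<and> W \<subseteq> fst c \<and> open S \<and> smooth_on S f \<and>
     (\<forall>q\<in>W. indep (snd c q) \<in> S) \<and> (\<forall>x\<in>S. join x (f x) \<in> snd c ` W) \<and>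
     L \<inter> W = {q \<in> W. dep (snd c q) = f (indep (snd c q))}"

lemma graph_onD:
  assumes "graph_on c L f W S"
  shows "openin E W" "W \<subseteq> fst c" "open S" "smooth_on S f" "\<And>q. q \<in> W \<Longrightarrow> indep (snd c q) \<in> S"
    "\<And>x. x \<in> S \<Longrightarrow> join x (f x) \<in> snd c ` W"
    "\<And>q. q \<in> W \<Longrightarrow> q \<in> L \<longleftrightarrow> dep (snd c q) = f (indep (snd c q))"
  using assms unfolding graph_on_def by blast+

lemma graph_at_normal:
  assumes c: "c \<in> A" and g: "graph_at E c p L f" and N: "openin E N" "p \<in> N"
  obtains W S where "graph_on c L f W S" "p \<in> W" "W \<subseteq> N"
proof -
  obtain W0 where W0: "openin E W0" "p \<in> W0" "W0 \<subseteq> fst c" "smooth_on (indep ` snd c ` W0) f"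
      "L \<inter> W0 = {q \<in> W0. dep (snd c q) = f (indep (snd c q))}" and pL: "p \<in> L"
    using g unfolding graph_at_def by blast
  define W1 where "W1 = W0 \<inter> N"
  have W1: "openin E W1" "p \<in> W1" "W1 \<subseteq> fst c" using W0 N by (auto simp: W1_def)
  have oW1: "open (snd c ` W1)" by (rule chart_image_open[OF c W1(1,3)])
  define S1 where "S1 = indep ` snd c ` W1"
  have S1: "open S1" unfolding S1_def by (rule open_indep_image[OF oW1])
  have f1: "smooth_on S1 f"
    by (rule smooth_on_subset[OF W0(4)]) (auto simp: S1_def W1_def)
  \<comment> \<open>Points of the projection over which the graph leaves the neighbourhood have to be discarded.\<close>
  define S where "S = S1 \<inter> (\<lambda>x. join x (f x)) -` (snd c ` W1)"
  have cont: "continuous_on S1 (\<lambda>x. join x (f x))"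
    by (rule smooth_on_continuous[OF smooth_on_join[OF S1 smooth_on_id[OF S1] f1]])
  have oS: "open S"
    unfolding S_def by (rule continuous_open_preimage[OF cont S1 oW1])
  define W where "W = {q \<in> W1. indep (snd c q) \<in> S}"
  have "W = W1 \<inter> {q \<in> fst c. snd c q \<in> indep -` S}" using W1(3) by (auto simp: W_def)
  moreover have "open (indep -` S)"
    by (rule open_vimage[OF oS linear_continuous_on[OF bounded_linear_indep]])
  ultimately have oW: "openin E W"
    using openin_Int[OF W1(1) chart_preimage_open[OF c]] by metis
  have "dep (snd c p) = f (indep (snd c p))" using W0(2,5) pL by blast
  then have "join (indep (snd c p)) (f (indep (snd c p))) = snd c p"
    using join_indep_dep[of "snd c p"] by simp
  then have pW: "p \<in> W" using W1(2) by (auto simp: W_def S_def S1_def)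
  have "join x (f x) \<in> snd c ` W" if "x \<in> S" for x
  proof -
    have "join x (f x) \<in> snd c ` W1" using that unfolding S_def by blast
    then obtain q where q: "q \<in> W1" "join x (f x) = snd c q" by blast
    have "indep (snd c q) = x" unfolding q(2)[symmetric] by simp
    then have "q \<in> W" using q(1) that unfolding W_def by simp
    then show ?thesis unfolding q(2) by (rule imageI)
  qed
  moreover have "L \<inter> W = {q \<in> W. dep (snd c q) = f (indep (snd c q))}"
    using W0(5) by (auto simp: W_def W1_def)
  moreover have "smooth_on S f" by (rule smooth_on_subset[OF f1]) (simp add: S_def)
  moreover have "W \<subseteq> fst c" "\<forall>q\<in>W. indep (snd c q) \<in> S" using W1(3) by (auto simp: W_def)
  ultimately have "graph_on c L f W S"
    unfolding graph_on_def using oW oS by blast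
  then show ?thesis by (rule that[OF _ pW]) (auto simp: W_def W1_def)
qed

lemma graph_on_graph_at:
  assumes "graph_on c L f W S" "q \<in> W" "q \<in> L"
  shows "graph_at E c q L f"
proof -
  note g = graph_onD[OF assms(1)]
  have "smooth_on (indep ` snd c ` W) f"
    by (rule smooth_on_subset[OF g(4)]) (use g(5) in auto)
  moreover have "L \<inter> W = {q \<in> W. dep (snd c q) = f (indep (snd c q))}"
    using assms(1) by (simp add: graph_on_def)
  ultimately show ?thesis
    unfolding graph_at_def using g(1,2) assms(2,3) by blast
qed

lemma graph_at_mem: "graph_at E c p L f \<Longrightarrow> p \<in> L"
  by (simp add: graph_at_def)

lemma graph_at_chart: "c \<in> A \<Longrightarrow> graph_at E c p L f \<Longrightarrow> c \<in> charts_at A p"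
  unfolding graph_at_def charts_at_def by blast

lemma graph_on_coords:
  assumes "graph_on c L f W S" "q \<in> W" "q \<in> L"
  shows "snd c q = join (indep (snd c q)) (f (indep (snd c q)))" "indep (snd c q) \<in> S"
  using graph_onD(7)[OF assms(1,2)] assms(3) join_indep_dep[of "snd c q"] graph_onD(5)[OF assms(1,2)]
  by simp_all

lemma graph_on_point:
  assumes c: "c \<in> A" and g: "graph_on c L f W S" and x: "x \<in> S"
  shows "chart_inv c (join x (f x)) \<in> W" "chart_inv c (join x (f x)) \<in> L"
    "snd c (chart_inv c (join x (f x))) = join x (f x)"
proof -
  note g' = graph_onD[OF g]
  show W: "chart_inv c (join x (f x)) \<in> W" by (rule chart_inv_image[OF c g'(2) g'(6)[OF x]])
  show eq: "snd c (chart_inv c (join x (f x))) = join x (f x)"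
    by (rule chart_inv_right[OF g'(6)[OF x] g'(2)])
  show "chart_inv c (join x (f x)) \<in> L"
    using g'(7)[OF W] by (simp add: eq)
qed

lemma graph_at_base:
  assumes "c \<in> A" "graph_at E c p L f"
  shows "dep (snd c p) = f (indep (snd c p))" "snd c p = join (indep (snd c p)) (f (indep (snd c p)))"
proof -
  show "dep (snd c p) = f (indep (snd c p))" using assms(2) unfolding graph_at_def by blast
  then show "snd c p = join (indep (snd c p)) (f (indep (snd c p)))"
    using join_indep_dep[of "snd c p"] by simp
qed

lemma graph_at_smooth:
  assumes "c \<in> A" "graph_at E c p L f"
  obtains S where "open S" "smooth_on S f" "indep (snd c p) \<in> S"
proof -
  have p: "p \<in> topspace E" using assms(2) openin_subset unfolding graph_at_def by blast
  obtain W S where W: "graph_on c L f W S" "p \<in> W"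
    using graph_at_normal[OF assms openin_topspace p] by blast
  show ?thesis by (rule that[OF graph_onD(3,4)[OF W(1)] graph_onD(5)[OF W]])
qed

lemma graph_at_topspace: "graph_at E c p L f \<Longrightarrow> p \<in> topspace E"
  using openin_subset unfolding graph_at_def by blast

text \<open>
  Near the base point the graph of \<open>f'\<close> lies in the neighbourhood in which \<open>L\<close> is the graph of \<open>f\<close>, so
  that \<open>f\<close> and \<open>f'\<close> have the same germ.
\<close>

lemma graph_at_unique:
  assumes c: "c \<in> A" and g: "graph_at E c p L f" and g': "graph_at E c p L f'"
  shows "same_jet r f f' (indep (snd c p))"
proof -
  obtain W S where W: "graph_on c L f W S" "p \<in> W"
    using graph_at_normal[OF c g openin_topspace graph_at_topspace[OF g]] by blast
  obtain W' S' where W': "graph_on c L f' W' S'" "p \<in> W'" "W' \<subseteq> W"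
    using graph_at_normal[OF c g' graph_onD(1)[OF W(1)] W(2)] by blast
  have "f y = f' y" if "y \<in> S'" for y
    using graph_on_point[OF c W'(1) that] W'(3) graph_onD(7)[OF W(1), of "chart_inv c (join y (f' y))"] by auto
  then show ?thesis
    by (rule same_jet_cong_open[OF graph_onD(3)[OF W'(1)] graph_onD(5)[OF W'(1,2)]])
qed

subsection \<open>The tangent space of a graph\<close>

text \<open>A curve in the graph projecting to a line, used to realise all tangent vectors of the graph.\<close>

lemma graph_curve:
  assumes c: "c \<in> A" and g: "graph_on c L f W S" and q: "q \<in> W" "q \<in> L"
  obtains \<gamma> where "smooth_curve_at A q \<gamma>"
    "velocity A q \<gamma> c = join v (frechet_derivative f (at (indep (snd c q))) v)"
    "\<exists>e>0. \<gamma> ` {-e<..<e} \<subseteq> L"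
proof -
  note g' = graph_onD[OF g]
  define x where "x = indep (snd c q)"
  have x: "x \<in> S" "snd c q = join x (f x)" unfolding x_def using graph_on_coords[OF g q] by blast+
  have ch: "c \<in> charts_at A q" using c q g'(2) by (auto simp: charts_at_def)
  let ?l = "\<lambda>t::real. x + t *\<^sub>R v" and ?y = "\<lambda>t. join (x + t *\<^sub>R v) (f (x + t *\<^sub>R v))"
  let ?\<gamma> = "\<lambda>t. chart_inv c (?y t)"
  have "continuous_on UNIV ?l" by (intro continuous_intros)
  then have T: "open (?l -` S)"
    using g'(3) by (simp add: continuous_on_open_vimage[OF open_UNIV])
  have 0: "0 \<in> ?l -` S" using x by simp
  have sl: "smooth_on (?l -` S) ?l"
    by (intro smooth_on_add smooth_on_const smooth_on_linear T bounded_linear_scaleR_left)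
  have "smooth_on (?l -` S) (\<lambda>t. f (?l t))"
    by (rule smooth_on_compose[OF T g'(3) sl g'(4)]) auto
  then have "smooth_on (?l -` S) ?y" by (rule smooth_on_join[OF T sl])
  then have sm: "smooth_on (?l -` S) (\<lambda>t. snd c (?\<gamma> t))"
    by (rule smooth_on_cong[OF T, rotated]) (use graph_on_point(3)[OF c g] in simp)
  have inW: "?\<gamma> t \<in> W" "?\<gamma> t \<in> L" if "t \<in> ?l -` S" for t
    using graph_on_point[OF c g] that by auto
  have "?\<gamma> 0 = q" using x chart_inv_left[OF c, of q] ch by (simp add: charts_at_def)
  then have curve: "smooth_curve_at A q ?\<gamma>"
    by (rule smooth_curve_atI[OF ch _ T 0 _ sm]) (use inW g'(2) in blast)
  have fx: "(f has_derivative frechet_derivative f (at x)) (at (?l 0))"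
    using has_derivative_frechet[OF smooth_on_differentiable[OF g'(4) x(1)]] by simp
  have l: "(?l has_vector_derivative v) (at 0)"
    by (auto intro!: derivative_eq_intros)
  have "(?y has_derivative (\<lambda>t. join (t *\<^sub>R v) (t *\<^sub>R frechet_derivative f (at x) v))) (at 0)"
    using has_derivative_join[OF l[unfolded has_vector_derivative_def]
        has_vector_derivative_compose[OF l fx, unfolded has_vector_derivative_def]] .
  then have "(?y has_vector_derivative join v (frechet_derivative f (at x) v)) (at 0)"
    unfolding has_vector_derivative_def by (simp add: join_scaleR)
  then have "((\<lambda>t. snd c (?\<gamma> t)) has_vector_derivative join v (frechet_derivative f (at x) v)) (at 0)"
    by (rule has_vector_derivative_transform_within_open[OF _ T 0])
      (use graph_on_point(3)[OF c g] in simp)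
  then have vel: "velocity A q ?\<gamma> c = join v (frechet_derivative f (at x) v)"
    by (rule velocityI[OF ch])
  obtain e where "e > 0" "{-e<..<e} \<subseteq> ?l -` S" by (rule open_zero_interval[OF T 0])
  then have "\<exists>e>0. ?\<gamma> ` {-e<..<e} \<subseteq> L" using inW(2) by blast
  then show ?thesis using that[OF curve] vel unfolding x_def by blast
qed

lemma tangent_to_graph_on:
  assumes c: "c \<in> A" and g: "graph_on c L f W S" and q: "q \<in> W" "q \<in> L"
  shows "tangent_to A L q =
    {v \<in> tangent_space A q. dep (v c) = frechet_derivative f (at (indep (snd c q))) (indep (v c))}"
    (is "_ = ?R")
proof
  note g' = graph_onD[OF g]
  have ch: "c \<in> charts_at A q" using c q g'(2) by (auto simp: charts_at_def)
  have xS: "indep (snd c q) \<in> S" using g'(5) q by blast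
  show "tangent_to A L q \<subseteq> ?R"
  proof
    fix v assume "v \<in> tangent_to A L q"
    then obtain \<gamma> e where \<gamma>: "smooth_curve_at A q \<gamma>" "v = velocity A q \<gamma>" "e > 0" "\<gamma> ` {-e<..<e} \<subseteq> L"
      unfolding tangent_to_def by blast
    obtain e' where e': "e' > 0" "\<And>t. t \<in> {-e'<..<e'} \<Longrightarrow> \<gamma> t \<in> W \<inter> fst c"
      using smooth_curve_near[OF \<gamma>(1) ch g'(1) q(1)] by blast
    let ?e = "min e e'"
    have eq: "dep (snd c (\<gamma> t)) = f (indep (snd c (\<gamma> t)))" if "t \<in> {-?e<..<?e}" for t
    proof -
      have "\<gamma> t \<in> L" "\<gamma> t \<in> W" using that \<gamma>(4) e'(2)[of t] by auto
      then show ?thesis using g'(7) by blast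
    qed
    have "((\<lambda>t. snd c (\<gamma> t)) has_vector_derivative v c) (at 0)"
      unfolding \<gamma>(2) by (rule smooth_curve_velocity[OF \<gamma>(1) ch])
    then have d: "((\<lambda>t. indep (snd c (\<gamma> t))) has_vector_derivative indep (v c)) (at 0)"
      "((\<lambda>t. dep (snd c (\<gamma> t))) has_vector_derivative dep (v c)) (at 0)"
      by (rule bounded_linear.has_vector_derivative[OF bounded_linear_indep],
          rule bounded_linear.has_vector_derivative[OF bounded_linear_dep])
    have "((\<lambda>t. f (indep (snd c (\<gamma> t)))) has_vector_derivative
        frechet_derivative f (at (indep (snd c q))) (indep (v c))) (at 0)"
      by (rule has_vector_derivative_compose[OF d(1)])
        (use has_derivative_frechet[OF smooth_on_differentiable[OF g'(4) xS]] smooth_curve_start[OF \<gamma>(1)] in simp)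
    then have "((\<lambda>t. dep (snd c (\<gamma> t))) has_vector_derivative
        frechet_derivative f (at (indep (snd c q))) (indep (v c))) (at 0)"
      by (rule has_vector_derivative_transform_within_open[where S = "{-?e<..<?e}"])
        (use eq \<gamma>(3) e'(1) in auto)
    then have "dep (v c) = frechet_derivative f (at (indep (snd c q))) (indep (v c))"
      using vector_derivative_unique_at d(2) by blast
    moreover have "v \<in> tangent_space A q" using \<gamma> unfolding tangent_space_def by blast
    ultimately show "v \<in> ?R" by blast
  qed
  show "?R \<subseteq> tangent_to A L q"
  proof
    fix v assume v: "v \<in> ?R"
    obtain \<gamma> where \<gamma>: "smooth_curve_at A q \<gamma>"
      "velocity A q \<gamma> c = join (indep (v c)) (frechet_derivative f (at (indep (snd c q))) (indep (v c)))"
      "\<exists>e>0. \<gamma> ` {-e<..<e} \<subseteq> L"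
      by (rule graph_curve[OF c g q, of "indep (v c)"])
    have "velocity A q \<gamma> \<in> tangent_space A q" using \<gamma>(1) unfolding tangent_space_def by blast
    moreover have "velocity A q \<gamma> c = v c"
      unfolding \<gamma>(2) using v join_indep_dep[of "v c"] by auto
    ultimately have "velocity A q \<gamma> = v" using tangent_eqI[OF _ _ ch] v by blast
    then show "v \<in> tangent_to A L q" using \<gamma> unfolding tangent_to_def by blast
  qed
qed

lemma tangent_to_graph:
  assumes c: "c \<in> A" and g: "graph_at E c p L f"
  shows "tangent_to A L p =
    {v \<in> tangent_space A p. dep (v c) = frechet_derivative f (at (indep (snd c p))) (indep (v c))}"
proof -
  obtain W S where W: "graph_on c L f W S" "p \<in> W"
    using graph_at_normal[OF c g openin_topspace graph_at_topspace[OF g]] by blast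
  show ?thesis by (rule tangent_to_graph_on[OF c W graph_at_mem[OF g]])
qed

end


section \<open>Change of chart for graphs and contact\<close>

context graph_manifold
begin

text \<open>The first two derivatives at \<open>y\<close> of the graph map \<open>y \<mapsto> \<phi>(y, g y)\<close> in a second chart.\<close>

definition graph_d1 where
  "graph_d1 \<phi> g y v = frechet_derivative \<phi> (at (join y (g y))) (join v (frechet_derivative g (at y) v))"
  for \<phi> :: "real^('n + 'm) \<Rightarrow> real^('n + 'm)" and g :: "real^'n \<Rightarrow> real^'m"

definition graph_d2 where
  "graph_d2 \<phi> g y v w =
    second_derivative \<phi> (join y (g y)) (join v (frechet_derivative g (at y) v)) (join w (frechet_derivative g (at y) w))
    + frechet_derivative \<phi> (at (join y (g y))) (join 0 (second_derivative g y v w))"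
  for \<phi> :: "real^('n + 'm) \<Rightarrow> real^('n + 'm)" and g :: "real^'n \<Rightarrow> real^'m"

lemma graph_map_derivatives:
  assumes S: "open S" "smooth_on S g" "y \<in> S" and T: "open T" "smooth_on T \<phi>" "join y (g y) \<in> T"
  shows "((\<lambda>y. \<phi> (join y (g y))) has_derivative graph_d1 \<phi> g y) (at y)"
    and "((\<lambda>y. graph_d1 \<phi> g y v) has_derivative graph_d2 \<phi> g y v) (at y)"
proof -
  have g: "(g has_derivative frechet_derivative g (at y)) (at y)"
    by (rule has_derivative_frechet[OF smooth_on_differentiable[OF S(2,3)]])
  have j: "((\<lambda>y. join y (g y)) has_derivative (\<lambda>v. join v (frechet_derivative g (at y) v))) (at y)"
    by (rule has_derivative_join[OF has_derivative_ident g])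
  show "((\<lambda>y. \<phi> (join y (g y))) has_derivative graph_d1 \<phi> g y) (at y)"
    unfolding graph_d1_def[abs_def]
    by (rule has_derivative_compose[OF j has_derivative_frechet[OF smooth_on_differentiable[OF T(2,3)]]])
  have dg: "((\<lambda>y. frechet_derivative g (at y) v) has_derivative second_derivative g y v) (at y)"
    by (rule has_derivative_frechet[OF smooth_on_differentiable[OF smooth_on_derivative[OF S(2)] S(3)]])
  show "((\<lambda>y. graph_d1 \<phi> g y v) has_derivative graph_d2 \<phi> g y v) (at y)"
    unfolding graph_d1_def graph_d2_def[abs_def]
    by (rule has_derivative_directional_derivative[where a = "\<lambda>y. join y (g y)",
        OF T j has_derivative_join[OF has_derivative_const dg]])
qed

lemma same_jet_graph_d:
  assumes "same_jet r g g' y"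
  shows "graph_d1 \<phi> g y v = graph_d1 \<phi> g' y v"
    "2 \<le> r \<Longrightarrow> graph_d2 \<phi> g y v w = graph_d2 \<phi> g' y v w"
  using assms by (simp_all add: graph_d1_def graph_d2_def same_jet_def)

text \<open>
  The graph map of \<open>g\<close>, read in the chart \<open>d\<close>, runs through the graph of \<open>f\<close>: its dependent part is \<open>f\<close>
  applied to its independent part. Differentiating this relation twice expresses the derivatives of
  \<open>f\<close> by those of \<open>g\<close>.
\<close>

lemma graph_change:
  assumes c: "c \<in> A" and d: "d \<in> A" and g: "graph_at E c p L g" and f: "graph_at E d p L f"
  defines "\<phi> \<equiv> transition c d" and "y \<equiv> indep (snd c p)" and "x \<equiv> indep (snd d p)"
  shows "dep (graph_d1 \<phi> g y v) = frechet_derivative f (at x) (indep (graph_d1 \<phi> g y v))"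
    and "dep (graph_d2 \<phi> g y v w) =
      second_derivative f x (indep (graph_d1 \<phi> g y v)) (indep (graph_d1 \<phi> g y w))
      + frechet_derivative f (at x) (indep (graph_d2 \<phi> g y v w))"
proof -
  obtain Wd Sd where Wd: "graph_on d L f Wd Sd" "p \<in> Wd"
    using graph_at_normal[OF d f openin_topspace graph_at_topspace[OF f]] by blast
  obtain W S where W: "graph_on c L g W S" "p \<in> W" "W \<subseteq> Wd"
    using graph_at_normal[OF c g graph_onD(1)[OF Wd(1)] Wd(2)] by blast
  note G = graph_onD[OF W(1)] and F = graph_onD[OF Wd(1)]
  let ?T = "snd c ` (fst c \<inter> fst d)"
  have T: "open ?T" "smooth_on ?T \<phi>"
    unfolding \<phi>_def using overlap_open[OF c d] transition_smooth[OF c d] by blast+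
  have jT: "join z (g z) \<in> ?T" if "z \<in> S" for z
    using G(6)[OF that] G(2) W(3) F(2) by blast
  have yS: "y \<in> S" unfolding y_def by (rule G(5)[OF W(2)])
  let ?H = "\<lambda>z. \<phi> (join z (g z))"
  have H: "indep (?H z) \<in> Sd" "dep (?H z) = f (indep (?H z))" if "z \<in> S" for z
  proof -
    let ?q = "chart_inv c (join z (g z))"
    have q: "?q \<in> Wd" "?q \<in> L" using graph_on_point[OF c W(1) that] W(3) by blast+
    show "indep (?H z) \<in> Sd" unfolding \<phi>_def by (rule F(5)[OF q(1)])
    show "dep (?H z) = f (indep (?H z))" unfolding \<phi>_def using F(7)[OF q(1)] q(2) by blast
  qed
  have Hy: "indep (?H y) = x"
    unfolding \<phi>_def x_def y_def graph_at_base(2)[OF c g, symmetric]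
    using transition_apply[OF graph_at_chart[OF c g]] by simp
  note D = graph_map_derivatives[OF G(3,4) _ T jT]
  have df: "(f has_derivative frechet_derivative f (at (indep (?H z)))) (at (indep (?H z)))" if "z \<in> S" for z
    by (rule has_derivative_frechet[OF smooth_on_differentiable[OF F(4) H(1)[OF that]]])
  have first: "dep (graph_d1 \<phi> g z v) = frechet_derivative f (at (indep (?H z))) (indep (graph_d1 \<phi> g z v))"
    if z: "z \<in> S" for z v
  proof -
    have i: "((\<lambda>z. indep (?H z)) has_derivative (\<lambda>v. indep (graph_d1 \<phi> g z v))) (at z)"
      by (rule bounded_linear.has_derivative[OF bounded_linear_indep D(1)[OF z z]])
    have "((\<lambda>z. dep (?H z)) has_derivative (\<lambda>v. dep (graph_d1 \<phi> g z v))) (at z)"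
      by (rule bounded_linear.has_derivative[OF bounded_linear_dep D(1)[OF z z]])
    moreover have "((\<lambda>z. dep (?H z)) has_derivative
        (\<lambda>v. frechet_derivative f (at (indep (?H z))) (indep (graph_d1 \<phi> g z v)))) (at z)"
      by (rule has_derivative_transform_within_open[OF has_derivative_compose[OF i df[OF z]] G(3) z])
        (simp add: H(2))
    ultimately show ?thesis using has_derivative_unique by (metis (no_types, lifting))
  qed
  show "dep (graph_d1 \<phi> g y v) = frechet_derivative f (at x) (indep (graph_d1 \<phi> g y v))"
    using first[OF yS] unfolding Hy .
  have a: "((\<lambda>z. indep (?H z)) has_derivative (\<lambda>w. indep (graph_d1 \<phi> g y w))) (at y)"
    by (rule bounded_linear.has_derivative[OF bounded_linear_indep D(1)[OF yS yS]])
  have b: "((\<lambda>z. indep (graph_d1 \<phi> g z v)) has_derivative (\<lambda>w. indep (graph_d2 \<phi> g y v w))) (at y)"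
    by (rule bounded_linear.has_derivative[OF bounded_linear_indep D(2)[OF yS yS]])
  have "((\<lambda>z. dep (graph_d1 \<phi> g z v)) has_derivative (\<lambda>w. dep (graph_d2 \<phi> g y v w))) (at y)"
    by (rule bounded_linear.has_derivative[OF bounded_linear_dep D(2)[OF yS yS]])
  moreover have "((\<lambda>z. dep (graph_d1 \<phi> g z v)) has_derivative (\<lambda>w.
      second_derivative f (indep (?H y)) (indep (graph_d1 \<phi> g y v)) (indep (graph_d1 \<phi> g y w))
      + frechet_derivative f (at (indep (?H y))) (indep (graph_d2 \<phi> g y v w)))) (at y)"
    by (rule has_derivative_transform_within_open[OF has_derivative_directional_derivative[where
          a = "\<lambda>z. indep (?H z)", OF F(3,4) H(1)[OF yS] a b] G(3) yS])
      (simp add: first)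
  ultimately have "(\<lambda>w. dep (graph_d2 \<phi> g y v w)) = (\<lambda>w.
      second_derivative f (indep (?H y)) (indep (graph_d1 \<phi> g y v)) (indep (graph_d1 \<phi> g y w))
      + frechet_derivative f (at (indep (?H y))) (indep (graph_d2 \<phi> g y v w)))"
    by (rule has_derivative_unique)
  then show "dep (graph_d2 \<phi> g y v w) =
      second_derivative f x (indep (graph_d1 \<phi> g y v)) (indep (graph_d1 \<phi> g y w))
      + frechet_derivative f (at x) (indep (graph_d2 \<phi> g y v w))"
    unfolding Hy by (rule fun_cong)
qed

lemma graph_tangent_vector:
  assumes c: "c \<in> A" and g: "graph_at E c p L g"
  shows "tangent_vector c p (join v (frechet_derivative g (at (indep (snd c p))) v)) \<in> tangent_to A L p"
  unfolding tangent_to_graph[OF c g]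
  using tangent_vector_mem[OF graph_at_chart[OF c g]] coordinate_line(2)[OF graph_at_chart[OF c g]]
  by simp

lemma graph_d1_tangent:
  assumes c: "c \<in> A" and g: "graph_at E c p L g" and d: "d \<in> charts_at A p"
  shows "graph_d1 (transition c d) g (indep (snd c p)) v
    = tangent_vector c p (join v (frechet_derivative g (at (indep (snd c p))) v)) d"
proof -
  note ch = graph_at_chart[OF c g]
  show ?thesis
    unfolding graph_d1_def graph_at_base(2)[OF c g, symmetric]
      tangent_change[OF tangent_vector_mem[OF ch] ch d] coordinate_line(2)[OF ch] ..
qed

text \<open>
  The vectors with vanishing independent part are those tangent to the fibres \<open>u\<^sup>\<lambda> = const\<close> of \<open>d\<close>.
\<close>

definition transversal where
  "transversal d p L \<longleftrightarrow> (\<forall>v\<in>tangent_to A L p. indep (v d) = 0 \<longrightarrow> v d = 0)"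

lemma graph_transversal:
  assumes "d \<in> A" "graph_at E d p L f"
  shows "transversal d p L"
proof -
  have "linear (frechet_derivative f (at (indep (snd d p))))"
    using graph_at_smooth[OF assms] smooth_on_differentiable linear_frechet by metis
  then have "frechet_derivative f (at (indep (snd d p))) 0 = 0" by (rule linear_0)
  then have "v d = 0" if "v \<in> tangent_to A L p" "indep (v d) = 0" for v
    using that unfolding tangent_to_graph[OF assms] by (intro indep_dep_eqI) auto
  then show ?thesis unfolding transversal_def by blast
qed

lemma transversal_inj:
  assumes c: "c \<in> A" and g: "graph_at E c p L g" and d: "d \<in> charts_at A p" and t: "transversal d p L"
    and 0: "indep (graph_d1 (transition c d) g (indep (snd c p)) v) = 0"
  shows "v = 0"
proof -
  note ch = graph_at_chart[OF c g]
  let ?u = "tangent_vector c p (join v (frechet_derivative g (at (indep (snd c p))) v))"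
  have "?u d = 0"
    using t graph_tangent_vector[OF c g] 0 unfolding transversal_def graph_d1_tangent[OF c g d] by blast
  moreover have "tangent_vector c p 0 d = 0"
    using tangent_lincomb_eq[OF ch, of 0 0 0 0] by (auto simp: tadd_def tscale_def dest: fun_cong)
  ultimately have "?u = tangent_vector c p 0"
    by (intro tangent_eqI[OF tangent_vector_mem[OF ch] tangent_vector_mem[OF ch] d]) simp
  then have "join v (frechet_derivative g (at (indep (snd c p))) v) = 0"
    using coordinate_line(2)[OF ch] by metis
  then show ?thesis by (simp add: join_eq_0)
qed

text \<open>
  By transversality and the inverse function theorem, the independent coordinates of \<open>d\<close> are
  coordinates on \<open>L\<close> near \<open>p\<close>.
\<close>

lemma graph_in_chart:
  assumes c: "c \<in> A" and g: "graph_at E c p L g" and d: "d \<in> charts_at A p" and t: "transversal d p L"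
  obtains f where "graph_at E d p L f"
proof -
  have dA: "d \<in> A" and pd: "p \<in> fst d" using d by (simp_all add: charts_at_def)
  obtain W S where W: "graph_on c L g W S" "p \<in> W" "W \<subseteq> fst d"
    using graph_at_normal[OF c g chart_open[OF dA] pd] by blast
  note G = graph_onD[OF W(1)]
  let ?T = "snd c ` (fst c \<inter> fst d)" and ?\<phi> = "transition c d"
  let ?H = "\<lambda>z. ?\<phi> (join z (g z))"
  note T = overlap_open[OF c dA] transition_smooth[OF c dA]
  have jT: "join z (g z) \<in> ?T" if "z \<in> S" for z
    using G(6)[OF that] G(2) W(3) by blast
  define y where "y = indep (snd c p)"
  have yS: "y \<in> S" unfolding y_def by (rule G(5)[OF W(2)])
  have "smooth_on S ?H"
    by (rule smooth_on_compose[OF G(3) T(1) smooth_on_join[OF G(3) smooth_on_id[OF G(3)] G(4)] T(2)])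
      (use jT in blast)
  then have sH: "smooth_on S (\<lambda>z. indep (?H z))" "smooth_on S (\<lambda>z. dep (?H z))"
    by (rule smooth_on_linear_comp[OF bounded_linear_indep G(3)],
        rule smooth_on_linear_comp[OF bounded_linear_dep G(3)])
  have dH: "frechet_derivative (\<lambda>z. indep (?H z)) (at y) v = indep (graph_d1 ?\<phi> g y v)" for v
    by (simp add: frechetI[OF bounded_linear.has_derivative[OF bounded_linear_indep
          graph_map_derivatives(1)[OF G(3,4) yS T jT[OF yS]]]])
  obtain U V k where k: "open U" "U \<subseteq> S" "y \<in> U" "open V" "indep (?H y) \<in> V"
      "homeomorphism U V (\<lambda>z. indep (?H z)) k" "smooth_on V k"
  proof (rule smooth_inverse_function[OF G(3) sH(1) yS])
    fix v assume "frechet_derivative (\<lambda>z. indep (?H z)) (at y) v = 0"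
    then have "indep (graph_d1 ?\<phi> g y v) = 0" unfolding dH .
    then show "v = 0" unfolding y_def by (rule transversal_inj[OF c g d t])
  qed blast
  have kV: "k x \<in> U" "indep (?H (k x)) = x" if "x \<in> V" for x
    using k(6) that by (auto simp: homeomorphism_def)
  have kU: "k (indep (?H z)) = z" if "z \<in> U" for z
    using k(6) that by (auto simp: homeomorphism_def)
  define f where "f x = dep (?H (k x))" for x
  have "smooth_on V (\<lambda>x. dep (?H (k x)))"
    by (rule smooth_on_compose[OF k(4) G(3) k(7) sH(2)]) (use kV k(2) in blast)
  then have sf: "smooth_on V f" unfolding f_def[abs_def] .
  \<comment> \<open>Here \<open>k\<close> is a two-sided inverse of the change of independent coordinates along \<open>L\<close>.\<close>
  define W' where "W' = W \<inter> ({q \<in> fst c. snd c q \<in> indep -` U} \<inter> {q \<in> fst d. snd d q \<in> indep -` V})"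
  have oW': "openin E W'" unfolding W'_def
    by (intro openin_Int G(1) chart_preimage_open c dA open_vimage[OF k(1) linear_continuous_on[OF bounded_linear_indep]]
        open_vimage[OF k(4) linear_continuous_on[OF bounded_linear_indep]])
  have W'D: "q \<in> W" "q \<in> fst c" "q \<in> fst d" "indep (snd c q) \<in> U" "indep (snd d q) \<in> V" if "q \<in> W'" for q
    using that by (auto simp: W'_def)
  have Hq: "?H (indep (snd c q)) = snd d q" if "q \<in> W" "q \<in> L" for q
  proof -
    have "join (indep (snd c q)) (g (indep (snd c q))) = snd c q"
      using graph_on_coords(1)[OF W(1) that] by (rule sym)
    moreover have "chart_inv c (snd c q) = q" using chart_inv_left[OF c] G(2) that(1) by blast
    ultimately show ?thesis by simp
  qed
  have pW': "p \<in> W'"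
  proof -
    have "?H y = snd d p" unfolding y_def by (rule Hq[OF W(2) graph_at_mem[OF g]])
    then have "indep (snd d p) \<in> V" using k(5) by simp
    then show ?thesis
      unfolding W'_def using W(2) k(3) pd G(2) by (auto simp: y_def)
  qed
  have "q \<in> L \<longleftrightarrow> dep (snd d q) = f (indep (snd d q))" if q: "q \<in> W'" for q
  proof
    assume "q \<in> L"
    have H: "?H (indep (snd c q)) = snd d q" by (rule Hq[OF W'D(1)[OF q] \<open>q \<in> L\<close>])
    then have "k (indep (snd d q)) = indep (snd c q)" using kU[OF W'D(4)[OF q]] by simp
    then show "dep (snd d q) = f (indep (snd d q))" unfolding f_def using H by simp
  next
    assume eq: "dep (snd d q) = f (indep (snd d q))"
    define z where "z = k (indep (snd d q))"
    have z: "z \<in> S" "indep (?H z) = indep (snd d q)"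
      using kV[OF W'D(5)[OF q]] k(2) by (auto simp: z_def)
    have "?H z = snd d q"
      by (rule indep_dep_eqI) (use z eq in \<open>simp_all add: f_def z_def\<close>)
    moreover have r: "chart_inv c (join z (g z)) \<in> W" "chart_inv c (join z (g z)) \<in> L"
      using graph_on_point[OF c W(1) z(1)] by blast+
    ultimately have "chart_inv c (join z (g z)) = q"
      using inj_onD[OF chart_inj[OF dA]] W(3) W'D(3)[OF q] by blast
    then show "q \<in> L" using r(2) by simp
  qed
  then have "L \<inter> W' = {q \<in> W'. dep (snd d q) = f (indep (snd d q))}" by blast
  moreover have "smooth_on (indep ` snd d ` W') f"
    by (rule smooth_on_subset[OF sf]) (use W'D(5) in blast)
  ultimately have "graph_at E d p L f"
    unfolding graph_at_def using graph_at_mem[OF g] oW' pW' W'D(3) by blast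
  then show ?thesis by (rule that)
qed

text \<open>
  Since \<open>L\<close> is also a graph in \<open>d\<close>, the independent part \<open>h\<close> of the derivative of the graph map is
  injective, hence surjective. So the relations between the derivatives of \<open>g\<close> and \<open>f\<close> determine
  the latter, and the same relations hold for \<open>g'\<close> and \<open>f'\<close>.
\<close>

lemma same_jet_change:
  assumes c: "c \<in> A" and d: "d \<in> A" and r: "r = 1 \<or> r = 2"
    and g: "graph_at E c p L g" "graph_at E c p L' g'" and f: "graph_at E d p L f" "graph_at E d p L' f'"
    and same: "same_jet r g g' (indep (snd c p))"
  shows "same_jet r f f' (indep (snd d p))"
proof -
  let ?\<phi> = "transition c d"
  define y where "y = indep (snd c p)"
  define x where "x = indep (snd d p)"
  have chd: "d \<in> charts_at A p" by (rule graph_at_chart[OF d f(1)])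
  define h where "h v = indep (graph_d1 ?\<phi> g y v)" for v
  note eq1 = same_jet_graph_d(1)[OF same, folded y_def, of ?\<phi>, symmetric]
  note ch1 = graph_change(1)[OF c d g(1) f(1), folded y_def x_def]
    graph_change(1)[OF c d g(2) f(2), folded y_def x_def, unfolded eq1]
  have "linear h"
  proof -
    obtain S where "open S" "smooth_on S g" "y \<in> S" unfolding y_def by (rule graph_at_smooth[OF c g(1)])
    moreover have "join y (g y) \<in> snd c ` (fst c \<inter> fst d)"
      unfolding y_def graph_at_base(2)[OF c g(1), symmetric]
      using chd graph_at_chart[OF c g(1)] by (auto simp: charts_at_def)
    ultimately have "((\<lambda>y. ?\<phi> (join y (g y))) has_derivative graph_d1 ?\<phi> g y) (at y)"
      by (rule graph_map_derivatives(1)[OF _ _ _ overlap_open[OF c d] transition_smooth[OF c d]])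
    from has_derivative_linear[OF bounded_linear.has_derivative[OF bounded_linear_indep this]]
    show ?thesis unfolding h_def[abs_def] .
  qed
  moreover have "h v = 0 \<Longrightarrow> v = 0" for v
    unfolding h_def y_def by (rule transversal_inj[OF c g(1) chd graph_transversal[OF d f(1)]])
  then have "inj h" using linear_injective_0[OF \<open>linear h\<close>] by blast
  ultimately have surj: "surj h" by (rule linear_injective_imp_surjective) (rule refl)
  have val: "f x = f' x"
    unfolding x_def graph_at_base(1)[OF d f(1), symmetric] graph_at_base(1)[OF d f(2), symmetric] ..
  have d1: "frechet_derivative f (at x) v = frechet_derivative f' (at x) v" for v
  proof -
    obtain u where "v = h u" using surj by blast
    then show ?thesis unfolding h_def using ch1[of u] by simp
  qed
  have d2: "second_derivative f x v w = second_derivative f' x v w" if "2 \<le> r" for v w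
  proof -
    obtain u where u: "v = h u" using surj by blast
    obtain u' where u': "w = h u'" using surj by blast
    note eq2 = same_jet_graph_d(2)[OF same that, folded y_def, of ?\<phi>, symmetric]
    show ?thesis
      using graph_change(2)[OF c d g(1) f(1), folded y_def x_def, of u u']
        graph_change(2)[OF c d g(2) f(2), folded y_def x_def, unfolded eq1 eq2, of u u'] d1
      unfolding u u' h_def by simp
  qed
  show ?thesis using val d1 d2 unfolding same_jet_def x_def by blast
qed

lemma contact_iff:
  assumes c: "c \<in> A" and g: "graph_at E c p L f" "graph_at E c p L' f'" and r: "r = 1 \<or> r = 2"
  shows "(\<forall>s. length s \<le> r \<longrightarrow> iter_partial s (\<lambda>x. f x - f' x) (indep (snd c p)) = 0)
    \<longleftrightarrow> same_jet r f f' (indep (snd c p))"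
proof -
  obtain S where S: "open S" "smooth_on S f" "indep (snd c p) \<in> S" by (rule graph_at_smooth[OF c g(1)])
  obtain S' where S': "open S'" "smooth_on S' f'" "indep (snd c p) \<in> S'" by (rule graph_at_smooth[OF c g(2)])
  show ?thesis
    by (rule iter_partial_diff_eq_0_iff[of "S \<inter> S'"])
      (use S S' r smooth_on_subset[OF S(2)] smooth_on_subset[OF S'(2)] in auto)
qed

text \<open>
  Contact is witnessed by some chart, which varies with the pair of submanifolds. This lemma moves
  it to any chart adapted to \<open>L\<close>, whence contact is an equivalence relation: contact makes the
  tangent spaces equal, so that \<open>L'\<close> is transversal to the fibres of \<open>d\<close> as well.
\<close>

lemma contact_in_chart:
  assumes r: "r = 1 \<or> r = 2" and con: "contact E A r p L L'" and d: "d \<in> A" and f: "graph_at E d p L f"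
  obtains f' where "graph_at E d p L' f'" "same_jet r f f' (indep (snd d p))"
proof -
  obtain c g g' where c: "c \<in> A" and g: "graph_at E c p L g" "graph_at E c p L' g'"
      and "\<forall>s. length s \<le> r \<longrightarrow> iter_partial s (\<lambda>x. g x - g' x) (indep (snd c p)) = 0"
    using con unfolding contact_def charts_at_def by blast
  then have same: "same_jet r g g' (indep (snd c p))" using contact_iff[OF c g r] by blast
  have "tangent_to A L p = tangent_to A L' p"
    unfolding tangent_to_graph[OF c g(1)] tangent_to_graph[OF c g(2)]
    using same by (simp add: same_jet_def)
  then have "transversal d p L'"
    using graph_transversal[OF d f] unfolding transversal_def by simp
  then obtain f' where f': "graph_at E d p L' f'"
    by (rule graph_in_chart[OF c g(2) graph_at_chart[OF d f]])
  show ?thesis by (rule that[OF f' same_jet_change[OF c d r g f f' same]])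
qed

lemma contactI:
  assumes r: "r = 1 \<or> r = 2" and c: "c \<in> A" and f: "graph_at E c p L f" and f': "graph_at E c p L' f'"
    and same: "same_jet r f f' (indep (snd c p))"
  shows "contact E A r p L L'"
  unfolding contact_def using contact_iff[OF c f f' r] same f f' graph_at_chart[OF c f] by blast

lemma submanifold_graph:
  assumes "submanifold E A L" "p \<in> L"
  obtains c f where "c \<in> A" "graph_at E c p L f"
  using assms unfolding submanifold_def charts_at_def by blast

lemma contact_refl: "r = 1 \<or> r = 2 \<Longrightarrow> submanifold E A L \<Longrightarrow> p \<in> L \<Longrightarrow> contact E A r p L L"
  by (metis submanifold_graph contactI graph_at_unique)

lemma contact_sym:
  assumes r: "r = 1 \<or> r = 2" and L: "submanifold E A L" "p \<in> L" and con: "contact E A r p L L'"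
  shows "contact E A r p L' L"
proof -
  obtain c f where c: "c \<in> A" "graph_at E c p L f" by (rule submanifold_graph[OF L])
  obtain f' where "graph_at E c p L' f'" "same_jet r f f' (indep (snd c p))"
    by (rule contact_in_chart[OF r con c])
  then show ?thesis using contactI[OF r c(1) _ c(2)] same_jet_sym by blast
qed

lemma contact_trans:
  assumes r: "r = 1 \<or> r = 2" and L: "submanifold E A L" "p \<in> L"
    and con: "contact E A r p L L'" "contact E A r p L' L''"
  shows "contact E A r p L L''"
proof -
  obtain c f where c: "c \<in> A" "graph_at E c p L f" by (rule submanifold_graph[OF L])
  obtain f' where f': "graph_at E c p L' f'" "same_jet r f f' (indep (snd c p))"
    by (rule contact_in_chart[OF r con(1) c])
  obtain f'' where f'': "graph_at E c p L'' f''" "same_jet r f' f'' (indep (snd c p))"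
    by (rule contact_in_chart[OF r con(2) c(1) f'(1)])
  show ?thesis by (rule contactI[OF r c f''(1) same_jet_trans[OF f'(2) f''(2)]])
qed

lemma contact_2_imp_1:
  assumes "contact E A 2 p L L'" shows "contact E A 1 p L L'"
  using assms unfolding contact_def by (meson one_le_numeral order_trans)

end


section \<open>Jets of submanifolds\<close>

lemma the_elem_image_const: "x \<in> X \<Longrightarrow> (\<And>x. x \<in> X \<Longrightarrow> f x = a) \<Longrightarrow> the_elem (f ` X) = a"
  by (metis (no_types, lifting) image_cong image_constant the_elem_eq)

lemma fst_jet [simp]: "fst (jet E A r p L) = p"
  by (simp add: jet_def)

lemma mem_jet_iff: "L' \<in> snd (jet E A r p L) \<longleftrightarrow> submanifold E A L' \<and> p \<in> L' \<and> contact E A r p L L'"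
  by (simp add: jet_def)

context graph_manifold
begin

abbreviation J where "J \<equiv> jet1_atlas E A"

lemma jet_self: "r = 1 \<or> r = 2 \<Longrightarrow> submanifold E A L \<Longrightarrow> p \<in> L \<Longrightarrow> L \<in> snd (jet E A r p L)"
  using contact_refl by (simp add: mem_jet_iff)

lemma jet_eqI:
  assumes r: "r = 1 \<or> r = 2" and L: "submanifold E A L" "p \<in> L" and L': "submanifold E A L'" "p \<in> L'"
    and con: "contact E A r p L L'"
  shows "jet E A r p L = jet E A r p L'"
proof -
  have "contact E A r p L M \<longleftrightarrow> contact E A r p L' M" for M
    using contact_trans[OF r L con, of M] contact_trans[OF r L' contact_sym[OF r L con], of M] by blast
  then show ?thesis by (simp add: jet_def)
qed

lemma jet_eqD:
  assumes r: "r = 1 \<or> r = 2" and L': "submanifold E A L'" "p \<in> L'" and eq: "jet E A r p L = jet E A r p L'"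
  shows "contact E A r p L L'"
  using jet_self[OF r L'] unfolding eq[symmetric] mem_jet_iff by blast

lemma jet_proj_jet:
  assumes L: "submanifold E A L" "p \<in> L"
  shows "jet_proj E A 1 (jet E A 2 p L) = jet E A 1 p L"
  unfolding jet_proj_def fst_jet
proof (rule the_elem_image_const[OF jet_self[OF _ L]])
  fix L' assume "L' \<in> snd (jet E A 2 p L)"
  then have L': "submanifold E A L'" "p \<in> L'" "contact E A 1 p L L'"
    using contact_2_imp_1 by (auto simp: mem_jet_iff)
  show "jet E A 1 p L' = jet E A 1 p L"
    by (rule jet_eqI[OF _ L L', symmetric]) simp
qed simp

lemma contact_tangent_to:
  assumes L: "submanifold E A L" "p \<in> L" and con: "contact E A 1 p L L'"
  shows "tangent_to A L' p = tangent_to A L p"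
proof -
  obtain c f where c: "c \<in> A" "graph_at E c p L f" by (rule submanifold_graph[OF L])
  obtain f' where f': "graph_at E c p L' f'" "same_jet 1 f f' (indep (snd c p))"
    by (rule contact_in_chart[OF _ con c]) simp
  show ?thesis
    unfolding tangent_to_graph[OF c] tangent_to_graph[OF c(1) f'(1)] using f'(2) by (simp add: same_jet_def)
qed

lemma R_plane1_jet:
  assumes L: "submanifold E A L" "p \<in> L"
  shows "R_plane1 A (jet E A 1 p L) = tangent_to A L p"
  unfolding R_plane1_def fst_jet
  by (rule the_elem_image_const[OF jet_self[OF _ L]]) (simp_all add: mem_jet_iff contact_tangent_to[OF L])

lemma jet_coord_jet:
  assumes L: "submanifold E A L" "p \<in> L" and c: "c \<in> A" and f: "graph_at E c p L f"
  shows "jet_coord E c i [l] (jet E A 1 p L) = frechet_derivative f (at (indep (snd c p))) (axis l 1) $ i"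
proof -
  have "frechet_derivative f'' (at (indep (snd c p))) v = frechet_derivative f (at (indep (snd c p))) v"
    if "L' \<in> snd (jet E A 1 p L)" "graph_at E c p L' f''" for L' f'' v
  proof -
    have con: "contact E A 1 p L L'" using that(1) by (simp add: mem_jet_iff)
    obtain f' where f': "graph_at E c p L' f'" "same_jet 1 f f' (indep (snd c p))"
      by (rule contact_in_chart[OF _ con c f]) simp
    show ?thesis
      using same_jet_trans[OF f'(2) graph_at_unique[OF c f'(1) that(2)]] by (simp add: same_jet_def)
  qed
  then have eq: "iter_partial [l] f' (indep (snd c p)) $ i = frechet_derivative f (at (indep (snd c p))) (axis l 1) $ i"
    if "L' \<in> snd (jet E A 1 p L)" "graph_at E c p L' f'" for L' f'
    unfolding iter_partial.simps using that by metis
  let ?X = "{iter_partial [l] f' (indep (snd c p)) $ i | L' f'. L' \<in> snd (jet E A 1 p L) \<and> graph_at E c p L' f'}"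
  have mem: "L \<in> snd (jet E A 1 p L)" by (rule jet_self[OF _ L]) simp
  have "?X = {iter_partial [l] f (indep (snd c p)) $ i}"
  proof (intro subset_antisym subsetI)
    fix z assume "z \<in> ?X"
    then obtain L' f' where "z = iter_partial [l] f' (indep (snd c p)) $ i"
      "L' \<in> snd (jet E A 1 p L)" "graph_at E c p L' f'" by blast
    then show "z \<in> {iter_partial [l] f (indep (snd c p)) $ i}"
      using eq[of L' f'] eq[OF mem f] by (simp only: singleton_iff)
  qed (use mem f in blast)
  then have "?X = {frechet_derivative f (at (indep (snd c p))) (axis l 1) $ i}"
    unfolding eq[OF mem f] .
  then show ?thesis unfolding jet_coord_def fst_jet by (simp only: the_elem_eq)
qed

lemma mem_jet1_chart_iff:
  assumes L: "submanifold E A L" "p \<in> L" and c: "c \<in> A"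
  shows "jet E A 1 p L \<in> fst (jet1_chart E A c) \<longleftrightarrow> (\<exists>f. graph_at E c p L f)"
proof
  assume "jet E A 1 p L \<in> fst (jet1_chart E A c)"
  then obtain L' f where L': "L' \<in> snd (jet E A 1 p L)" "graph_at E c p L' f"
    by (auto simp: jet1_chart_def)
  then have "contact E A 1 p L' L" using contact_sym[OF _ L, of 1] by (simp add: mem_jet_iff)
  then show "\<exists>f. graph_at E c p L f"
    using contact_in_chart[OF _ _ c L'(2), of 1 L] by auto
next
  assume "\<exists>f. graph_at E c p L f"
  moreover from this have "p \<in> fst c" using graph_at_chart[OF c] by (auto simp: charts_at_def)
  moreover have "jet E A 1 p L \<in> jets E A 1" using L by (auto simp: jets_def)
  ultimately show "jet E A 1 p L \<in> fst (jet1_chart E A c)"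
    using jet_self[OF _ L, of 1] by (auto simp: jet1_chart_def)
qed

lemma jet1_chart_jet:
  assumes L: "submanifold E A L" "p \<in> L" and c: "c \<in> A" and f: "graph_at E c p L f"
  shows "snd (jet1_chart E A c) (jet E A 1 p L) =
    (snd c p, \<chi> i l. frechet_derivative f (at (indep (snd c p))) (axis l 1) $ i)"
  unfolding jet1_chart_def by (simp only: fst_jet snd_conv jet_coord_jet[OF assms])

lemma charts_at_J: "jc \<in> charts_at J \<theta> \<longleftrightarrow> (\<exists>c\<in>A. jc = jet1_chart E A c \<and> \<theta> \<in> fst (jet1_chart E A c))"
  unfolding charts_at_def jet1_atlas_def by blast

subsection \<open>Tangent vectors of prolongations\<close>

definition prolonged_vector :: "(real^'n \<Rightarrow> real^'m) \<Rightarrow> real^'n \<Rightarrow> real^('n + 'm) \<Rightarrow> (real^('n + 'm)) \<times> (real^'n^'m)" where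
  "prolonged_vector f x w = (w, \<chi> i l. second_derivative f x (axis l 1) (indep w) $ i)"

text \<open>
  Along a curve in \<open>L\<close> the graphing function \<open>f\<close> remains the same, so that the jet coordinates are the
  first derivatives of \<open>f\<close> at the moving point.
\<close>

lemma prolonged_curve:
  assumes L: "submanifold E A L" and c: "c \<in> A" and f: "graph_at E c p L f"
    and \<gamma>0: "smooth_curve_at A p \<gamma>0" and e: "e > 0" "\<gamma>0 ` {-e<..<e} \<subseteq> L"
    and \<gamma>: "\<And>t. t \<in> {-e<..<e} \<Longrightarrow> \<gamma> t = jet E A 1 (\<gamma>0 t) L"
  shows "\<exists>e'>0. (\<forall>t\<in>{-e'<..<e'}. \<gamma> t \<in> fst (jet1_chart E A c)) \<and>
      smooth_on {-e'<..<e'} (\<lambda>t. snd (jet1_chart E A c) (\<gamma> t))"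
    and "((\<lambda>t. snd (jet1_chart E A c) (\<gamma> t)) has_vector_derivative
      prolonged_vector f (indep (snd c p)) (velocity A p \<gamma>0 c)) (at 0)"
proof -
  have ch: "c \<in> charts_at A p" by (rule graph_at_chart[OF c f])
  obtain W S where W: "graph_on c L f W S" "p \<in> W"
    using graph_at_normal[OF c f openin_topspace graph_at_topspace[OF f]] by blast
  note G = graph_onD[OF W(1)]
  obtain e1 where e1: "e1 > 0" "\<And>t. t \<in> {-e1<..<e1} \<Longrightarrow> \<gamma>0 t \<in> W \<inter> fst c"
      "smooth_on {-e1<..<e1} (\<lambda>t. snd c (\<gamma>0 t))"
    using smooth_curve_near[OF \<gamma>0 ch G(1) W(2)] by blast
  let ?e = "min e e1"
  let ?I = "{-?e<..<?e}"
  let ?df = "\<lambda>l x. frechet_derivative f (at x) (axis l 1)"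
  let ?F = "\<lambda>t. (snd c (\<gamma>0 t), \<chi> i l. ?df l (indep (snd c (\<gamma>0 t))) $ i)"
  have q: "\<gamma>0 t \<in> W" "\<gamma>0 t \<in> L" "t \<in> {-e<..<e}" if "t \<in> ?I" for t
    using e1(2)[of t] e(2) that by auto
  have gr: "graph_at E c (\<gamma>0 t) L f" if "t \<in> ?I" for t
    by (rule graph_on_graph_at[OF W(1) q(1,2)[OF that]])
  have dom: "\<gamma> t \<in> fst (jet1_chart E A c)" if "t \<in> ?I" for t
    unfolding \<gamma>[OF q(3)[OF that]] using mem_jet1_chart_iff[OF L q(2)[OF that] c] gr[OF that] by blast
  have F: "?F t = snd (jet1_chart E A c) (\<gamma> t)" if "t \<in> ?I" for t
    unfolding \<gamma>[OF q(3)[OF that]] using jet1_chart_jet[OF L q(2)[OF that] c gr[OF that]] by (rule sym)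
  have oI: "open ?I" by simp
  have s1: "smooth_on ?I (\<lambda>t. snd c (\<gamma>0 t))" by (rule smooth_on_subset[OF e1(3)]) auto
  have s2: "smooth_on ?I (\<lambda>t. indep (snd c (\<gamma>0 t)))"
    by (rule smooth_on_linear_comp[OF bounded_linear_indep oI s1])
  have s3: "smooth_on ?I (\<lambda>t. ?df l (indep (snd c (\<gamma>0 t))))" for l
    by (rule smooth_on_compose[OF oI G(3) s2 smooth_on_derivative[OF G(4)]]) (use G(5) q(1) in blast)
  have s4: "smooth_on ?I (\<lambda>t. \<chi> i l. ?df l (indep (snd c (\<gamma>0 t))) $ i)"
    by (rule smooth_on_vec[OF oI], rule smooth_on_vec[OF oI]) (simp add: smooth_on_vec_nth[OF oI s3])
  have sF: "smooth_on ?I ?F" by (rule smooth_on_Pair[OF oI s1 s4])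
  then have "smooth_on ?I (\<lambda>t. snd (jet1_chart E A c) (\<gamma> t))"
    by (rule smooth_on_cong[OF oI F, rotated])
  moreover have "?e > 0" using e(1) e1(1) by simp
  ultimately show "\<exists>e'>0. (\<forall>t\<in>{-e'<..<e'}. \<gamma> t \<in> fst (jet1_chart E A c)) \<and>
      smooth_on {-e'<..<e'} (\<lambda>t. snd (jet1_chart E A c) (\<gamma> t))"
    using dom by blast
  have 0: "0 \<in> ?I" using e(1) e1(1) by simp
  let ?x = "indep (snd c p)" and ?w = "velocity A p \<gamma>0 c"
  obtain F' where F': "(?F has_vector_derivative F') (at 0)"
    using smooth_on_differentiable[OF sF 0] vector_derivative_works by blast
  have d1: "((\<lambda>t. snd c (\<gamma>0 t)) has_vector_derivative ?w) (at 0)"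
    by (rule smooth_curve_velocity[OF \<gamma>0 ch])
  have "((\<lambda>t. snd c (\<gamma>0 t)) has_vector_derivative fst F') (at 0)"
    using bounded_linear.has_vector_derivative[OF bounded_linear_fst F'] by simp
  then have fst: "fst F' = ?w" using d1 vector_derivative_unique_at by blast
  have snd: "snd F' $ i $ l = second_derivative f ?x (axis l 1) (indep ?w) $ i" for i l
  proof -
    have x: "?x \<in> S" by (rule G(5)[OF W(2)])
    have "((\<lambda>t. ?df l (indep (snd c (\<gamma>0 t)))) has_vector_derivative
        second_derivative f ?x (axis l 1) (indep ?w)) (at 0)"
      by (rule has_vector_derivative_compose[OF bounded_linear.has_vector_derivative[OF bounded_linear_indep d1]])
        (use has_derivative_frechet[OF smooth_on_differentiable[OF smooth_on_derivative[OF G(4)] x]]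
          smooth_curve_start[OF \<gamma>0] in simp)
    then have "((\<lambda>t. ?df l (indep (snd c (\<gamma>0 t))) $ i) has_vector_derivative
        second_derivative f ?x (axis l 1) (indep ?w) $ i) (at 0)"
      by (rule bounded_linear.has_vector_derivative[OF bounded_linear_vec_nth])
    moreover have "((\<lambda>t. ?df l (indep (snd c (\<gamma>0 t))) $ i) has_vector_derivative snd F' $ i $ l) (at 0)"
      using bounded_linear.has_vector_derivative[OF bounded_linear_vec_nth
          bounded_linear.has_vector_derivative[OF bounded_linear_vec_nth
            bounded_linear.has_vector_derivative[OF bounded_linear_snd F']], of i l] by simp
    ultimately show ?thesis using vector_derivative_unique_at by blast
  qed
  have "F' = prolonged_vector f ?x ?w"
    unfolding prolonged_vector_def using fst snd by (simp add: prod_eq_iff vec_eq_iff)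
  then show "((\<lambda>t. snd (jet1_chart E A c) (\<gamma> t)) has_vector_derivative
      prolonged_vector f ?x ?w) (at 0)"
    using has_vector_derivative_transform_within_open[OF F' oI 0 F] by simp
qed

lemma projected_curve:
  assumes \<gamma>: "smooth_curve_at J \<theta> \<gamma>" and c: "c \<in> A" "\<theta> \<in> fst (jet1_chart E A c)"
  shows "smooth_curve_at A (fst \<theta>) (fst \<circ> \<gamma>)"
    and "velocity A (fst \<theta>) (fst \<circ> \<gamma>) c = fst (velocity J \<theta> \<gamma> (jet1_chart E A c))"
proof -
  let ?jc = "jet1_chart E A c"
  have jc: "?jc \<in> charts_at J \<theta>" using c charts_at_J by blast
  have ch: "c \<in> charts_at A (fst \<theta>)" using c by (auto simp: jet1_chart_def charts_at_def)
  have \<gamma>0: "\<gamma> 0 = \<theta>" using \<gamma> by (simp add: smooth_curve_at_def)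
  obtain e where e: "e > 0" "\<gamma> ` {-e<..<e} \<subseteq> fst ?jc" "smooth_on {-e<..<e} (snd ?jc \<circ> \<gamma>)"
    using \<gamma> jc unfolding smooth_curve_at_def by blast
  have fst_jc: "fst (snd ?jc \<theta>') = snd c (fst \<theta>')" for \<theta>' by (simp add: jet1_chart_def)
  have "smooth_on {-e<..<e} (\<lambda>t. fst ((snd ?jc \<circ> \<gamma>) t))"
    by (rule smooth_on_linear_comp[OF bounded_linear_fst _ e(3)]) simp
  then have sm: "smooth_on {-e<..<e} (\<lambda>t. snd c ((fst \<circ> \<gamma>) t))" by (simp add: fst_jc)
  have dom: "(fst \<circ> \<gamma>) t \<in> fst c" if "t \<in> {-e<..<e}" for t
  proof -
    have "\<gamma> t \<in> fst ?jc" using e(2) that by blast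
    then show ?thesis by (simp add: jet1_chart_def)
  qed
  show "smooth_curve_at A (fst \<theta>) (fst \<circ> \<gamma>)"
    by (rule smooth_curve_atI[OF ch _ _ _ dom sm]) (use \<gamma>0 e(1) in auto)
  have "(snd ?jc \<circ> \<gamma>) differentiable at 0"
    by (rule smooth_on_differentiable[OF e(3)]) (use e(1) in simp)
  then have "((snd ?jc \<circ> \<gamma>) has_vector_derivative velocity J \<theta> \<gamma> ?jc) (at 0)"
    using jc by (simp add: velocity_def vector_derivative_works[symmetric])
  from bounded_linear.has_vector_derivative[OF bounded_linear_fst this]
  have "((\<lambda>t. snd c ((fst \<circ> \<gamma>) t)) has_vector_derivative fst (velocity J \<theta> \<gamma> ?jc)) (at 0)"
    by (simp add: fst_jc)
  then show "velocity A (fst \<theta>) (fst \<circ> \<gamma>) c = fst (velocity J \<theta> \<gamma> ?jc)"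
    by (rule velocityI[OF ch])
qed

text \<open>
  The tangent space of the prolongation of \<open>L\<close>: above a tangent vector \<open>w\<close> of \<open>L\<close>, the fibre components
  are the second derivatives of the graphing functions in the direction of \<open>w\<close>. The first clause
  accounts for the value \<open>0\<close> of tangent vectors at charts away from the base point.
\<close>

definition prolonged_vectors :: "'e set \<Rightarrow> 'e \<Rightarrow> ('e jet, (real^('n + 'm)) \<times> (real^'n^'m)) tvec set" where
  "prolonged_vectors L p = {v. (\<forall>jc. jc \<notin> charts_at J (jet E A 1 p L) \<longrightarrow> v jc = 0) \<and>
    (\<exists>w\<in>tangent_to A L p. \<forall>c\<in>A. \<forall>f. graph_at E c p L f \<longrightarrow>
      v (jet1_chart E A c) = prolonged_vector f (indep (snd c p)) (w c))}"

lemma tangent_to_prolongation: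
  assumes L: "submanifold E A L" "p \<in> L"
  shows "tangent_to J (prolongation E A 1 L) (jet E A 1 p L) = prolonged_vectors L p"
proof
  let ?\<theta> = "jet E A 1 p L"
  obtain c0 f0 where c0: "c0 \<in> A" "graph_at E c0 p L f0" by (rule submanifold_graph[OF L])
  have dom0: "?\<theta> \<in> fst (jet1_chart E A c0)" using mem_jet1_chart_iff[OF L c0(1)] c0(2) by blast
  show "tangent_to J (prolongation E A 1 L) ?\<theta> \<subseteq> prolonged_vectors L p"
  proof
    fix v assume "v \<in> tangent_to J (prolongation E A 1 L) ?\<theta>"
    then obtain \<gamma> e where \<gamma>: "v = velocity J ?\<theta> \<gamma>" "smooth_curve_at J ?\<theta> \<gamma>" "e > 0"
      "\<gamma> ` {-e<..<e} \<subseteq> prolongation E A 1 L" unfolding tangent_to_def by blast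
    let ?\<gamma>0 = "fst \<circ> \<gamma>"
    have curve: "smooth_curve_at A p ?\<gamma>0" using projected_curve(1)[OF \<gamma>(2) c0(1) dom0] by simp
    have \<gamma>t: "?\<gamma>0 t \<in> L" "\<gamma> t = jet E A 1 (?\<gamma>0 t) L" if "t \<in> {-e<..<e}" for t
    proof -
      have "\<gamma> t \<in> prolongation E A 1 L" using \<gamma>(4) that by blast
      then obtain q where "q \<in> L" "\<gamma> t = jet E A 1 q L" unfolding prolongation_def by blast
      then show "?\<gamma>0 t \<in> L" "\<gamma> t = jet E A 1 (?\<gamma>0 t) L" by simp_all
    qed
    have inL: "?\<gamma>0 ` {-e<..<e} \<subseteq> L" using \<gamma>t(1) by blast
    have w: "velocity A p ?\<gamma>0 \<in> tangent_to A L p"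
      unfolding tangent_to_def using curve inL \<gamma>(3) by blast
    have "v (jet1_chart E A c) = prolonged_vector f (indep (snd c p)) (velocity A p ?\<gamma>0 c)"
      if c: "c \<in> A" and f: "graph_at E c p L f" for c f
    proof -
      have "jet1_chart E A c \<in> charts_at J ?\<theta>"
        unfolding charts_at_J using mem_jet1_chart_iff[OF L c] c f by blast
      then show ?thesis
        unfolding \<gamma>(1) velocity_def o_def
        using vector_derivative_at[OF prolonged_curve(2)[OF L(1) c f curve \<gamma>(3) inL \<gamma>t(2)]]
        by (simp add: velocity_def o_def)
    qed
    moreover have "v jc = 0" if "jc \<notin> charts_at J ?\<theta>" for jc
      unfolding \<gamma>(1) velocity_def using that by simp
    ultimately show "v \<in> prolonged_vectors L p"
      unfolding prolonged_vectors_def using w by blast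
  qed
  show "prolonged_vectors L p \<subseteq> tangent_to J (prolongation E A 1 L) ?\<theta>"
  proof
    fix v assume "v \<in> prolonged_vectors L p"
    then obtain w where w: "w \<in> tangent_to A L p" "\<And>jc. jc \<notin> charts_at J ?\<theta> \<Longrightarrow> v jc = 0"
      "\<And>c f. c \<in> A \<Longrightarrow> graph_at E c p L f \<Longrightarrow> v (jet1_chart E A c) = prolonged_vector f (indep (snd c p)) (w c)"
      unfolding prolonged_vectors_def by blast
    obtain \<gamma>0 e where \<gamma>0: "w = velocity A p \<gamma>0" "smooth_curve_at A p \<gamma>0" "e > 0" "\<gamma>0 ` {-e<..<e} \<subseteq> L"
      using w(1) unfolding tangent_to_def by blast
    let ?\<gamma> = "\<lambda>t. jet E A 1 (\<gamma>0 t) L"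
    have start: "?\<gamma> 0 = ?\<theta>" using smooth_curve_start[OF \<gamma>0(2)] by simp
    have *: "\<exists>e'>0. (\<forall>t\<in>{-e'<..<e'}. ?\<gamma> t \<in> fst jc) \<and> smooth_on {-e'<..<e'} (\<lambda>t. snd jc (?\<gamma> t))"
      "vector_derivative (\<lambda>t. snd jc (?\<gamma> t)) (at 0) = v jc" if jc: "jc \<in> charts_at J ?\<theta>" for jc
    proof -
      obtain c where c: "c \<in> A" "jc = jet1_chart E A c" "?\<theta> \<in> fst (jet1_chart E A c)"
        using jc unfolding charts_at_J by blast
      obtain f where f: "graph_at E c p L f" using mem_jet1_chart_iff[OF L c(1)] c(3) by blast
      note pc = prolonged_curve[OF L(1) c(1) f \<gamma>0(2,3,4), of ?\<gamma>, OF refl]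
      show "\<exists>e'>0. (\<forall>t\<in>{-e'<..<e'}. ?\<gamma> t \<in> fst jc) \<and> smooth_on {-e'<..<e'} (\<lambda>t. snd jc (?\<gamma> t))"
        unfolding c(2) by (rule pc(1))
      show "vector_derivative (\<lambda>t. snd jc (?\<gamma> t)) (at 0) = v jc"
        unfolding c(2) w(3)[OF c(1) f] \<gamma>0(1) by (rule vector_derivative_at[OF pc(2)])
    qed
    have "smooth_curve_at J ?\<theta> ?\<gamma>"
      unfolding smooth_curve_at_def o_def using start *(1) by blast
    moreover have "\<exists>e>0. ?\<gamma> ` {-e<..<e} \<subseteq> prolongation E A 1 L"
      using \<gamma>0(3,4) unfolding prolongation_def by blast
    moreover have "velocity J ?\<theta> ?\<gamma> = v"
    proof
      fix jc show "velocity J ?\<theta> ?\<gamma> jc = v jc"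
        unfolding velocity_def o_def using *(2)[of jc] w(2)[of jc] by (cases "jc \<in> charts_at J ?\<theta>") simp_all
    qed
    ultimately show "v \<in> tangent_to J (prolongation E A 1 L) ?\<theta>"
      unfolding tangent_to_def by blast
  qed
qed

lemma prolonged_vector_exists:
  assumes L: "submanifold E A L" "p \<in> L" and w: "w \<in> tangent_to A L p"
  obtains u where "u \<in> prolonged_vectors L p"
    "\<And>c f. c \<in> A \<Longrightarrow> graph_at E c p L f \<Longrightarrow> u (jet1_chart E A c) = prolonged_vector f (indep (snd c p)) (w c)"
proof -
  let ?\<theta> = "jet E A 1 p L"
  obtain \<gamma>0 e where \<gamma>0: "w = velocity A p \<gamma>0" "smooth_curve_at A p \<gamma>0" "e > 0" "\<gamma>0 ` {-e<..<e} \<subseteq> L"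
    using w unfolding tangent_to_def by blast
  let ?u = "velocity J ?\<theta> (\<lambda>t. jet E A 1 (\<gamma>0 t) L)"
  have uc: "?u (jet1_chart E A c) = prolonged_vector f (indep (snd c p)) (w c)"
    if c: "c \<in> A" and f: "graph_at E c p L f" for c f
  proof -
    have "jet1_chart E A c \<in> charts_at J ?\<theta>"
      unfolding charts_at_J using mem_jet1_chart_iff[OF L c] c f by blast
    then show ?thesis
      unfolding velocity_def o_def \<gamma>0(1)
      using vector_derivative_at[OF prolonged_curve(2)[OF L(1) c f \<gamma>0(2,3,4), of "\<lambda>t. jet E A 1 (\<gamma>0 t) L", OF refl]]
      by (simp add: velocity_def o_def)
  qed
  moreover have "?u jc = 0" if "jc \<notin> charts_at J ?\<theta>" for jc using that by (simp add: velocity_def)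
  ultimately have "?u \<in> prolonged_vectors L p" unfolding prolonged_vectors_def using w by blast
  then show ?thesis using that uc by blast
qed

lemma prolonged_vectors_subset:
  assumes L: "submanifold E A L" "p \<in> L" and L': "submanifold E A L'" "p \<in> L'" and con: "contact E A 2 p L L'"
  shows "prolonged_vectors L p \<subseteq> prolonged_vectors L' p"
proof
  fix v assume v: "v \<in> prolonged_vectors L p"
  have con1: "contact E A 1 p L L'" by (rule contact_2_imp_1[OF con])
  have eq: "jet E A 1 p L = jet E A 1 p L'" by (rule jet_eqI[OF _ L L' con1]) simp
  obtain w where w: "w \<in> tangent_to A L p" "\<And>jc. jc \<notin> charts_at J (jet E A 1 p L) \<Longrightarrow> v jc = 0"
    "\<And>c f. c \<in> A \<Longrightarrow> graph_at E c p L f \<Longrightarrow> v (jet1_chart E A c) = prolonged_vector f (indep (snd c p)) (w c)"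
    using v unfolding prolonged_vectors_def by blast
  have "v (jet1_chart E A c) = prolonged_vector f' (indep (snd c p)) (w c)"
    if c: "c \<in> A" and f': "graph_at E c p L' f'" for c f'
  proof -
    obtain f where f: "graph_at E c p L f" "same_jet 2 f' f (indep (snd c p))"
      by (rule contact_in_chart[OF _ contact_sym[OF _ L con] c f']) simp_all
    then show ?thesis unfolding w(3)[OF c f(1)] prolonged_vector_def by (simp add: same_jet_def)
  qed
  then show "v \<in> prolonged_vectors L' p"
    unfolding prolonged_vectors_def eq[symmetric] using w(1,2) contact_tangent_to[OF L con1] by blast
qed

lemma R_plane2_jet:
  assumes L: "submanifold E A L" "p \<in> L"
  shows "R_plane2 E A (jet E A 2 p L) = prolonged_vectors L p"
  unfolding R_plane2_def fst_jet
proof (rule the_elem_image_const[OF jet_self[OF _ L]])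
  fix L' assume "L' \<in> snd (jet E A 2 p L)"
  then have L': "submanifold E A L'" "p \<in> L'" and con: "contact E A 2 p L L'"
    by (auto simp: mem_jet_iff)
  have "contact E A 2 p L' L" by (rule contact_sym[OF _ L con]) simp
  then show "tangent_to J (prolongation E A 1 L') (jet E A 1 p L') = prolonged_vectors L p"
    unfolding tangent_to_prolongation[OF L']
    using prolonged_vectors_subset[OF L L' con] prolonged_vectors_subset[OF L' L] by blast
qed simp

text \<open>
  The velocity of the projected curve can be read off one chart, so that it is the same for all
  curves with the velocity \<open>v\<close>.
\<close>

lemma pushforward_fst:
  assumes v: "v \<in> tangent_space J \<theta>" and c0: "c0 \<in> A" "\<theta> \<in> fst (jet1_chart E A c0)"
  shows "pushforward J A fst \<theta> v \<in> tangent_space A (fst \<theta>)"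
    and "c \<in> A \<Longrightarrow> \<theta> \<in> fst (jet1_chart E A c) \<Longrightarrow> pushforward J A fst \<theta> v c = fst (v (jet1_chart E A c))"
proof -
  obtain \<gamma> where \<gamma>: "smooth_curve_at J \<theta> \<gamma>" "velocity J \<theta> \<gamma> = v"
    using v unfolding tangent_space_def by blast
  have ch: "c0 \<in> charts_at A (fst \<theta>)" using c0 by (auto simp: jet1_chart_def charts_at_def)
  have mem: "velocity A (fst \<theta>) (fst \<circ> \<gamma>') \<in> tangent_space A (fst \<theta>)" if "smooth_curve_at J \<theta> \<gamma>'" for \<gamma>'
    unfolding tangent_space_def using projected_curve(1)[OF that c0] by blast
  have "pushforward J A fst \<theta> v = velocity A (fst \<theta>) (fst \<circ> \<gamma>)"
    unfolding pushforward_def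
  proof (rule the_elem_image_const)
    show "\<gamma> \<in> {\<gamma>. smooth_curve_at J \<theta> \<gamma> \<and> velocity J \<theta> \<gamma> = v}" using \<gamma> by simp
    fix \<gamma>' assume \<gamma>': "\<gamma>' \<in> {\<gamma>. smooth_curve_at J \<theta> \<gamma> \<and> velocity J \<theta> \<gamma> = v}"
    show "velocity A (fst \<theta>) (fst \<circ> \<gamma>') = velocity A (fst \<theta>) (fst \<circ> \<gamma>)"
      by (rule tangent_eqI[OF mem mem ch])
        (use \<gamma> \<gamma>' projected_curve(2)[OF _ c0] in auto)
  qed
  then show "pushforward J A fst \<theta> v \<in> tangent_space A (fst \<theta>)"
    and "c \<in> A \<Longrightarrow> \<theta> \<in> fst (jet1_chart E A c) \<Longrightarrow> pushforward J A fst \<theta> v c = fst (v (jet1_chart E A c))"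
    using mem[OF \<gamma>(1)] projected_curve(2)[OF \<gamma>(1)] \<gamma>(2) by simp_all
qed

end


section \<open>The second fundamental form in coordinates\<close>

locale graph_connection = connection E A D + graph_manifold E A
  for E :: "'e topology" and A :: "('e, real^('n::finite + 'm::finite)) chart set"
    and D :: "('e, real^('n + 'm)) covd"
begin

abbreviation lift :: "(real^'n \<Rightarrow> real^'m) \<Rightarrow> real^'n \<Rightarrow> real^'n \<Rightarrow> real^('n + 'm)" where
  "lift f x v \<equiv> join v (frechet_derivative f (at x) v)"

text \<open>
  The projection of \<open>z\<close> along the tangent space of the graph of \<open>f\<close>: it identifies the normal space
  with \<open>real^'m\<close>.
\<close>

definition normal_part :: "(real^'n \<Rightarrow> real^'m) \<Rightarrow> real^'n \<Rightarrow> real^('n + 'm) \<Rightarrow> real^'m" where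
  "normal_part f x z = dep z - frechet_derivative f (at x) (indep z)"

text \<open>
  The left-hand side of the local equation of totally geodesic submanifolds; the tangent vector with
  independent part \<open>w\<close> is the direction of derivation.
\<close>

definition geodesic_form where
  "geodesic_form c p f v w =
    (let x = indep (snd c p) in
      second_derivative f x v w + normal_part f x (christoffel_form c p (lift f x w) (lift f x v)))"

lemma linear_normal_part:
  assumes "linear (frechet_derivative f (at x))"
  shows "linear (normal_part f x)"
  by (rule linearI) (simp_all add: normal_part_def linear_add[OF assms] linear_cmul[OF assms] algebra_simps)

lemma linear_lift:
  assumes "linear (frechet_derivative f (at x))"
  shows "linear (lift f x)"
  by (rule linearI) (simp_all add: linear_add[OF assms] linear_cmul[OF assms] join_add join_scaleR)

lemma graph_at_linear:
  assumes "c \<in> A" "graph_at E c p L f"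
  shows "linear (frechet_derivative f (at (indep (snd c p))))"
  using graph_at_smooth[OF assms] smooth_on_differentiable linear_frechet by metis

lemma tangent_to_normal:
  assumes "c \<in> A" "graph_at E c p L f"
  shows "tangent_to A L p = {v \<in> tangent_space A p. normal_part f (indep (snd c p)) (v c) = 0}"
  unfolding tangent_to_graph[OF assms] normal_part_def by simp

lemma tangent_to_lift:
  assumes "c \<in> A" "graph_at E c p L f" "v \<in> tangent_to A L p"
  shows "v c = lift f (indep (snd c p)) (indep (v c))"
  using assms(3) join_indep_dep[of "v c"] unfolding tangent_to_graph[OF assms(1,2)] by simp

lemma tcoset_tangent_to:
  assumes c: "c \<in> A" and f: "graph_at E c p L f" and u: "u \<in> tangent_space A p"
  shows "tcoset (tangent_to A L p) u =
    {v \<in> tangent_space A p. normal_part f (indep (snd c p)) (v c) = normal_part f (indep (snd c p)) (u c)}"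
    (is "_ = ?R")
proof -
  let ?l = "normal_part f (indep (snd c p))"
  note lin = linear_normal_part[OF graph_at_linear[OF c f]]
  have p: "p \<in> topspace E" by (rule graph_at_topspace[OF f])
  have tadd1: "tadd v w = tadd (tscale 1 v) (tscale 1 w)" for v w :: "('e, real^('n + 'm)) tvec"
    by (simp add: tadd_def tscale_def)
  show ?thesis
  proof (intro subset_antisym subsetI)
    fix v assume "v \<in> tcoset (tangent_to A L p) u"
    then obtain w where w: "w \<in> tangent_space A p" "?l (w c) = 0" "v = tadd u w"
      unfolding tcoset_def tangent_to_normal[OF c f] by blast
    have "v \<in> tangent_space A p" unfolding w(3) tadd1[of u] by (rule tangent_lincomb[OF p u w(1)])
    moreover have "?l (v c) = ?l (u c)"
      unfolding w(3) using w(2) by (simp add: tadd_def linear_add[OF lin])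
    ultimately show "v \<in> ?R" by blast
  next
    fix v assume v: "v \<in> ?R"
    let ?w = "tadd (tscale 1 v) (tscale (-1) u)"
    have "?w \<in> tangent_space A p" using v by (intro tangent_lincomb[OF p _ u]) blast
    moreover have "?l (?w c) = 0"
      using v by (simp add: tadd_def tscale_def linear_diff[OF lin])
    moreover have "v = tadd u ?w" by (simp add: tadd_def tscale_def fun_eq_iff)
    ultimately show "v \<in> tcoset (tangent_to A L p) u"
      unfolding tcoset_def tangent_to_normal[OF c f] by blast
  qed
qed

text \<open>
  Differentiating the tangency condition for \<open>Y\<close> along \<open>L\<close> eliminates the derivatives of \<open>Y\<close> from
  the normal part of its covariant derivative.
\<close>

lemma normal_part_covd:
  assumes c: "c \<in> A" and f: "graph_at E c p L f" and x: "x \<in> tangent_to A L p"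
    and Y: "vector_field_on E A W Y" "p \<in> W" "\<And>q. q \<in> L \<inter> W \<Longrightarrow> Y q \<in> tangent_to A L q"
  shows "normal_part f (indep (snd c p)) (D p x Y c) = geodesic_form c p f (indep (Y p c)) (indep (x c))"
proof -
  have ch: "c \<in> charts_at A p" by (rule graph_at_chart[OF c f])
  have xT: "x \<in> tangent_space A p" using x unfolding tangent_to_graph[OF c f] by blast
  have oW: "openin E W" using Y(1) by (simp add: vector_field_on_def)
  obtain V S where V: "graph_on c L f V S" "p \<in> V" "V \<subseteq> W"
    by (rule graph_at_normal[OF c f oW Y(2)])
  note G = graph_onD[OF V(1)]
  have Y': "vector_field_on E A V Y" by (rule vector_field_on_subset[OF Y(1) G(1) V(3)])
  define yc where "yc z = Y (chart_inv c z) c" for z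
  have yc: "smooth_on (snd c ` V) yc"
    unfolding yc_def[abs_def] by (rule smooth_on_chart_vector_field[OF Y' c G(2)])
  define x0 where "x0 = indep (snd c p)"
  have x0: "x0 \<in> S" unfolding x0_def by (rule G(5)[OF V(2)])
  have base: "join x0 (f x0) = snd c p" unfolding x0_def by (rule graph_at_base(2)[OF c f, symmetric])
  let ?j = "\<lambda>t. join t (f t)"
  have lin: "linear (frechet_derivative f (at x0))" unfolding x0_def by (rule graph_at_linear[OF c f])
  have tang: "dep (yc (?j t)) = frechet_derivative f (at t) (indep (yc (?j t)))" if t: "t \<in> S" for t
  proof -
    let ?q = "chart_inv c (?j t)"
    note q = graph_on_point[OF c V(1) t]
    have "Y ?q \<in> tangent_to A L ?q" using Y(3) q(1,2) V(3) by blast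
    then show ?thesis
      unfolding tangent_to_graph_on[OF c V(1) q(1,2)] yc_def q(3) by simp
  qed
  have df: "(f has_derivative frechet_derivative f (at x0)) (at x0)"
    by (rule has_derivative_frechet[OF smooth_on_differentiable[OF G(4) x0]])
  have dyc: "(yc has_derivative frechet_derivative yc (at (snd c p))) (at (?j x0))"
    unfolding base
    by (rule has_derivative_frechet[OF smooth_on_differentiable[OF yc]]) (use V(2) in blast)
  let ?dY = "\<lambda>v. frechet_derivative yc (at (snd c p)) (lift f x0 v)"
  have dj: "((\<lambda>t. yc (?j t)) has_derivative ?dY) (at x0)"
    by (rule has_derivative_compose[OF has_derivative_join[OF has_derivative_ident df] dyc])
  have d1: "((\<lambda>t. indep (yc (?j t))) has_derivative (\<lambda>v. indep (?dY v))) (at x0)"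
    by (rule bounded_linear.has_derivative[OF bounded_linear_indep dj])
  have d2: "((\<lambda>t. dep (yc (?j t))) has_derivative (\<lambda>v. dep (?dY v))) (at x0)"
    by (rule bounded_linear.has_derivative[OF bounded_linear_dep dj])
  have "((\<lambda>t. dep (yc (?j t))) has_derivative (\<lambda>v. second_derivative f x0 (indep (yc (?j x0))) v
      + frechet_derivative f (at x0) (indep (?dY v)))) (at x0)"
    by (rule has_derivative_transform_within_open[OF has_derivative_directional_derivative[where a = "\<lambda>t. t",
          OF G(3,4) x0 has_derivative_ident d1] G(3) x0])
      (simp add: tang)
  from has_derivative_unique[OF d2 this]
  have *: "dep (?dY v) = second_derivative f x0 (indep (yc (?j x0))) v
      + frechet_derivative f (at x0) (indep (?dY v))" for v by (rule fun_cong)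
  have "chart_inv c (snd c p) = p" by (rule chart_inv_left[OF c charts_atD(2)[OF ch]])
  then have yp: "yc (?j x0) = Y p c" unfolding base yc_def by simp
  have xc: "x c = lift f x0 (indep (x c))" unfolding x0_def by (rule tangent_to_lift[OF c f x])
  have "Y p \<in> tangent_to A L p" using Y(2,3) graph_at_mem[OF f] by blast
  then have yc0: "Y p c = lift f x0 (indep (Y p c))" unfolding x0_def by (rule tangent_to_lift[OF c f])
  have "D p x Y c = ?dY (indep (x c)) + christoffel_form c p (x c) (Y p c)"
    unfolding xc[symmetric] yc_def[abs_def] by (rule covd_coordinates[OF Y(1,2) ch xT])
  then have "normal_part f x0 (D p x Y c) =
      normal_part f x0 (?dY (indep (x c))) + normal_part f x0 (christoffel_form c p (x c) (Y p c))"
    by (simp only: linear_add[OF linear_normal_part[OF lin]])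
  also have "normal_part f x0 (?dY (indep (x c))) = second_derivative f x0 (indep (Y p c)) (indep (x c))"
    unfolding normal_part_def *[of "indep (x c)"] yp by simp
  also have "second_derivative f x0 (indep (Y p c)) (indep (x c)) + normal_part f x0 (christoffel_form c p (x c) (Y p c))
      = geodesic_form c p f (indep (Y p c)) (indep (x c))"
    unfolding geodesic_form_def Let_def x0_def[symmetric] xc[symmetric] yc0[symmetric] ..
  finally show ?thesis unfolding x0_def .
qed

text \<open>
  The extension has constant independent part and, at every point, the slope of \<open>f\<close> at the independent
  coordinates of that point.
\<close>

lemma tangent_extension:
  assumes c: "c \<in> A" and f: "graph_at E c p L f" and y: "y \<in> tangent_to A L p"
  obtains W Y where "vector_field_on E A W Y" "p \<in> W" "\<forall>q\<in>L \<inter> W. Y q \<in> tangent_to A L q" "Y p = y"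
proof -
  obtain W S where W: "graph_on c L f W S" "p \<in> W"
    using graph_at_normal[OF c f openin_topspace graph_at_topspace[OF f]] by blast
  note G = graph_onD[OF W(1)]
  note O = chart_image_open[OF c G(1,2)]
  let ?y = "\<lambda>z. lift f (indep z) (indep (y c))"
  have "smooth_on (snd c ` W) ?y"
  proof (rule smooth_on_join[OF O smooth_on_const])
    show "smooth_on (snd c ` W) (\<lambda>z. frechet_derivative f (at (indep z)) (indep (y c)))"
      by (rule smooth_on_compose[OF O G(3) smooth_on_linear[OF bounded_linear_indep O] smooth_on_derivative[OF G(4)]])
        (use G(5) in blast)
  qed
  from vector_field_tangent_vector[OF c G(1,2) this]
  have vf: "vector_field_on E A W (\<lambda>q. tangent_vector c q (?y (snd c q)))" .
  have "tangent_vector c q (?y (snd c q)) \<in> tangent_to A L q" if "q \<in> L \<inter> W" for q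
    by (rule graph_tangent_vector[OF c graph_on_graph_at[OF W(1)]]) (use that in blast)+
  moreover have "tangent_vector c p (?y (snd c p)) = y"
    unfolding tangent_to_lift[OF c f y, symmetric]
    using tangent_vector_coords[OF _ graph_at_chart[OF c f]] y unfolding tangent_to_graph[OF c f] by blast
  ultimately show ?thesis using that[OF vf W(2)] by blast
qed

lemma second_fundamental_form_coordinates:
  assumes c: "c \<in> A" and f: "graph_at E c p L f" and x: "x \<in> tangent_to A L p" and y: "y \<in> tangent_to A L p"
  shows "second_fundamental_form E A D L p x y =
    {v \<in> tangent_space A p. normal_part f (indep (snd c p)) (v c) = geodesic_form c p f (indep (y c)) (indep (x c))}"
    (is "_ = ?R")
proof -
  have xT: "x \<in> tangent_space A p" using x unfolding tangent_to_graph[OF c f] by blast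
  have "tcoset (tangent_to A L p) (D p x Y) = ?R"
    if "vector_field_on E A W Y" "p \<in> W" "\<forall>q\<in>L \<inter> W. Y q \<in> tangent_to A L q" "Y p = y" for W Y
  proof -
    have "normal_part f (indep (snd c p)) (D p x Y c) = geodesic_form c p f (indep (Y p c)) (indep (x c))"
      by (rule normal_part_covd[OF c f x that(1,2)]) (use that(3) in blast)
    then show ?thesis
      unfolding tcoset_tangent_to[OF c f covd_mem[OF that(1,2) xT]] that(4) by simp
  qed
  moreover obtain W Y where "vector_field_on E A W Y" "p \<in> W" "\<forall>q\<in>L \<inter> W. Y q \<in> tangent_to A L q" "Y p = y"
    by (rule tangent_extension[OF c f y])
  ultimately have "{tcoset (tangent_to A L p) (D p x Y) | W Y. vector_field_on E A W Y \<and> p \<in> W \<and>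
      (\<forall>q\<in>L \<inter> W. Y q \<in> tangent_to A L q) \<and> Y p = y} = {?R}" by blast
  then show ?thesis unfolding second_fundamental_form_def by (simp only: the_elem_eq)
qed

lemma universal_II_jet:
  assumes L: "submanifold E A L" "p \<in> L" and c: "c \<in> A" and f: "graph_at E c p L f"
    and x: "x \<in> tangent_to A L p" and y: "y \<in> tangent_to A L p"
  shows "universal_II E A D (jet E A 2 p L) x y =
    {v \<in> tangent_space A p. normal_part f (indep (snd c p)) (v c) = geodesic_form c p f (indep (y c)) (indep (x c))}"
  unfolding universal_II_def fst_jet
proof (rule the_elem_image_const[OF jet_self[OF _ L]])
  fix L' assume "L' \<in> snd (jet E A 2 p L)"
  then have con: "contact E A 2 p L L'" by (simp add: mem_jet_iff)
  obtain f' where f': "graph_at E c p L' f'" "same_jet 2 f f' (indep (snd c p))"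
    by (rule contact_in_chart[OF _ con c f]) simp
  have fd: "frechet_derivative f (at (indep (snd c p))) = frechet_derivative f' (at (indep (snd c p)))"
    and sd: "second_derivative f (indep (snd c p)) v w = second_derivative f' (indep (snd c p)) v w" for v w
    using f'(2) by (auto simp: same_jet_def)
  note T = contact_tangent_to[OF L contact_2_imp_1[OF con]]
  show "second_fundamental_form E A D L' p x y =
    {v \<in> tangent_space A p. normal_part f (indep (snd c p)) (v c) = geodesic_form c p f (indep (y c)) (indep (x c))}"
    unfolding second_fundamental_form_coordinates[OF c f'(1) x[folded T] y[folded T]]
      normal_part_def geodesic_form_def Let_def fd sd ..
qed simp

lemma totally_geodesic_iff:
  assumes L: "submanifold E A L" "p \<in> L" and c: "c \<in> A" and f: "graph_at E c p L f"
  shows "jet E A 2 p L \<in> totally_geodesic_eq E A D \<longleftrightarrow> (\<forall>v w. geodesic_form c p f v w = 0)"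
proof -
  let ?P = "tangent_to A L p" and ?x = "indep (snd c p)"
  note ch = graph_at_chart[OF c f]
  have II: "universal_II E A D (jet E A 2 p L) x y = ?P \<longleftrightarrow> geodesic_form c p f (indep (y c)) (indep (x c)) = 0"
    if "x \<in> ?P" "y \<in> ?P" for x y
  proof -
    have "tangent_vector c p 0 c = 0" by (rule coordinate_line(2)[OF ch])
    then have "tangent_vector c p 0 \<in> tangent_space A p" "normal_part f ?x (tangent_vector c p 0 c) = 0"
      using tangent_vector_mem[OF ch] linear_0[OF linear_normal_part[OF graph_at_linear[OF c f]]] by simp_all
    then show ?thesis
      unfolding universal_II_jet[OF L c f that] tangent_to_normal[OF c f] by (auto simp: set_eq_iff)
  qed
  have "jet E A 2 p L \<in> jets E A 2" using L by (auto simp: jets_def)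
  then have "jet E A 2 p L \<in> totally_geodesic_eq E A D \<longleftrightarrow>
      (\<forall>x\<in>?P. \<forall>y\<in>?P. universal_II E A D (jet E A 2 p L) x y = ?P)"
    unfolding totally_geodesic_eq_def Let_def mem_Collect_eq jet_proj_jet[OF L] R_plane1_jet[OF L] by blast
  also have "\<dots> \<longleftrightarrow> (\<forall>x\<in>?P. \<forall>y\<in>?P. geodesic_form c p f (indep (y c)) (indep (x c)) = 0)"
    using II by blast
  also have "\<dots> \<longleftrightarrow> (\<forall>v w. geodesic_form c p f v w = 0)"
  proof
    assume *: "\<forall>x\<in>?P. \<forall>y\<in>?P. geodesic_form c p f (indep (y c)) (indep (x c)) = 0"
    have "geodesic_form c p f v w = 0" for v w
    proof -
      have "indep (tangent_vector c p (lift f ?x v) c) = v" for v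
        by (simp only: coordinate_line(2)[OF ch] indep_join)
      then show ?thesis
        using *[rule_format, OF graph_tangent_vector[OF c f, of w] graph_tangent_vector[OF c f, of v]] by simp
    qed
    then show "\<forall>v w. geodesic_form c p f v w = 0" by blast
  qed blast
  finally show ?thesis .
qed

section \<open>The horizontal lift in coordinates\<close>

text \<open>
  In the definition of \<^const>\<open>gamma_dot\<close> the sums over \<open>i\<close> lift the coordinate vector \<open>\<xi>\<close> to the tangent
  space, and the one over \<open>\<beta>\<close> subtracts the tangential part.
\<close>

lemma gamma_dot_jet:
  assumes L: "submanifold E A L" "p \<in> L" and c: "c \<in> A" and f: "graph_at E c p L f"
  defines "x \<equiv> indep (snd c p)"
  shows "gamma_dot E A D c (jet E A 1 p L) a k \<xi> =
    normal_part f x (christoffel_form c p (axis a 1) (lift f x (axis \<xi> 1))) $ k"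
proof -
  let ?G = "christoffel_form c p (axis a 1)"
  let ?df = "frechet_derivative f (at x)"
  have u: "jet_coord E c i [l] (jet E A 1 p L) = ?df (axis l 1) $ i" for i l
    unfolding x_def by (rule jet_coord_jet[OF L c f])
  have "join (axis \<xi> 1) z = axis (Inl \<xi>) 1 + (\<Sum>i\<in>UNIV. (z $ i) *\<^sub>R axis (Inr i) 1)" for z :: "real^'m"
  proof -
    have "join (0 :: real^'n) z = (\<Sum>i\<in>UNIV. (z $ i) *\<^sub>R join 0 (axis i 1))"
      by (rule linear_expand_axis) (use bounded_linear_join_right linear_conv_bounded_linear in blast)
    moreover have "join (0 :: real^'n) (axis i 1 :: real^'m) = axis (Inr i) 1" for i
      by (simp add: join_def axis_def vec_eq_iff split: sum.split)
    moreover have "join (axis \<xi> 1) (0 :: real^'m) = axis (Inl \<xi>) 1"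
      by (simp add: join_def axis_def vec_eq_iff split: sum.split)
    ultimately show ?thesis using join_split[of "axis \<xi> 1" z] by simp
  qed
  then have "?G (lift f x (axis \<xi> 1)) = ?G (axis (Inl \<xi>) 1) + (\<Sum>i\<in>UNIV. (?df (axis \<xi> 1) $ i) *\<^sub>R ?G (axis (Inr i) 1))"
    by (simp add: linear_add[OF bilinear_christoffel_form(2)] linear_sum[OF bilinear_christoffel_form(2)]
        linear_cmul[OF bilinear_christoffel_form(2)])
  then have G: "?G (lift f x (axis \<xi> 1)) $ b = christoffel A D c p a b (Inl \<xi>)
      + (\<Sum>i\<in>UNIV. christoffel A D c p a b (Inr i) * ?df (axis \<xi> 1) $ i)" for b
    by (simp add: christoffel_form_axis mult.commute)
  have "?df (indep (?G (lift f x (axis \<xi> 1)))) =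
      (\<Sum>\<beta>\<in>UNIV. (?G (lift f x (axis \<xi> 1)) $ Inl \<beta>) *\<^sub>R ?df (axis \<beta> 1))"
    using linear_expand_axis[OF graph_at_linear[OF c f], folded x_def, of "indep (?G (lift f x (axis \<xi> 1)))"]
    by (simp add: indep_def)
  then have "normal_part f x (?G (lift f x (axis \<xi> 1))) $ k = ?G (lift f x (axis \<xi> 1)) $ Inr k
      - (\<Sum>\<beta>\<in>UNIV. ?df (axis \<beta> 1) $ k * ?G (lift f x (axis \<xi> 1)) $ Inl \<beta>)"
    by (simp add: normal_part_def dep_def mult.commute)
  then show ?thesis
    unfolding gamma_dot_def Let_def fst_jet u G by simp
qed

lemma vertical_projection_jet:
  assumes L: "submanifold E A L" "p \<in> L" and c: "c \<in> A" and f: "graph_at E c p L f"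
  defines "x \<equiv> indep (snd c p)"
  shows "vertical_projection E A D c (jet E A 1 p L) v $ k $ \<xi> =
    snd (v (jet1_chart E A c)) $ k $ \<xi>
    + normal_part f x (christoffel_form c p (fst (v (jet1_chart E A c))) (lift f x (axis \<xi> 1))) $ k"
proof -
  let ?w = "fst (v (jet1_chart E A c))" and ?n = "\<lambda>z. normal_part f x (christoffel_form c p z (lift f x (axis \<xi> 1)))"
  have "linear (normal_part f x \<circ> (\<lambda>z. christoffel_form c p z (lift f x (axis \<xi> 1))))"
    by (rule linear_compose[OF bilinear_christoffel_form(1) linear_normal_part])
      (use graph_at_linear[OF c f] in \<open>simp add: x_def\<close>)
  from linear_expand_axis[OF this, of ?w]
  have "?n ?w = (\<Sum>a\<in>UNIV. (?w $ a) *\<^sub>R ?n (axis a 1))"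
    unfolding o_def .
  then have "?n ?w $ k = (\<Sum>a\<in>UNIV. ?n (axis a 1) $ k * ?w $ a)"
    by (simp add: mult.commute)
  then show ?thesis
    unfolding vertical_projection_def Let_def gamma_dot_jet[OF L c f] x_def by simp
qed

text \<open>
  This is where both sides of the theorem meet. The second derivative of \<open>f\<close>, which is the normal part
  of the derivative of a tangent field, is also the velocity of the jet coordinates along the
  prolongation, and \<^const>\<open>gamma_dot\<close> contributes the same contraction of the Christoffel symbols as
  the covariant derivative.
\<close>

lemma vertical_projection_prolonged:
  assumes L: "submanifold E A L" "p \<in> L" and c: "c \<in> A" and f: "graph_at E c p L f"
    and w: "w \<in> tangent_to A L p"
    and v: "v (jet1_chart E A c) = prolonged_vector f (indep (snd c p)) (w c)"
  shows "vertical_projection E A D c (jet E A 1 p L) v $ k $ \<xi> = geodesic_form c p f (axis \<xi> 1) (indep (w c)) $ k"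
  unfolding vertical_projection_jet[OF L c f] v prolonged_vector_def geodesic_form_def Let_def
    tangent_to_lift[OF c f w, symmetric] by simp

lemma linear_geodesic_form:
  assumes c: "c \<in> A" and f: "graph_at E c p L f"
  shows "linear (\<lambda>v. geodesic_form c p f v w)"
proof -
  let ?x = "indep (snd c p)"
  obtain S where S: "open S" "smooth_on S f" "?x \<in> S" by (rule graph_at_smooth[OF c f])
  note lin = graph_at_linear[OF c f]
  have "linear (normal_part f ?x \<circ> (christoffel_form c p (lift f ?x w) \<circ> lift f ?x))"
    by (intro linear_compose linear_normal_part linear_lift lin bilinear_christoffel_form(2))
  from linear_compose_add[OF linear_second_derivative_left[OF S] this]
  show ?thesis unfolding geodesic_form_def Let_def o_def .
qed

text \<open>
  A vector in the horizontal lift is determined in each chart of the jet manifold by its projection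
  and by the vanishing of its vertical projection. As the equation holds in all charts, these are
  the coordinates of a prolonged vector in all of them.
\<close>

lemma R_plane2_horizontal:
  assumes L: "submanifold E A L" "p \<in> L"
    and geo: "\<And>c f v w. c \<in> A \<Longrightarrow> graph_at E c p L f \<Longrightarrow> geodesic_form c p f v w = 0"
  shows "R_plane2 E A (jet E A 2 p L) = horizontal_lift E A D (jet E A 1 p L) (tangent_to A L p)"
proof (intro subset_antisym subsetI)
  let ?\<theta> = "jet E A 1 p L"
  obtain c0 f0 where c0: "c0 \<in> A" "graph_at E c0 p L f0" by (rule submanifold_graph[OF L])
  have dom0: "?\<theta> \<in> fst (jet1_chart E A c0)" using mem_jet1_chart_iff[OF L c0(1)] c0(2) by blast
  note ch0 = graph_at_chart[OF c0]
  note push = pushforward_fst[OF _ c0(1) dom0, unfolded fst_jet]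
  {
    fix v assume "v \<in> R_plane2 E A (jet E A 2 p L)"
    then have v: "v \<in> prolonged_vectors L p" unfolding R_plane2_jet[OF L] .
    then have "v \<in> tangent_to J (prolongation E A 1 L) ?\<theta>" unfolding tangent_to_prolongation[OF L] .
    then have vT: "v \<in> tangent_space J ?\<theta>" unfolding tangent_to_def tangent_space_def by blast
    obtain w where w: "w \<in> tangent_to A L p"
      "\<And>c f. c \<in> A \<Longrightarrow> graph_at E c p L f \<Longrightarrow> v (jet1_chart E A c) = prolonged_vector f (indep (snd c p)) (w c)"
      using v unfolding prolonged_vectors_def by blast
    have "w \<in> tangent_space A p" using w(1) unfolding tangent_to_graph[OF c0] by blast
    then have "pushforward J A fst ?\<theta> v = w"
      using push(1)[OF vT] push(2)[OF vT c0(1) dom0] w(2)[OF c0]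
      by (intro tangent_eqI[OF _ _ ch0]) (simp_all add: prolonged_vector_def)
    moreover have "vertical_projection E A D c ?\<theta> v = 0" if c: "c \<in> A" "?\<theta> \<in> fst (jet1_chart E A c)" for c
    proof -
      obtain f where f: "graph_at E c p L f" using mem_jet1_chart_iff[OF L c(1)] c(2) by blast
      show ?thesis
        unfolding vec_eq_iff vertical_projection_prolonged[where v = v, OF L c(1) f w(1) w(2)[OF c(1) f]]
        by (simp add: geo[OF c(1) f])
    qed
    ultimately show "v \<in> horizontal_lift E A D ?\<theta> (tangent_to A L p)"
      unfolding horizontal_lift_def using vT w(1) by blast
  next
    fix v assume v: "v \<in> horizontal_lift E A D ?\<theta> (tangent_to A L p)"
    then have vT: "v \<in> tangent_space J ?\<theta>" unfolding horizontal_lift_def by blast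
    define w where "w = pushforward J A fst ?\<theta> v"
    have w: "w \<in> tangent_to A L p" unfolding w_def using v unfolding horizontal_lift_def by blast
    have "v (jet1_chart E A c) = prolonged_vector f (indep (snd c p)) (w c)"
      if c: "c \<in> A" and f: "graph_at E c p L f" for c f
    proof -
      let ?x = "indep (snd c p)"
      have dom: "?\<theta> \<in> fst (jet1_chart E A c)" using mem_jet1_chart_iff[OF L c] f by blast
      have fst: "fst (v (jet1_chart E A c)) = w c" unfolding w_def by (rule push(2)[OF vT c dom, symmetric])
      have vp: "vertical_projection E A D c ?\<theta> v = 0" using v c dom unfolding horizontal_lift_def by blast
      have "snd (v (jet1_chart E A c)) $ k $ \<xi> = second_derivative f ?x (axis \<xi> 1) (indep (w c)) $ k" for k \<xi>
      proof -
        have "snd (v (jet1_chart E A c)) $ k $ \<xi>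
            + normal_part f ?x (christoffel_form c p (w c) (lift f ?x (axis \<xi> 1))) $ k = 0"
          using vertical_projection_jet[OF L c f, of v k \<xi>] unfolding vp fst by simp
        moreover have "second_derivative f ?x (axis \<xi> 1) (indep (w c)) $ k
            + normal_part f ?x (christoffel_form c p (w c) (lift f ?x (axis \<xi> 1))) $ k = 0"
          using geo[OF c f, of "axis \<xi> 1" "indep (w c)"]
          unfolding geodesic_form_def Let_def tangent_to_lift[OF c f w, symmetric]
          by (simp add: vec_eq_iff)
        ultimately show ?thesis by simp
      qed
      then show ?thesis
        unfolding prolonged_vector_def using fst by (simp add: prod_eq_iff vec_eq_iff)
    qed
    moreover have "v jc = 0" if "jc \<notin> charts_at J ?\<theta>" for jc
    proof -
      obtain \<gamma> where "v = velocity J ?\<theta> \<gamma>" using vT unfolding tangent_space_def by blast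
      then show ?thesis using that by (simp add: velocity_def)
    qed
    ultimately show "v \<in> R_plane2 E A (jet E A 2 p L)"
      unfolding R_plane2_jet[OF L] prolonged_vectors_def using w by blast
  }
qed

text \<open>
  Every tangent vector of \<open>L\<close> has a prolonged vector above it, whose vertical projection vanishes by
  hypothesis.
\<close>

lemma horizontal_imp_geodesic:
  assumes L: "submanifold E A L" "p \<in> L" and c: "c \<in> A" and f: "graph_at E c p L f"
    and eq: "R_plane2 E A (jet E A 2 p L) = horizontal_lift E A D (jet E A 1 p L) (tangent_to A L p)"
  shows "geodesic_form c p f v w = 0"
proof -
  let ?\<theta> = "jet E A 1 p L"
  note ch = graph_at_chart[OF c f]
  have dom: "?\<theta> \<in> fst (jet1_chart E A c)" using mem_jet1_chart_iff[OF L c] f by blast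
  let ?w = "tangent_vector c p (lift f (indep (snd c p)) w)"
  have w: "?w \<in> tangent_to A L p" by (rule graph_tangent_vector[OF c f])
  have wc: "indep (?w c) = w" by (simp only: coordinate_line(2)[OF ch] indep_join)
  obtain u where u: "u \<in> prolonged_vectors L p" "u (jet1_chart E A c) = prolonged_vector f (indep (snd c p)) (?w c)"
    using prolonged_vector_exists[OF L w] c f by metis
  have "u \<in> horizontal_lift E A D ?\<theta> (tangent_to A L p)"
    unfolding eq[symmetric] R_plane2_jet[OF L] by (rule u(1))
  then have vp: "vertical_projection E A D c ?\<theta> u = 0"
    unfolding horizontal_lift_def using c dom by blast
  have "geodesic_form c p f (axis \<xi> 1) w $ k = 0" for \<xi> k
    using vertical_projection_prolonged[where v = u and k = k and \<xi> = \<xi>, OF L c f w u(2)]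
    unfolding wc vp zero_index by (rule sym)
  then have *: "geodesic_form c p f (axis \<xi> 1) w = 0" for \<xi> by (simp add: vec_eq_iff)
  show ?thesis
    by (rule linear_eq_axisI[OF linear_geodesic_form[OF c f] linear_zero *])
qed

lemma totally_geodesic_iff_horizontal:
  assumes L: "submanifold E A L" "p \<in> L"
  shows "jet E A 2 p L \<in> totally_geodesic_eq E A D \<longleftrightarrow>
    R_plane2 E A (jet E A 2 p L) = horizontal_lift E A D (jet E A 1 p L) (R_plane1 A (jet E A 1 p L))"
proof -
  obtain c f where c: "c \<in> A" "graph_at E c p L f" by (rule submanifold_graph[OF L])
  show ?thesis
    unfolding R_plane1_jet[OF L]
    using R_plane2_horizontal[OF L] horizontal_imp_geodesic[OF L c] totally_geodesic_iff[OF L]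
      totally_geodesic_iff[OF L c] by metis
qed

section \<open>Totally geodesic 2-jets over a 1-jet\<close>

lemma quadratic_map_derivatives:
  fixes l :: "real^'n \<Rightarrow> real^'m" and B :: "real^'n \<Rightarrow> real^'n \<Rightarrow> real^'m"
  assumes l: "linear l" and B: "bilinear B" and sym: "\<And>v w. B v w = B w v"
    and h: "h = (\<lambda>x. y0 + l (x - x0) + (1/2) *\<^sub>R B (x - x0) (x - x0))"
  shows "smooth_on UNIV h" "h x0 = y0" "frechet_derivative h (at x0) = l"
    "second_derivative h x0 v w = B v w"
proof -
  have bl: "bounded_linear l" using l linear_conv_bounded_linear by blast
  have bB: "bounded_bilinear B" using B bilinear_conv_bounded_bilinear by blast
  have d: "(h has_derivative (\<lambda>v. l v + B v (x - x0))) (at x)" for x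
  proof -
    have "(h has_derivative (\<lambda>v. 0 + l (v - 0) + (1/2) *\<^sub>R (B (x - x0) (v - 0) + B (v - 0) (x - x0)))) (at x)"
      unfolding h
      by (intro has_derivative_add has_derivative_const has_derivative_scaleR_right
          bounded_bilinear.FDERIV[OF bB] bounded_linear.has_derivative[OF bl]
          has_derivative_diff has_derivative_ident)
    moreover have "0 + l (v - 0) + (1/2) *\<^sub>R (B (x - x0) (v - 0) + B (v - 0) (x - x0)) = l v + B v (x - x0)" for v
      by (simp add: sym[of "x - x0" v] scaleR_2[symmetric])
    ultimately show ?thesis by simp
  qed
  have sx: "smooth_on UNIV (\<lambda>x. x - x0)"
    by (intro smooth_on_diff smooth_on_id smooth_on_const open_UNIV)
  show "smooth_on UNIV h"
    unfolding h
    by (intro smooth_on_add[OF open_UNIV] smooth_on_const smooth_on_linear_comp[OF bl open_UNIV]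
        smooth_on_linear_comp[OF bounded_linear_scaleR_right open_UNIV] smooth_on_bilinear[OF bB open_UNIV] sx)
  show "h x0 = y0"
    unfolding h by (simp add: linear_0[OF l] bounded_bilinear.zero_left[OF bB])
  show "frechet_derivative h (at x0) = l"
    using frechetI[OF d[of x0]] by (simp add: bounded_bilinear.zero_right[OF bB])
  have "((\<lambda>y. l v + B v (y - x0)) has_derivative (\<lambda>w. 0 + B v (w - 0))) (at x0)"
    by (intro has_derivative_add has_derivative_const has_derivative_diff has_derivative_ident
        bounded_linear.has_derivative[OF bounded_bilinear.bounded_linear_right[OF bB]])
  then show "second_derivative h x0 v w = B v w"
    unfolding frechetI[OF d] by (simp add: frechetI)
qed

text \<open>
  The equation prescribes the second derivative of the graphing function in terms of its first one.
  As the connection is torsion-free, the prescribed bilinear map \<open>B\<close> is symmetric; hence it is the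
  second derivative of a quadratic polynomial with the given value and first derivative.
\<close>

lemma geodesic_jet_exists:
  assumes tf: "torsion_free E A D" and L: "submanifold E A L" "p \<in> L"
  obtains L' where "submanifold E A L'" "p \<in> L'" "contact E A 1 p L L'"
    "jet E A 2 p L' \<in> totally_geodesic_eq E A D"
proof -
  obtain c f where c: "c \<in> A" and f: "graph_at E c p L f" by (rule submanifold_graph[OF L])
  note ch = graph_at_chart[OF c f]
  define x where "x = indep (snd c p)"
  note lin = graph_at_linear[OF c f, folded x_def]
  define B where "B v w = - normal_part f x (christoffel_form c p (lift f x w) (lift f x v))" for v w
  have B1: "linear (B v)" for v
  proof -
    have "linear (normal_part f x \<circ> ((\<lambda>z. christoffel_form c p z (lift f x v)) \<circ> lift f x))"
      by (intro linear_compose linear_normal_part linear_lift lin bilinear_christoffel_form(1))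
    from linear_compose_neg[OF this] show ?thesis unfolding B_def[abs_def] o_def .
  qed
  have sym: "B v w = B w v" for v w
    unfolding B_def using christoffel_form_symmetric[OF tf ch] by metis
  have "(\<lambda>v. B v w) = B w" for w using sym by blast
  then have "bilinear B" unfolding bilinear_def using B1 by simp
  define h where "h = (\<lambda>z. f x + frechet_derivative f (at x) (z - x) + (1/2) *\<^sub>R B (z - x) (z - x))"
  note q = quadratic_map_derivatives[OF lin \<open>bilinear B\<close> sym h_def]
  define L' where "L' = {q \<in> fst c. dep (snd c q) = h (indep (snd c q))}"
  have graph: "graph_at E c q L' h" if "q \<in> L'" for q
    unfolding graph_at_def
  proof (intro conjI exI)
    show "smooth_on (indep ` snd c ` fst c) h" by (rule smooth_on_subset[OF q(1)]) simp
  qed (use that chart_open[OF c] in \<open>auto simp: L'_def\<close>)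
  have sub: "submanifold E A L'"
    unfolding submanifold_def
  proof (intro conjI ballI)
    show "L' \<subseteq> topspace E" using openin_subset[OF chart_open[OF c]] by (auto simp: L'_def)
    show "\<exists>c\<in>charts_at A q. \<exists>f. graph_at E c q L' f" if "q \<in> L'" for q
      using graph[OF that] graph_at_chart[OF c graph[OF that]] by blast
  qed
  have pL': "p \<in> L'"
    unfolding L'_def using charts_atD(2)[OF ch] graph_at_base(1)[OF c f, folded x_def] q(2)
    by (simp add: x_def[symmetric])
  have "same_jet 1 f h x" unfolding same_jet_def q(2,3) by simp
  then have "contact E A 1 p L L'"
    unfolding x_def by (intro contactI[OF _ c f graph[OF pL']]) simp_all
  moreover have "geodesic_form c p h v w = 0" for v w
    unfolding geodesic_form_def Let_def x_def[symmetric] normal_part_def q(3,4)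
    unfolding B_def normal_part_def by simp
  then have "jet E A 2 p L' \<in> totally_geodesic_eq E A D"
    using totally_geodesic_iff[OF sub pL' c graph[OF pL']] by blast
  ultimately show ?thesis using that[OF sub pL'] by blast
qed

lemma geodesic_jet_unique:
  assumes L: "submanifold E A L" "p \<in> L" and L': "submanifold E A L'" "p \<in> L'"
    and con: "contact E A 1 p L L'"
    and geo: "jet E A 2 p L \<in> totally_geodesic_eq E A D" "jet E A 2 p L' \<in> totally_geodesic_eq E A D"
  shows "jet E A 2 p L = jet E A 2 p L'"
proof -
  obtain c f where c: "c \<in> A" and f: "graph_at E c p L f" by (rule submanifold_graph[OF L])
  obtain f' where f': "graph_at E c p L' f'" "same_jet 1 f f' (indep (snd c p))"
    by (rule contact_in_chart[OF _ con c f]) simp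
  let ?x = "indep (snd c p)"
  have d1: "frechet_derivative f (at ?x) = frechet_derivative f' (at ?x)"
    using f'(2) by (auto simp: same_jet_def)
  have "second_derivative f ?x v w = second_derivative f' ?x v w" for v w
  proof -
    have "geodesic_form c p f v w = 0" "geodesic_form c p f' v w = 0"
      using totally_geodesic_iff[OF L c f] totally_geodesic_iff[OF L' c f'(1)] geo by blast+
    then show ?thesis unfolding geodesic_form_def Let_def normal_part_def d1 by (simp add: add_eq_0_iff2)
  qed
  then have "same_jet 2 f f' ?x" using f'(2) by (simp add: same_jet_def)
  then have "contact E A 2 p L L'" by (intro contactI[OF _ c f f'(1)]) simp_all
  then show ?thesis by (intro jet_eqI[OF _ L L']) simp_all
qed

end

theorem proposition1:
  fixes E :: "'e topology"
    and A :: "('e, real^('n::finite + 'm::finite)) chart set"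
    and D :: "('e, real^('n + 'm)) covd"
  assumes "smooth_manifold E A"
    and "linear_connection E A D"
    and "torsion_free E A D"
  shows "gamma_ddot E A D ` jets E A 1 = totally_geodesic_eq E A D"
proof -
  interpret graph_connection E A D
    by unfold_locales (fact assms)+
  let ?S = "totally_geodesic_eq E A D"
  let ?lift = "\<lambda>\<theta>1 \<theta>2. \<theta>2 \<in> jets E A 2 \<and> jet_proj E A 1 \<theta>2 = \<theta>1 \<and>
        R_plane2 E A \<theta>2 = horizontal_lift E A D \<theta>1 (R_plane1 A \<theta>1)"
  have S: "?lift \<theta>1 \<theta>2 \<longleftrightarrow> \<theta>2 \<in> ?S \<and> jet_proj E A 1 \<theta>2 = \<theta>1" for \<theta>1 \<theta>2
  proof (cases "\<theta>2 \<in> jets E A 2")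
    case True
    then obtain p L where L: "submanifold E A L" "p \<in> L" and \<theta>2: "\<theta>2 = jet E A 2 p L"
      unfolding jets_def by blast
    show ?thesis
      unfolding \<theta>2 jet_proj_jet[OF L] totally_geodesic_iff_horizontal[OF L] using True \<theta>2 by blast
  next
    case False
    then show ?thesis unfolding totally_geodesic_eq_def by blast
  qed
  have unique: "\<theta>2 = \<theta>2'" if hyps: "\<theta>2 \<in> ?S" "\<theta>2' \<in> ?S" "jet_proj E A 1 \<theta>2 = jet_proj E A 1 \<theta>2'" for \<theta>2 \<theta>2'
  proof -
    obtain p L where L: "submanifold E A L" "p \<in> L" and \<theta>2: "\<theta>2 = jet E A 2 p L"
      using hyps(1) unfolding totally_geodesic_eq_def jets_def by blast
    obtain p' L' where L': "submanifold E A L'" "p' \<in> L'" and \<theta>2': "\<theta>2' = jet E A 2 p' L'"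
      using hyps(2) unfolding totally_geodesic_eq_def jets_def by blast
    have eq: "jet E A 1 p L = jet E A 1 p' L'"
      using hyps(3) unfolding \<theta>2 \<theta>2' jet_proj_jet[OF L] jet_proj_jet[OF L'] .
    then have p: "p' = p" by (metis fst_jet)
    have "contact E A 1 p L L'"
      by (rule jet_eqD[OF _ L'[unfolded p] eq[unfolded p]]) simp
    then show ?thesis
      using geodesic_jet_unique[OF L L'[unfolded p]] hyps(1,2) unfolding \<theta>2 \<theta>2' p by blast
  qed
  have gamma: "gamma_ddot E A D (jet_proj E A 1 \<theta>2) = \<theta>2" if "\<theta>2 \<in> ?S" for \<theta>2
    unfolding gamma_ddot_def S by (rule the_equality) (use that unique in blast)+
  show ?thesis
  proof (intro subset_antisym subsetI)
    fix \<theta>2 assume "\<theta>2 \<in> gamma_ddot E A D ` jets E A 1"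
    then obtain p L where L: "submanifold E A L" "p \<in> L" and \<theta>2: "\<theta>2 = gamma_ddot E A D (jet E A 1 p L)"
      unfolding jets_def by blast
    obtain L' where L': "submanifold E A L'" "p \<in> L'" "contact E A 1 p L L'" "jet E A 2 p L' \<in> ?S"
      by (rule geodesic_jet_exists[OF assms(3) L])
    have "jet E A 1 p L = jet_proj E A 1 (jet E A 2 p L')"
      unfolding jet_proj_jet[OF L'(1,2)] by (rule jet_eqI[OF _ L L'(1,2,3)]) simp
    then show "\<theta>2 \<in> ?S" unfolding \<theta>2 using gamma[OF L'(4)] L'(4) by metis
  next
    fix \<theta>2 assume \<theta>2: "\<theta>2 \<in> ?S"
    then have "\<theta>2 \<in> jets E A 2" unfolding totally_geodesic_eq_def by blast
    then obtain p L where L: "submanifold E A L" "p \<in> L" "\<theta>2 = jet E A 2 p L"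
      unfolding jets_def by blast
    have "jet_proj E A 1 \<theta>2 \<in> jets E A 1"
      unfolding L(3) jet_proj_jet[OF L(1,2)] jets_def using L(1,2) by blast
    then show "\<theta>2 \<in> gamma_ddot E A D ` jets E A 1"
      using gamma[OF \<theta>2] by (metis imageI)
  qed
qed

end
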